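(* Let $f\in\mathrm{Frac}(\mathcal{A})$. Assume that $f$ has at most a simple pole at all points $z\in F^{\mathrm{s}}$, $z\ne0$ (i.e. $\mathrm{ord}_z(f)\ge -1$ for all such $z$). Then $$\sum_{z \in F^{\mathrm{s}} \sqcup \{\infty\}} \mathrm{sres}_{z,j}(f) = 0$$ in $K\otimes_F F^{\mathrm{s}}$, for all $j\in\{0,1,\ldots,r-1\}$.
   Context: Let $K$ be a field with an automorphism $\theta$ of finite order $r$, and $F = \{a\in K : \theta(a)=a\}$. Let $\mathcal{A} = K[X^{\pm 1};\theta]$ (skew Laurent polynomials, $Xa = \theta(a)X$ for $a\in K$), $Y = X^r$, $\mathcal{C} = K[Y^{\pm1}]$, and $\mathcal{Z} = F[Y^{\pm 1}]$ (the centre of $\mathcal{A}$). $\mathrm{Frac}(\mathcal{A}) = \mathrm{Frac}(\mathcal{Z})\otimes_{\mathcal{Z}}\mathcal{A}$ is the skew field of fractions of $\mathcal{A}$. A "$K$-algebra" is a ring $B$ with a ring homomorphism $K\to B$ (image not necessarily central). Section operators: for $j\in\mathbb{Z}$, $\sigma_j:\mathcal{A}\to\mathcal{C}$ is $\sigma_j(\sum_i a_iX^i)=\sum_i a_{j+ir}Y^i$; it is $\mathcal{Z}$-linear and extends to $\mathrm{Frac}(\mathcal{A})\to\mathrm{Frac}(\mathcal{C})$, to $\mathcal{A}/N\mathcal{A}\to\mathcal{C}/N\mathcal{C}$ for $N \in \mathcal{Z}$, and coefficientwise to series in $T$. Fix a separable closure $F^{\mathrm{s}}$ of $F$ and an embedding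 $K\hookrightarrow F^{\mathrm{s}}$. Let $z\in F^{\mathrm{s}}$, $z\ne0$, with minimal polynomial $N\in F[Y]$ over $F$; identify $\mathcal{Z}/N\mathcal{Z}$ with $F(z)$ via $Y\mapsto z$, so $z$ also denotes the class of $Y$ in $\mathcal{Z}/N\mathcal{Z}$. Let $\hat{\mathcal{A}}_N=\varprojlim_m\mathcal{A}/N^m\mathcal{A}$. A morphism of $K$-algebras $\tau:\hat{\mathcal{A}}_N\to(\mathcal{A}/N\mathcal{A})[[T]]$ ($T$ central) is $z$-admissible if $\tau(X)\equiv X\pmod T$ and $\tau(Y)=z+T$. For each such $z$ a $z$-admissible morphism $\tau_z$ is chosen, and $\mathrm{TS}_z:\mathrm{Frac}(\mathcal{A})=\mathrm{Frac}(\mathcal{Z})\otimes_{\mathcal{Z}}\mathcal{A}\to\mathrm{Frac}(\mathcal{Z})\otimes_{\mathcal{Z}}\hat{\mathcal{A}}_N\to(\mathcal{A}/N\mathcal{A})((T))$ is the map induced by $\tau_z$. The order $\mathrm{ord}_z(f)$ is the $T$-adic valuation of $\mathrm{TS}_z(f)$ (it does not depend on the choice of $\tau_z$). Let $\iota_z:\mathcal{C}/N\mathcal{C}\to K\otimes_F F^{\mathrm{s}}$ be the $K$-linear extension of $\mathcal{Z}/N\mathcal{Z}\hookrightarrow F^{\mathrm{s}}$, $Y\mapsto z$. For $f\in\mathrm{Frac}(\mathcal{A})$, $\mathrm{sres}_z(f)\in\mathcal{A}/N\mathcal{A}$ is the coefficient of $T^{-1}$ in $\mathrm{TS}_z(f)$,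 and for $0\le j<r$ the $j$-th partial skew residue is $\mathrm{sres}_{z,j}(f)=\iota_z(\sigma_j(\mathrm{sres}_z(f)))\in K\otimes_F F^{\mathrm{s}}$. At $0$: $\mathrm{TS}_0:\mathrm{Frac}(\mathcal{A})\to K((X;\theta))$ is the canonical embedding into the ring of skew Laurent series (with $Xc=\theta(c)X$), induced by $\mathrm{Frac}(\mathcal{Z})=F(Y)\subset F((Y))$; $\mathrm{sres}_{0,j}(f)$ is the coefficient of $X^{j-r}$ in $\mathrm{TS}_0(f)$. At $\infty$: with $\tilde X=X^{-1}$, $\mathrm{TS}_\infty:\mathrm{Frac}(\mathcal{A})\to K((\tilde X;\theta^{-1}))$ is the analogous expansion, and $\mathrm{sres}_{\infty,j}(f)$ is the opposite of the coefficient of $\tilde X^{r-j}$ in $\mathrm{TS}_\infty(f)$. Both are elements of $K$, viewed in $K\otimes_FF^{\mathrm{s}}$ via $c\mapsto c\otimes1$. The sum over $z$ is over its finitely many nonzero terms.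
   Formalization: It is additionally assumed that all nonzero finite poles of f lie in F^s (some denominator of f in F[Y] splits over F^s), which is automatic for perfect F; otherwise Y^(p-1)/(Y^p-a), with K=F, θ=id and a not a p-th power, is a counterexample. *)

theory Defs
  imports "HOL-Algebra.Algebraic_Closure_Type" "HOL-Algebra.Free_Abelian_Groups"
    "HOL-Library.Extended"
begin

section \<open>Skew Laurent series and skew Laurent polynomials\<close>

definition int_pow_map :: "('a, 'b) ring_scheme \<Rightarrow> ('a \<Rightarrow> 'a) \<Rightarrow> int \<Rightarrow> 'a \<Rightarrow> 'a" where
  "int_pow_map R \<theta> n =
     (if 0 \<le> n then \<theta> ^^ nat n else inv_into (carrier R) \<theta> ^^ nat (- n))"

text \<open>
  The ring \<open>R((X; \<theta>))\<close>, with \<open>X c = \<theta>(c) X\<close>. A series \<open>\<Sum> a\<^sub>n X\<^sup>n\<close> (coefficients on the left) is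
  represented by the function \<open>n \<mapsto> a\<^sub>n\<close>. For \<open>\<theta> = id\<close> the variable is central.
\<close>

definition skew_laurent_series ::
  "('a, 'b) ring_scheme \<Rightarrow> ('a \<Rightarrow> 'a) \<Rightarrow> (int \<Rightarrow> 'a) ring" where
  "skew_laurent_series R \<theta> =
     \<lparr>carrier = {f. (\<forall>n. f n \<in> carrier R) \<and> (\<exists>n0. \<forall>n<n0. f n = \<zero>\<^bsub>R\<^esub>)},
      monoid.mult = (\<lambda>f g n. finsum R (\<lambda>i. f i \<otimes>\<^bsub>R\<^esub> int_pow_map R \<theta> i (g (n - i)))
                        {i. f i \<noteq> \<zero>\<^bsub>R\<^esub> \<and> g (n - i) \<noteq> \<zero>\<^bsub>R\<^esub>}),
      one = (\<lambda>n. if n = 0 then \<one>\<^bsub>R\<^esub> else \<zero>\<^bsub>R\<^esub>),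
      ring.zero = (\<lambda>_. \<zero>\<^bsub>R\<^esub>),
      add = (\<lambda>f g n. f n \<oplus>\<^bsub>R\<^esub> g n)\<rparr>"

definition skew_laurent_poly ::
  "('a, 'b) ring_scheme \<Rightarrow> ('a \<Rightarrow> 'a) \<Rightarrow> (int \<Rightarrow> 'a) ring" where
  "skew_laurent_poly R \<theta> = (skew_laurent_series R \<theta>)
     \<lparr>carrier := {f. (\<forall>n. f n \<in> carrier R) \<and> finite {n. f n \<noteq> \<zero>\<^bsub>R\<^esub>}}\<rparr>"

definition power_series :: "('a, 'b) ring_scheme \<Rightarrow> (int \<Rightarrow> 'a) ring" where
  "power_series R = (skew_laurent_series R id)
     \<lparr>carrier := {f \<in> carrier (skew_laurent_series R id). \<forall>n<0. f n = \<zero>\<^bsub>R\<^esub>}\<rparr>"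

definition laurent_monom :: "('a, 'b) ring_scheme \<Rightarrow> 'a \<Rightarrow> int \<Rightarrow> int \<Rightarrow> 'a" where
  "laurent_monom R c n = (\<lambda>i. if i = n then c else \<zero>\<^bsub>R\<^esub>)"

definition laurent_ord :: "('a, 'b) ring_scheme \<Rightarrow> (int \<Rightarrow> 'a) \<Rightarrow> int extended" where
  "laurent_ord R g =
     (if \<forall>n. g n = \<zero>\<^bsub>R\<^esub> then Pinf else Fin (LEAST n. g n \<noteq> \<zero>\<^bsub>R\<^esub>))"


section \<open>Adic completion at an element\<close>

definition adic_ideal :: "('a, 'b) ring_scheme \<Rightarrow> 'a \<Rightarrow> nat \<Rightarrow> 'a set" where
  "adic_ideal R N m = PIdl\<^bsub>R\<^esub> (N [^]\<^bsub>R\<^esub> m)"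

text \<open>
  The inverse limit of the rings \<open>R/N\<^sup>mR\<close>, for \<open>N\<close> central in \<open>R\<close>: compatible sequences of classes,
  with componentwise operations.
\<close>

definition adic_completion :: "('a, 'b) ring_scheme \<Rightarrow> 'a \<Rightarrow> (nat \<Rightarrow> 'a set) ring" where
  "adic_completion R N =
     \<lparr>carrier = {x. (\<forall>m. x m \<in> carrier (R Quot adic_ideal R N m)) \<and>
                    (\<forall>m. \<forall>a\<in>x (Suc m). adic_ideal R N m +>\<^bsub>R\<^esub> a = x m)},
      monoid.mult = (\<lambda>x y m. x m \<otimes>\<^bsub>R Quot adic_ideal R N m\<^esub> y m),
      one = (\<lambda>m. \<one>\<^bsub>R Quot adic_ideal R N m\<^esub>),
      ring.zero = (\<lambda>m. \<zero>\<^bsub>R Quot adic_ideal R N m\<^esub>),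
      add = (\<lambda>x y m. x m \<oplus>\<^bsub>R Quot adic_ideal R N m\<^esub> y m)\<rparr>"

definition to_completion :: "('a, 'b) ring_scheme \<Rightarrow> 'a \<Rightarrow> 'a \<Rightarrow> nat \<Rightarrow> 'a set" where
  "to_completion R N a = (\<lambda>m. adic_ideal R N m +>\<^bsub>R\<^esub> a)"


section \<open>The rings attached to a field with an automorphism of finite order\<close>

abbreviation type_ring :: "'k::field ring" where
  "type_ring \<equiv> ring_of_type_algebra"

definition has_order :: "('a \<Rightarrow> 'a) \<Rightarrow> nat \<Rightarrow> bool" where
  "has_order \<theta> r \<longleftrightarrow> 0 < r \<and> \<theta> ^^ r = id \<and> (\<forall>m. 0 < m \<and> m < r \<longrightarrow> \<theta> ^^ m \<noteq> id)"

definition fixed_field :: "('k \<Rightarrow> 'k) \<Rightarrow> 'k set" where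
  "fixed_field \<theta> = {a. \<theta> a = a}"

abbreviation ring_A :: "('k::field \<Rightarrow> 'k) \<Rightarrow> (int \<Rightarrow> 'k) ring" where
  "ring_A \<theta> \<equiv> skew_laurent_poly type_ring \<theta>"

text \<open>\<open>\<C> = K[Y\<^sup>\<plusminus>\<^sup>1]\<close>, whose elements are indexed by the exponent of \<open>Y\<close> (not of \<open>X\<close>).\<close>

abbreviation ring_C :: "(int \<Rightarrow> 'k::field) ring" where
  "ring_C \<equiv> skew_laurent_poly type_ring id"

text \<open>\<open>\<Z> = F[Y\<^sup>\<plusminus>\<^sup>1]\<close>, as a subset of \<open>\<A>\<close> via \<open>Y = X\<^sup>r\<close>.\<close>

definition center_Z :: "('k::field \<Rightarrow> 'k) \<Rightarrow> nat \<Rightarrow> (int \<Rightarrow> 'k) set" where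
  "center_Z \<theta> r = {a \<in> carrier (ring_A \<theta>).
     \<forall>n. a n \<in> fixed_field \<theta> \<and> (a n \<noteq> 0 \<longrightarrow> int r dvd n)}"

text \<open>
  The Laurent polynomial \<open>p(X\<^sup>d)\<close>. An element of \<open>F[Y]\<close> is viewed in \<open>\<A>\<close> with \<open>d = r\<close>
  and in \<open>\<C>\<close> with \<open>d = 1\<close>.
\<close>

definition poly_at_power :: "nat \<Rightarrow> 'k::field poly \<Rightarrow> int \<Rightarrow> 'k" where
  "poly_at_power d p =
     (\<lambda>n. if 0 \<le> n \<and> int d dvd n then Polynomial.coeff p (nat (n div int d)) else 0)"


section \<open>The skew field of fractions\<close>

text \<open>
  \<open>Frac(\<Z>) \<otimes>\<^sub>\<Z> \<A>\<close> is the localization of \<open>\<A>\<close> at the central set \<open>\<Z> - {0}\<close>. The pair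
  \<open>(P, D)\<close> represents \<open>D\<^sup>-\<^sup>1 P\<close>.
\<close>

definition frac_rel ::
  "('k::field \<Rightarrow> 'k) \<Rightarrow> nat \<Rightarrow> (((int \<Rightarrow> 'k) \<times> (int \<Rightarrow> 'k)) \<times> ((int \<Rightarrow> 'k) \<times> (int \<Rightarrow> 'k))) set" where
  "frac_rel \<theta> r = {((P, D), (Q, E)).
     P \<in> carrier (ring_A \<theta>) \<and> Q \<in> carrier (ring_A \<theta>) \<and>
     D \<in> center_Z \<theta> r - {\<zero>\<^bsub>ring_A \<theta>\<^esub>} \<and> E \<in> center_Z \<theta> r - {\<zero>\<^bsub>ring_A \<theta>\<^esub>} \<and>
     E \<otimes>\<^bsub>ring_A \<theta>\<^esub> P = D \<otimes>\<^bsub>ring_A \<theta>\<^esub> Q}"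

definition frac_A :: "('k::field \<Rightarrow> 'k) \<Rightarrow> nat \<Rightarrow> ((int \<Rightarrow> 'k) \<times> (int \<Rightarrow> 'k)) set set" where
  "frac_A \<theta> r =
     (carrier (ring_A \<theta>) \<times> (center_Z \<theta> r - {\<zero>\<^bsub>ring_A \<theta>\<^esub>})) // frac_rel \<theta> r"

text \<open>
  The map \<open>D\<^sup>-\<^sup>1 P \<mapsto> \<phi>(D)\<^sup>-\<^sup>1 \<phi>(P)\<close> induced on fractions by a ring homomorphism \<open>\<phi>\<close> from \<open>\<A>\<close> to \<open>S\<close>
  sending \<open>\<Z> - {0}\<close> to units; the image of the class \<open>f\<close> is then a singleton.
\<close>

definition frac_extend ::
  "('c, 'd) ring_scheme \<Rightarrow> ('a \<Rightarrow> 'c) \<Rightarrow> ('a \<times> 'a) set \<Rightarrow> 'c" where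
  "frac_extend S \<phi> f = the_elem ((\<lambda>(P, D). inv\<^bsub>S\<^esub> (\<phi> D) \<otimes>\<^bsub>S\<^esub> \<phi> P) ` f)"


section \<open>Minimal polynomials and the separable closure\<close>

text \<open>
  Throughout, \<open>e\<close> is the embedding of \<open>K\<close> into the separable closure \<open>F\<^sup>s\<close>, and \<open>F \<subseteq> K\<close> is embedded
  into \<open>F\<^sup>s\<close> by the restriction of \<open>e\<close>. Polynomials over \<open>F\<close> are polynomials over \<open>K\<close> with
  coefficients in \<open>F\<close>.
\<close>

definition poly_over :: "'k::zero set \<Rightarrow> 'k poly \<Rightarrow> bool" where
  "poly_over F p \<longleftrightarrow> (\<forall>i. Polynomial.coeff p i \<in> F)"

definition annihilates :: "'k::field set \<Rightarrow> ('k \<Rightarrow> 'l::field) \<Rightarrow> 'l \<Rightarrow> 'k poly \<Rightarrow> bool" where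
  "annihilates F e z p \<longleftrightarrow> p \<noteq> 0 \<and> poly_over F p \<and> poly (map_poly e p) z = 0"

definition min_poly :: "'k::field set \<Rightarrow> ('k \<Rightarrow> 'l::field) \<Rightarrow> 'l \<Rightarrow> 'k poly" where
  "min_poly F e z = (THE p. annihilates F e z p \<and> lead_coeff p = 1 \<and>
     (\<forall>q. annihilates F e z q \<longrightarrow> Polynomial.degree p \<le> Polynomial.degree q))"

definition separable_poly :: "'a::field poly \<Rightarrow> bool" where
  "separable_poly p \<longleftrightarrow> coprime p (pderiv p)"

definition separable_closure :: "'k::field set \<Rightarrow> ('k \<Rightarrow> 'l::field) \<Rightarrow> bool" where
  "separable_closure F e \<longleftrightarrow>
     (\<forall>z. (\<exists>p. annihilates F e z p) \<and> separable_poly (min_poly F e z)) \<and>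
     (\<forall>p :: 'l poly. separable_poly p \<and> 0 < Polynomial.degree p \<longrightarrow> (\<exists>z. poly p z = 0))"


section \<open>The tensor product of \<open>K\<close> and \<open>F\<^sup>s\<close> over \<open>F\<close>\<close>

text \<open>
  The underlying abelian group, as a quotient of the free abelian group on \<open>K \<times> F\<^sup>s\<close>. As for free
  abelian groups in the library, its addition is the multiplication of the record and its zero is
  the unit.
\<close>

definition tensor_relations :: "'k::field set \<Rightarrow> ('k \<Rightarrow> 'l::field) \<Rightarrow> ('k \<times> 'l \<Rightarrow>\<^sub>0 int) set" where
  "tensor_relations F e = generate (free_Abelian_group UNIV)
     ({frag_of (a + b, x) - frag_of (a, x) - frag_of (b, x) | a b x. True} \<union>
      {frag_of (a, x + y) - frag_of (a, x) - frag_of (a, y) | a x y. True} \<union>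
      {frag_of (c * a, x) - frag_of (a, e c * x) | c a x. c \<in> F})"

definition tensor_product ::
  "'k::field set \<Rightarrow> ('k \<Rightarrow> 'l::field) \<Rightarrow> ('k \<times> 'l \<Rightarrow>\<^sub>0 int) set monoid" where
  "tensor_product F e = free_Abelian_group UNIV Mod tensor_relations F e"

definition pure_tensor ::
  "'k::field set \<Rightarrow> ('k \<Rightarrow> 'l::field) \<Rightarrow> 'k \<Rightarrow> 'l \<Rightarrow> ('k \<times> 'l \<Rightarrow>\<^sub>0 int) set" where
  "pure_tensor F e a x = tensor_relations F e #>\<^bsub>free_Abelian_group UNIV\<^esub> frag_of (a, x)"


section \<open>Taylor expansions, orders and partial skew residues\<close>

definition min_poly_A :: "('k::field \<Rightarrow> 'k) \<Rightarrow> nat \<Rightarrow> ('k \<Rightarrow> 'l::field) \<Rightarrow> 'l \<Rightarrow> int \<Rightarrow> 'k" where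
  "min_poly_A \<theta> r e z = poly_at_power r (min_poly (fixed_field \<theta>) e z)"

definition quot_A :: "('k::field \<Rightarrow> 'k) \<Rightarrow> (int \<Rightarrow> 'k) \<Rightarrow> (int \<Rightarrow> 'k) set ring" where
  "quot_A \<theta> N = ring_A \<theta> Quot (PIdl\<^bsub>ring_A \<theta>\<^esub> N)"

definition class_A :: "('k::field \<Rightarrow> 'k) \<Rightarrow> (int \<Rightarrow> 'k) \<Rightarrow> (int \<Rightarrow> 'k) \<Rightarrow> (int \<Rightarrow> 'k) set" where
  "class_A \<theta> N a = PIdl\<^bsub>ring_A \<theta>\<^esub> N +>\<^bsub>ring_A \<theta>\<^esub> a"

text \<open>
  The conditions, in order: \<open>\<tau>\<close> is a ring homomorphism, it is compatible with the maps from \<open>K\<close>,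
  \<open>\<tau>(X) \<equiv> X\<close> modulo \<open>T\<close>, and \<open>\<tau>(Y) = z + T\<close>, where \<open>z\<close> is the class of \<open>Y = X\<^sup>r\<close> modulo \<open>N\<close>.
\<close>

definition admissible ::
  "('k::field \<Rightarrow> 'k) \<Rightarrow> nat \<Rightarrow> (int \<Rightarrow> 'k) \<Rightarrow>
     ((nat \<Rightarrow> (int \<Rightarrow> 'k) set) \<Rightarrow> int \<Rightarrow> (int \<Rightarrow> 'k) set) \<Rightarrow> bool" where
  "admissible \<theta> r N \<tau> \<longleftrightarrow>
     \<tau> \<in> ring_hom (adic_completion (ring_A \<theta>) N) (power_series (quot_A \<theta> N)) \<and>
     (\<forall>c. \<tau> (to_completion (ring_A \<theta>) N (laurent_monom type_ring c 0)) =
            laurent_monom (quot_A \<theta> N) (class_A \<theta> N (laurent_monom type_ring c 0)) 0) \<and>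
     \<tau> (to_completion (ring_A \<theta>) N (laurent_monom type_ring 1 1)) 0 =
       class_A \<theta> N (laurent_monom type_ring 1 1) \<and>
     \<tau> (to_completion (ring_A \<theta>) N (laurent_monom type_ring 1 (int r))) =
       laurent_monom (quot_A \<theta> N) (class_A \<theta> N (laurent_monom type_ring 1 (int r))) 0
         \<oplus>\<^bsub>power_series (quot_A \<theta> N)\<^esub> laurent_monom (quot_A \<theta> N) \<one>\<^bsub>quot_A \<theta> N\<^esub> 1"

definition TS_at ::
  "('k::field \<Rightarrow> 'k) \<Rightarrow> (int \<Rightarrow> 'k) \<Rightarrow>
     ((nat \<Rightarrow> (int \<Rightarrow> 'k) set) \<Rightarrow> int \<Rightarrow> (int \<Rightarrow> 'k) set) \<Rightarrow>
     ((int \<Rightarrow> 'k) \<times> (int \<Rightarrow> 'k)) set \<Rightarrow> int \<Rightarrow> (int \<Rightarrow> 'k) set" where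
  "TS_at \<theta> N \<tau> =
     frac_extend (skew_laurent_series (quot_A \<theta> N) id) (\<lambda>a. \<tau> (to_completion (ring_A \<theta>) N a))"

definition TS_zero ::
  "('k::field \<Rightarrow> 'k) \<Rightarrow> ((int \<Rightarrow> 'k) \<times> (int \<Rightarrow> 'k)) set \<Rightarrow> int \<Rightarrow> 'k" where
  "TS_zero \<theta> = frac_extend (skew_laurent_series type_ring \<theta>) id"

text \<open>The substitution \<open>n \<mapsto> -n\<close> rewrites powers of \<open>X\<close> as powers of \<open>X\<^sup>-\<^sup>1\<close>.\<close>

definition TS_infinity ::
  "('k::field \<Rightarrow> 'k) \<Rightarrow> ((int \<Rightarrow> 'k) \<times> (int \<Rightarrow> 'k)) set \<Rightarrow> int \<Rightarrow> 'k" where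
  "TS_infinity \<theta> =
     frac_extend (skew_laurent_series type_ring (inv_into UNIV \<theta>)) (\<lambda>a n. a (- n))"

definition ord_at ::
  "('k::field \<Rightarrow> 'k) \<Rightarrow> (int \<Rightarrow> 'k) \<Rightarrow>
     ((nat \<Rightarrow> (int \<Rightarrow> 'k) set) \<Rightarrow> int \<Rightarrow> (int \<Rightarrow> 'k) set) \<Rightarrow>
     ((int \<Rightarrow> 'k) \<times> (int \<Rightarrow> 'k)) set \<Rightarrow> int extended" where
  "ord_at \<theta> N \<tau> f = laurent_ord (quot_A \<theta> N) (TS_at \<theta> N \<tau> f)"

definition section_op :: "nat \<Rightarrow> int \<Rightarrow> (int \<Rightarrow> 'k) \<Rightarrow> int \<Rightarrow> 'k" where
  "section_op r j a = (\<lambda>i. a (j + i * int r))"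

text \<open>
  The operator induced by \<open>\<sigma>\<^sub>j\<close> from \<open>\<A>/N\<A>\<close> to \<open>\<C>/N\<C>\<close>: since \<open>\<sigma>\<^sub>j\<close> is additive and
  \<open>\<sigma>\<^sub>j(N\<A>) = N\<C>\<close>, the image of the coset of \<open>a\<close> is the coset of \<open>\<sigma>\<^sub>j(a)\<close>.
\<close>

definition section_quot :: "nat \<Rightarrow> int \<Rightarrow> (int \<Rightarrow> 'k) set \<Rightarrow> (int \<Rightarrow> 'k) set" where
  "section_quot r j c = section_op r j ` c"

text \<open>
  The \<open>K\<close>-linear map \<open>\<iota>\<^sub>z\<close> from \<open>\<C>/N\<C>\<close> to the tensor product, \<open>\<Sum> a\<^sub>i Y\<^sup>i \<mapsto> \<Sum> a\<^sub>i \<otimes> z\<^sup>i\<close>: all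
  representatives \<open>a\<close> of the class \<open>c\<close> have the same image.
\<close>

definition iota ::
  "'k::field set \<Rightarrow> ('k \<Rightarrow> 'l::field) \<Rightarrow> 'l \<Rightarrow> (int \<Rightarrow> 'k) set \<Rightarrow> ('k \<times> 'l \<Rightarrow>\<^sub>0 int) set" where
  "iota F e z c = the_elem
     ((\<lambda>a. finprod (tensor_product F e) (\<lambda>i. pure_tensor F e (a i) (z powi i)) {i. a i \<noteq> 0}) ` c)"

text \<open>
  The points of \<open>F\<^sup>s \<squnion> {\<infinity>}\<close> are the values of the option type, with \<open>None\<close> for \<open>\<infinity>\<close>;
  \<open>\<tau> z\<close> is the chosen morphism at the point \<open>z \<noteq> 0\<close>.
\<close>

definition partial_skew_residue ::
  "('k::field \<Rightarrow> 'k) \<Rightarrow> nat \<Rightarrow> ('k \<Rightarrow> 'l::field) \<Rightarrow>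
     ('l \<Rightarrow> (nat \<Rightarrow> (int \<Rightarrow> 'k) set) \<Rightarrow> int \<Rightarrow> (int \<Rightarrow> 'k) set) \<Rightarrow> nat \<Rightarrow>
     ((int \<Rightarrow> 'k) \<times> (int \<Rightarrow> 'k)) set \<Rightarrow> 'l option \<Rightarrow> ('k \<times> 'l \<Rightarrow>\<^sub>0 int) set" where
  "partial_skew_residue \<theta> r e \<tau> j f p =
     (case p of
        None \<Rightarrow> pure_tensor (fixed_field \<theta>) e (- TS_infinity \<theta> f (int r - int j)) 1
      | Some z \<Rightarrow>
          if z = 0 then pure_tensor (fixed_field \<theta>) e (TS_zero \<theta> f (int j - int r)) 1
          else iota (fixed_field \<theta>) e z
                 (section_quot r (int j) (TS_at \<theta> (min_poly_A \<theta> r e z) (\<tau> z) f (- 1))))"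

text \<open>
  All nonzero finite poles of \<open>f\<close> lie in \<open>F\<^sup>s\<close>: some denominator \<open>D \<in> F[Y]\<close> of \<open>f\<close> splits into linear
  factors over \<open>F\<^sup>s\<close>. (As \<open>Y\<close> is invertible in \<open>\<A>\<close>, every element of \<open>Frac(\<A>)\<close> has a denominator
  in \<open>F[Y]\<close>.) The condition holds for every \<open>f\<close> if \<open>F\<close> is perfect. The points of \<open>F\<^sup>s\<close> do not detect
  the other poles: for \<open>K = F\<close> imperfect of characteristic \<open>p\<close>, \<open>\<theta> = id\<close> and \<open>a\<close> in \<open>F\<close> without
  a \<open>p\<close>-th root in \<open>F\<close>, the fraction \<open>Y\<^sup>p\<^sup>-\<^sup>1 / (Y\<^sup>p - a)\<close> has residue \<open>-1\<close> at \<open>\<infinity>\<close> and residue \<open>0\<close> at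
  all points of \<open>F\<^sup>s\<close>.
\<close>

definition poles_in_separable_closure ::
  "nat \<Rightarrow> ('k::field \<Rightarrow> 'l::field) \<Rightarrow> ((int \<Rightarrow> 'k) \<times> (int \<Rightarrow> 'k)) set \<Rightarrow> bool" where
  "poles_in_separable_closure r e f \<longleftrightarrow>
     (\<exists>P D c zs. (P, poly_at_power r D) \<in> f \<and>
        map_poly e D = Polynomial.smult c (\<Prod>z\<leftarrow>zs. [:- z, 1:]))"

end

theory Submission
  imports Defs
begin

text \<open>
  Write \<open>f = D\<^sup>-\<^sup>1 P\<close> with \<open>P \<in> \<A>\<close>, \<open>D \<in> F[Y]\<close> split over \<open>F\<^sup>s\<close>, and \<open>deg D\<close> minimal. Let \<open>z \<noteq> 0\<close> have
  minimal polynomial \<open>N\<close>. Modulo \<open>T\<^sup>2\<close>, an admissible morphism sends \<open>p(Y)\<close> to \<open>p(z) + p'(z) T\<close>, so comparing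
  coefficients of \<open>T\<^sup>0\<close> in \<open>\<tau>(D) TS\<^sub>z(f) = \<tau>(P)\<close> gives \<open>D(z) s\<^sub>0 + D'(z) sres\<^sub>z(f) = P mod N\<close>, where \<open>s\<^sub>0\<close>
  is the constant coefficient of \<open>TS\<^sub>z(f)\<close>.
  If \<open>z\<close> were a multiple root of \<open>D\<close>, then \<open>N\<close> would divide both \<open>P\<close> and \<open>D\<close>, contradicting minimality;
  likewise \<open>D(0) \<noteq> 0\<close>, as \<open>Y\<close> is invertible. Hence \<open>D\<close> has simple nonzero roots, and at such a root
  \<open>sres\<^sub>z(f) = P / D'(z) mod N\<close>. With \<open>\<sigma>\<^sub>j(P) = \<Sum> b\<^sub>i Y\<^sup>i\<close>, every partial skew residue has the form
  \<open>\<Sum> b\<^sub>i \<otimes> w\<^sub>i\<close>, where \<open>w\<^sub>i\<close> is the residue of \<open>Y\<^sup>i / D\<close> at the point considered. The claim thus reduces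
  to the residue theorem for \<open>Y\<^sup>i / D\<close> over \<open>F\<^sup>s\<close>, which follows from
  \<open>1 / D = \<Sum>\<^sub>z 1 / (D'(z) (Y - z))\<close>.
\<close>

text \<open>For each \<open>j\<close> the section operator turns left multiplication by
  \<open>pw D\<close> into the action of \<open>D\<close> on two-sided sequences, so the expansions
  at 0 and at infinity both become solutions \<open>x\<close> of
  \<open>D x = \<sigma>\<^sub>j(P)\<close> in one commutative module. Two-sided solutions are not
  unique, but solutions vanishing far to one side are, because \<open>D\<close> has nonzero constant
  term. This uniqueness identifies the two expansions with convolutions of
  \<open>\<sigma>\<^sub>j(P)\<close> and \<open>1 / D\<close>, shows that the coefficients of
  \<open>1 / D\<close> lie in \<open>F\<close> (so that they may cross the tensor sign), and yields
  the geometric expansions in the residue theorem. At \<open>z\<close> the obstacle is that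
  polynomials over \<open>F\<close> are stored over \<open>K\<close>, where \<open>N\<close> may
  factor. Divisibility and inverses modulo \<open>N\<close> therefore come from divisions and Bezout
  relations whose terms are checked to stay over \<open>F\<close>; the inverse of
  \<open>D'(z)\<close> is then the class of a polynomial, which \<open>iota\<close> can evaluate. A
  nonconstant factor of \<open>D\<close> without root in \<open>F\<^sup>s\<close> would be a pole
  that no point sees. Hence splitting is used in the form "every nonconstant divisor has a root",
  which passes to factors of \<open>D\<close>.\<close>

lemma (in comm_monoid) finprod_swap:
  assumes "finite A" "finite B" "\<And>i j. i \<in> A \<Longrightarrow> j \<in> B \<Longrightarrow> h i j \<in> carrier G"
  shows "finprod G (\<lambda>i. finprod G (h i) B) A = finprod G (\<lambda>j. finprod G (\<lambda>i. h i j) A) B"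
  using assms(1,3)
proof (induction A rule: finite_induct)
  case empty
  show ?case by simp
next
  case (insert a A)
  have "finprod G (\<lambda>i. finprod G (h i) B) (insert a A)
      = finprod G (h a) B \<otimes> finprod G (\<lambda>j. finprod G (\<lambda>i. h i j) A) B"
    using insert by (subst finprod_insert) (auto intro!: finprod_closed)
  also have "\<dots> = finprod G (\<lambda>j. h a j \<otimes> finprod G (\<lambda>i. h i j) A) B"
    using insert by (intro finprod_multf[symmetric]) auto
  also have "\<dots> = finprod G (\<lambda>j. finprod G (\<lambda>i. h i j) (insert a A)) B"
    using insert by (intro finprod_cong') (auto intro!: finprod_closed)
  finally show ?case .
qed

section \<open>The ring of skew Laurent series\<close>

text \<open>\<open>R\<close> is not assumed commutative: the construction serves for
  \<open>K\<close> with \<theta> or its inverse, and for the quotient of \<open>A\<close> by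
  \<open>N\<close> with the identity.\<close>

locale ring_automorphism = ring R for R (structure) +
  fixes \<theta> :: "'a \<Rightarrow> 'a"
  assumes aut: "\<theta> \<in> ring_iso R R"
begin

abbreviation "S \<equiv> skew_laurent_series R \<theta>"
abbreviation "tw \<equiv> int_pow_map R \<theta>"

lemma aut_hom: "\<theta> \<in> ring_hom R R" and aut_bij: "bij_betw \<theta> (carrier R) (carrier R)"
  using aut by (auto simp: ring_iso_def)

lemma aut_inv:
  assumes "x \<in> carrier R"
  shows "inv_into (carrier R) \<theta> x \<in> carrier R"
    "\<theta> (inv_into (carrier R) \<theta> x) = x" "inv_into (carrier R) \<theta> (\<theta> x) = x"
  using aut_bij assms
  by (auto simp: bij_betw_def inv_into_f_f inv_into_into f_inv_into_f)

lemma tw_closed [simp]: "x \<in> carrier R \<Longrightarrow> tw i x \<in> carrier R"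
proof -
  assume x: "x \<in> carrier R"
  have "(\<theta> ^^ n) x \<in> carrier R" for n
    using x ring_hom_closed[OF aut_hom] by (induction n) auto
  moreover have "(inv_into (carrier R) \<theta> ^^ n) x \<in> carrier R" for n
    using x aut_inv(1) by (induction n) auto
  ultimately show ?thesis by (simp add: int_pow_map_def)
qed

lemma tw_0 [simp]: "tw 0 x = x"
  by (simp add: int_pow_map_def)

lemma tw_Suc: "x \<in> carrier R \<Longrightarrow> tw (i + 1) x = \<theta> (tw i x)"
proof (cases "0 \<le> i")
  case True
  then show ?thesis by (simp add: int_pow_map_def nat_add_distrib)
next
  case False
  assume x: "x \<in> carrier R"
  define k where "k = nat (- (i + 1))"
  have k: "nat (- i) = Suc k" "i + 1 \<le> 0" using False by (auto simp: k_def)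
  have twi: "tw i x = inv_into (carrier R) \<theta> ((inv_into (carrier R) \<theta> ^^ k) x)"
    using False k by (simp add: int_pow_map_def)
  \<comment> \<open>For \<open>i = -1\<close> the exponent \<open>i + 1\<close> falls into the
    nonnegative branch of \<open>int_pow_map\<close>; both branches give the identity there.\<close>
  have tws: "tw (i + 1) x = (inv_into (carrier R) \<theta> ^^ k) x"
    using k by (cases "i + 1 = 0") (auto simp: int_pow_map_def k_def)
  then have "(inv_into (carrier R) \<theta> ^^ k) x \<in> carrier R" using tw_closed[OF x] by metis
  then show ?thesis using twi tws aut_inv by simp
qed

lemma tw_pred: "x \<in> carrier R \<Longrightarrow> tw (i - 1) x = inv_into (carrier R) \<theta> (tw i x)"
  using tw_Suc[of x "i - 1"] aut_inv(3)[of "tw (i - 1) x"] by simp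

lemma tw_add: "x \<in> carrier R \<Longrightarrow> tw (i + j) x = tw i (tw j x)"
proof (induction i rule: int_induct[where k = 0])
  case (step1 i)
  then show ?case using tw_Suc[of x "i + j"] tw_Suc[of "tw j x" i] by (simp add: ac_simps)
next
  case (step2 i)
  then show ?case using tw_pred[of x "i + j"] tw_pred[of "tw j x" i] by (simp add: algebra_simps)
qed simp

lemma inv_hom: "inv_into (carrier R) \<theta> \<in> ring_hom R R"
proof (rule ring_hom_memI)
  fix x y assume xy: "x \<in> carrier R" "y \<in> carrier R"
  let ?v = "inv_into (carrier R) \<theta>"
  have "?v (\<theta> (?v x) \<otimes> \<theta> (?v y)) = ?v (\<theta> (?v x \<otimes> ?v y))"
    using ring_hom_mult[OF aut_hom] aut_inv(1) xy by simp
  then show "?v (x \<otimes> y) = ?v x \<otimes> ?v y" using aut_inv xy by simp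
  have "?v (\<theta> (?v x) \<oplus> \<theta> (?v y)) = ?v (\<theta> (?v x \<oplus> ?v y))"
    using ring_hom_add[OF aut_hom] aut_inv(1) xy by simp
  then show "?v (x \<oplus> y) = ?v x \<oplus> ?v y" using aut_inv xy by simp
next
  show "inv_into (carrier R) \<theta> \<one> = \<one>"
    using aut_inv(3)[of \<one>] ring_hom_one[OF aut_hom] by simp
qed (use aut_inv in auto)

lemma tw_hom: "tw i \<in> ring_hom R R"
proof -
  have *: "h ^^ n \<in> ring_hom R R" if "h \<in> ring_hom R R" for h n
  proof (induction n)
    case 0
    show ?case by (auto intro!: ring_hom_memI)
  next
    case (Suc n)
    show ?case using ring_hom_trans[OF Suc that] by (simp add: o_def)
  qed
  have "tw i = (if 0 \<le> i then \<theta> ^^ nat i else inv_into (carrier R) \<theta> ^^ nat (- i))"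
    by (rule ext) (simp add: int_pow_map_def)
  then show ?thesis using *[OF aut_hom] *[OF inv_hom] by simp
qed

lemmas tw_mult [simp] = ring_hom_mult[OF tw_hom]
lemmas tw_plus [simp] = ring_hom_add[OF tw_hom]
lemmas tw_one [simp] = ring_hom_one[OF tw_hom]

lemma tw_zero [simp]: "tw i \<zero> = \<zero>"
  using ring_hom_zero[OF tw_hom] ring_axioms by blast

lemma tw_finsum:
  assumes "finite A" "h \<in> A \<rightarrow> carrier R"
  shows "tw i (finsum R h A) = finsum R (\<lambda>x. tw i (h x)) A"
  using assms
proof (induction A rule: finite_induct)
  case (insert a A)
  then have "h \<in> A \<rightarrow> carrier R" "h a \<in> carrier R" "(\<lambda>x. tw i (h x)) \<in> A \<rightarrow> carrier R"
    by (auto simp: Pi_iff)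
  with insert show ?case by (simp add: finsum_insert finsum_closed del: Pi_iff)
qed simp

lemma series_carrier:
  "f \<in> carrier S \<longleftrightarrow> (\<forall>n. f n \<in> carrier R) \<and> (\<exists>n0. \<forall>n<n0. f n = \<zero>)"
  by (simp add: skew_laurent_series_def)

lemma series_closed: "f \<in> carrier S \<Longrightarrow> f n \<in> carrier R"
  by (simp add: series_carrier)

lemma series_zero [simp]: "\<zero>\<^bsub>S\<^esub> = (\<lambda>_. \<zero>)"
  and series_add [simp]: "f \<oplus>\<^bsub>S\<^esub> g = (\<lambda>n. f n \<oplus> g n)"
  and series_one: "\<one>\<^bsub>S\<^esub> = (\<lambda>n. if n = 0 then \<one> else \<zero>)"
  by (simp_all add: skew_laurent_series_def)

text \<open>The product is defined by a sum over its exact support, which varies with the factors;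
  the extra terms over a larger finite \<open>I\<close> vanish, so different products can be summed
  over one index set.\<close>

lemma series_mult_on:
  assumes "\<And>n. f n \<in> carrier R" "\<And>n. g n \<in> carrier R" "finite I"
    and "\<And>i. f i \<noteq> \<zero> \<Longrightarrow> g (n - i) \<noteq> \<zero> \<Longrightarrow> i \<in> I"
  shows "(f \<otimes>\<^bsub>S\<^esub> g) n = finsum R (\<lambda>i. f i \<otimes> tw i (g (n - i))) I"
proof -
  have "finsum R (\<lambda>i. f i \<otimes> tw i (g (n - i))) {i. f i \<noteq> \<zero> \<and> g (n - i) \<noteq> \<zero>} =
      finsum R (\<lambda>i. f i \<otimes> tw i (g (n - i))) I"
  proof (rule add.finprod_mono_neutral_cong_left)
    fix i assume "i \<in> I - {i. f i \<noteq> \<zero> \<and> g (n - i) \<noteq> \<zero>}"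
    then have "f i = \<zero> \<or> g (n - i) = \<zero>" by auto
    then show "f i \<otimes> tw i (g (n - i)) = \<zero>" using assms(1,2) by auto
  qed (use assms in auto)
  then show ?thesis by (simp add: skew_laurent_series_def)
qed

text \<open>Lower bounds of the two supports confine \<open>i\<close> to a finite interval. The
  slack in \<open>m\<close> and \<open>M\<close> allows a common interval for several
  products.\<close>

lemma series_mult_interval:
  assumes "\<And>n. f n \<in> carrier R" "\<And>n. g n \<in> carrier R"
    and "\<And>i. i < a \<Longrightarrow> f i = \<zero>" "\<And>i. i < b \<Longrightarrow> g i = \<zero>" "n - b \<le> M" "m \<le> a"
  shows "(f \<otimes>\<^bsub>S\<^esub> g) n = finsum R (\<lambda>i. f i \<otimes> tw i (g (n - i))) {m..M}"
proof (rule series_mult_on)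
  fix i assume "f i \<noteq> \<zero>" "g (n - i) \<noteq> \<zero>"
  then have "\<not> i < a" "\<not> n - i < b" using assms(3,4) by auto
  then show "i \<in> {m..M}" using assms(5,6) by auto
qed (use assms in auto)

lemma series_mult_below:
  assumes "\<And>n. f n \<in> carrier R" "\<And>n. g n \<in> carrier R"
    and "\<And>i. i < a \<Longrightarrow> f i = \<zero>" "\<And>i. i < b \<Longrightarrow> g i = \<zero>" "n < a + b"
  shows "(f \<otimes>\<^bsub>S\<^esub> g) n = \<zero>"
  using series_mult_interval[OF assms(1-4) order_refl order_refl] assms(5) by simp

lemma series_mult_closed:
  assumes "f \<in> carrier S" "g \<in> carrier S"
  shows "f \<otimes>\<^bsub>S\<^esub> g \<in> carrier S"
proof -
  obtain a b where a: "\<And>n. n < a \<Longrightarrow> f n = \<zero>" and b: "\<And>n. n < b \<Longrightarrow> g n = \<zero>"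
    using assms by (auto simp: series_carrier)
  have "(f \<otimes>\<^bsub>S\<^esub> g) n \<in> carrier R" for n
    using series_closed[OF assms(1)] series_closed[OF assms(2)] by (subst series_mult_interval[OF _ _ a b order_refl order_refl])
      (auto intro!: finsum_closed)
  moreover have "\<forall>n<a + b. (f \<otimes>\<^bsub>S\<^esub> g) n = \<zero>"
    using series_mult_below[OF _ _ a b] series_closed[OF assms(1)] series_closed[OF assms(2)] by auto
  ultimately show ?thesis unfolding series_carrier by blast
qed

text \<open>Both sides equal one double sum over a rectangle of pairs \<open>(i, s)\<close>, where
  \<open>s\<close> is the total degree taken from \<open>f\<close> and \<open>g\<close>. The inner
  sum of the right side is reindexed by \<open>t = s - i\<close>, and \<open>tw_add\<close> merges
  the twists.\<close>

lemma series_assoc: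
  assumes f: "f \<in> carrier S" and g: "g \<in> carrier S" and h: "h \<in> carrier S"
  shows "(f \<otimes>\<^bsub>S\<^esub> g) \<otimes>\<^bsub>S\<^esub> h = f \<otimes>\<^bsub>S\<^esub> (g \<otimes>\<^bsub>S\<^esub> h)"
proof
  fix n
  obtain a b c where a: "\<And>n. n < a \<Longrightarrow> f n = \<zero>" and b: "\<And>n. n < b \<Longrightarrow> g n = \<zero>"
    and c: "\<And>n. n < c \<Longrightarrow> h n = \<zero>" using f g h by (auto simp: series_carrier)
  note [simp] = series_closed[OF f] series_closed[OF g] series_closed[OF h]
  note fg = series_mult_closed[OF f g] and gh = series_mult_closed[OF g h]
  have fg0: "(f \<otimes>\<^bsub>S\<^esub> g) i = \<zero>" if "i < a + b" for i
    using series_mult_below[OF _ _ a b that] by simp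
  have gh0: "(g \<otimes>\<^bsub>S\<^esub> h) i = \<zero>" if "i < b + c" for i
    using series_mult_below[OF _ _ b c that] by simp
  \<comment> \<open>A nonzero term needs \<open>a \<le> i\<close>, \<open>b \<le> s - i\<close> and
    \<open>c \<le> n - s\<close>; these give both ranges.\<close>
  let ?I = "{a..n - b - c}" and ?J = "{a + b..n - c}"
  have "((f \<otimes>\<^bsub>S\<^esub> g) \<otimes>\<^bsub>S\<^esub> h) n = finsum R (\<lambda>s. (f \<otimes>\<^bsub>S\<^esub> g) s \<otimes> tw s (h (n - s))) ?J"
    using series_closed[OF fg] by (intro series_mult_interval[OF _ _ fg0 c]) auto
  also have "\<dots> = finsum R (\<lambda>s. finsum R (\<lambda>i. f i \<otimes> tw i (g (s - i)) \<otimes> tw s (h (n - s))) ?I) ?J"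
  proof (rule finsum_cong')
    fix s assume "s \<in> ?J"
    then have "(f \<otimes>\<^bsub>S\<^esub> g) s = finsum R (\<lambda>i. f i \<otimes> tw i (g (s - i))) ?I"
      by (intro series_mult_interval[OF _ _ a b]) auto
    then show "(f \<otimes>\<^bsub>S\<^esub> g) s \<otimes> tw s (h (n - s)) =
        finsum R (\<lambda>i. f i \<otimes> tw i (g (s - i)) \<otimes> tw s (h (n - s))) ?I"
      by (simp add: finsum_ldistr)
  qed (auto intro!: finsum_closed)
  also have "\<dots> = finsum R (\<lambda>i. finsum R (\<lambda>s. f i \<otimes> tw i (g (s - i)) \<otimes> tw s (h (n - s))) ?J) ?I"
    by (rule add.finprod_swap) auto
  also have "\<dots> = finsum R (\<lambda>i. f i \<otimes> tw i ((g \<otimes>\<^bsub>S\<^esub> h) (n - i))) ?I"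
  proof (rule finsum_cong')
    fix i assume i: "i \<in> ?I"
    have "(g \<otimes>\<^bsub>S\<^esub> h) (n - i) =
        finsum R (\<lambda>t. g t \<otimes> tw t (h (n - i - t))) {a + b - i..n - c - i}"
      using i by (intro series_mult_interval[OF _ _ b c]) auto
    also have "\<dots> = finsum R (\<lambda>s. g (s - i) \<otimes> tw (s - i) (h (n - s))) ?J"
    proof -
      have "{a + b - i..n - c - i} = (\<lambda>s. s - i) ` ?J"
        using image_diff_atLeastAtMost[of i "a + b" "n - c"] by auto
      then show ?thesis
        using finsum_reindex[of "\<lambda>t. g t \<otimes> tw t (h (n - i - t))" "\<lambda>s. s - i" ?J]
        by (simp add: inj_on_def)
    qed
    finally have "f i \<otimes> tw i ((g \<otimes>\<^bsub>S\<^esub> h) (n - i)) =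
        f i \<otimes> finsum R (\<lambda>s. tw i (g (s - i) \<otimes> tw (s - i) (h (n - s)))) ?J"
      by (simp add: tw_finsum Pi_def)
    also have "\<dots> = f i \<otimes> finsum R (\<lambda>s. tw i (g (s - i)) \<otimes> tw s (h (n - s))) ?J"
      using tw_add[of _ i, symmetric] by simp
    also have "\<dots> = finsum R (\<lambda>s. f i \<otimes> tw i (g (s - i)) \<otimes> tw s (h (n - s))) ?J"
      by (simp add: finsum_rdistr m_assoc Pi_def)
    finally show "finsum R (\<lambda>s. f i \<otimes> tw i (g (s - i)) \<otimes> tw s (h (n - s))) ?J =
        f i \<otimes> tw i ((g \<otimes>\<^bsub>S\<^esub> h) (n - i))" ..
  qed (use series_closed[OF gh] in auto)
  also have "\<dots> = (f \<otimes>\<^bsub>S\<^esub> (g \<otimes>\<^bsub>S\<^esub> h)) n"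
    using series_closed[OF gh] by (intro series_mult_interval[OF _ _ a gh0, symmetric]) auto
  finally show "((f \<otimes>\<^bsub>S\<^esub> g) \<otimes>\<^bsub>S\<^esub> h) n = (f \<otimes>\<^bsub>S\<^esub> (g \<otimes>\<^bsub>S\<^esub> h)) n" .
qed

lemma series_one_closed: "\<one>\<^bsub>S\<^esub> \<in> carrier S"
  by (auto simp: series_carrier series_one intro!: exI[of _ 0])

lemma laurent_monom_mult:
  assumes "c \<in> carrier R" "\<And>n. g n \<in> carrier R"
  shows "(laurent_monom R c k \<otimes>\<^bsub>S\<^esub> g) n = c \<otimes> tw k (g (n - k))"
  using assms
  by (subst series_mult_on[where I = "{k}"]) (auto simp: laurent_monom_def split: if_splits)

lemma mult_laurent_monom:
  assumes "c \<in> carrier R" "\<And>n. g n \<in> carrier R"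
  shows "(g \<otimes>\<^bsub>S\<^esub> laurent_monom R c k) n = g (n - k) \<otimes> tw (n - k) c"
  using assms
  by (subst series_mult_on[where I = "{n - k}"]) (auto simp: laurent_monom_def split: if_splits)

lemma series_one_monom: "\<one>\<^bsub>S\<^esub> = laurent_monom R \<one> 0"
  by (simp add: series_one laurent_monom_def)

lemma series_ring: "ring S"
proof (rule ringI)
  show "abelian_group S"
  proof (rule abelian_groupI)
    fix x y assume x: "x \<in> carrier S" and y: "y \<in> carrier S"
    obtain a b where "\<And>n. n < a \<Longrightarrow> x n = \<zero>" "\<And>n. n < b \<Longrightarrow> y n = \<zero>"
      using x y by (auto simp: series_carrier)
    then have "\<exists>n0. \<forall>n<n0. x n \<oplus> y n = \<zero>" by (intro exI[of _ "min a b"]) simp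
    then show "x \<oplus>\<^bsub>S\<^esub> y \<in> carrier S"
      using series_closed[OF x] series_closed[OF y] by (simp add: series_carrier[of "\<lambda>n. x n \<oplus> y n"])
  next
    fix x assume x: "x \<in> carrier S"
    then have "(\<lambda>n. \<ominus> x n) \<in> carrier S" by (auto simp: series_carrier)
    moreover have "(\<lambda>n. \<ominus> x n) \<oplus>\<^bsub>S\<^esub> x = \<zero>\<^bsub>S\<^esub>" using series_closed[OF x] by (simp add: l_neg)
    ultimately show "\<exists>y\<in>carrier S. y \<oplus>\<^bsub>S\<^esub> x = \<zero>\<^bsub>S\<^esub>" by blast
  qed (auto simp: series_carrier a_ac)
  show "monoid S"
  proof (rule monoidI)
    fix x assume x: "x \<in> carrier S"
    from series_closed[OF x] show "\<one>\<^bsub>S\<^esub> \<otimes>\<^bsub>S\<^esub> x = x" "x \<otimes>\<^bsub>S\<^esub> \<one>\<^bsub>S\<^esub> = x"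
      by (auto simp: series_one_monom laurent_monom_mult mult_laurent_monom fun_eq_iff)
  qed (auto simp: series_mult_closed series_assoc series_one_closed)
next
  fix f g h assume f: "f \<in> carrier S" and g: "g \<in> carrier S" and h: "h \<in> carrier S"
  obtain a b c where a: "\<And>n. n < a \<Longrightarrow> f n = \<zero>" and b: "\<And>n. n < b \<Longrightarrow> g n = \<zero>"
    and c: "\<And>n. n < c \<Longrightarrow> h n = \<zero>" using f g h by (auto simp: series_carrier)
  note [simp] = series_closed[OF f] series_closed[OF g] series_closed[OF h]
  show "(f \<oplus>\<^bsub>S\<^esub> g) \<otimes>\<^bsub>S\<^esub> h = f \<otimes>\<^bsub>S\<^esub> h \<oplus>\<^bsub>S\<^esub> g \<otimes>\<^bsub>S\<^esub> h"
  proof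
    fix n
    let ?I = "{min a b..n - c}"
    have "((f \<oplus>\<^bsub>S\<^esub> g) \<otimes>\<^bsub>S\<^esub> h) n = finsum R (\<lambda>i. (f i \<oplus> g i) \<otimes> tw i (h (n - i))) ?I"
      using a b by (subst series_mult_interval[where a = "min a b" and b = c, OF _ _ _ c]) auto
    also have "\<dots> = finsum R (\<lambda>i. f i \<otimes> tw i (h (n - i))) ?I \<oplus> finsum R (\<lambda>i. g i \<otimes> tw i (h (n - i))) ?I"
      by (subst finsum_addf[symmetric]) (auto simp: l_distr)
    also have "\<dots> = (f \<otimes>\<^bsub>S\<^esub> h \<oplus>\<^bsub>S\<^esub> g \<otimes>\<^bsub>S\<^esub> h) n"
      by (simp add: series_mult_interval[OF _ _ a c, where n = n and M = "n - c" and m = "min a b"]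
          series_mult_interval[OF _ _ b c, where n = n and M = "n - c" and m = "min a b"])
    finally show "((f \<oplus>\<^bsub>S\<^esub> g) \<otimes>\<^bsub>S\<^esub> h) n = (f \<otimes>\<^bsub>S\<^esub> h \<oplus>\<^bsub>S\<^esub> g \<otimes>\<^bsub>S\<^esub> h) n" .
  qed
  show "h \<otimes>\<^bsub>S\<^esub> (f \<oplus>\<^bsub>S\<^esub> g) = h \<otimes>\<^bsub>S\<^esub> f \<oplus>\<^bsub>S\<^esub> h \<otimes>\<^bsub>S\<^esub> g"
  proof
    fix n
    let ?I = "{c..n - min a b}"
    have "(h \<otimes>\<^bsub>S\<^esub> (f \<oplus>\<^bsub>S\<^esub> g)) n = finsum R (\<lambda>i. h i \<otimes> tw i (f (n - i) \<oplus> g (n - i))) ?I"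
      using a b by (subst series_mult_interval[where b = "min a b" and a = c, OF _ _ c]) auto
    also have "\<dots> = finsum R (\<lambda>i. h i \<otimes> tw i (f (n - i))) ?I \<oplus> finsum R (\<lambda>i. h i \<otimes> tw i (g (n - i))) ?I"
      by (subst finsum_addf[symmetric]) (auto simp: r_distr)
    also have "\<dots> = (h \<otimes>\<^bsub>S\<^esub> f \<oplus>\<^bsub>S\<^esub> h \<otimes>\<^bsub>S\<^esub> g) n"
      by (simp add: series_mult_interval[OF _ _ c a, where n = n and M = "n - min a b" and m = c]
          series_mult_interval[OF _ _ c b, where n = n and M = "n - min a b" and m = c])
    finally show "(h \<otimes>\<^bsub>S\<^esub> (f \<oplus>\<^bsub>S\<^esub> g)) n = (h \<otimes>\<^bsub>S\<^esub> f \<oplus>\<^bsub>S\<^esub> h \<otimes>\<^bsub>S\<^esub> g) n" .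
  qed
qed

end

section \<open>Invertible series\<close>

context ring_automorphism
begin

lemma tw_Units:
  assumes "u \<in> Units R"
  shows "tw i u \<in> Units R"
proof -
  have u: "u \<in> carrier R" "inv u \<in> carrier R" "u \<otimes> inv u = \<one>" "inv u \<otimes> u = \<one>"
    using assms by auto
  then have "tw i u \<otimes> tw i (inv u) = \<one>" "tw i (inv u) \<otimes> tw i u = \<one>"
    by (metis tw_mult tw_one)+
  then show ?thesis using u by (auto simp: Units_def intro!: bexI[of _ "tw i (inv u)"])
qed

text \<open>The coefficients of \<open>g\<close> are found recursively: each equation contains the
  new one only through \<open>f k\<close> times its twist, and both operations are invertible. The
  information on the leading coefficient of \<open>g\<close> allows the lemma to be applied to
  \<open>g\<close> again.\<close>

lemma series_right_inverse:
  assumes f: "f \<in> carrier S" and low: "\<And>n. n < k \<Longrightarrow> f n = \<zero>" and unit: "f k \<in> Units R"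
  shows "\<exists>g\<in>carrier S. f \<otimes>\<^bsub>S\<^esub> g = \<one>\<^bsub>S\<^esub> \<and> (\<forall>n. n < - k \<longrightarrow> g n = \<zero>) \<and> g (- k) \<in> Units R"
proof -
  note [simp] = series_closed[OF f]
  \<comment> \<open>\<open>G m\<close> stands for the coefficient of \<open>g\<close> at
    \<open>m - k\<close>. The guard holds for all \<open>i\<close> in the range summed below; it is
    written out so that \<open>h G m\<close> visibly depends only on values of \<open>G\<close>
    before \<open>m\<close>, as the well-founded choice requires.\<close>
  define h where "h G m i = (if nat (k + int m - i) < m then f i \<otimes> tw i (G (nat (k + int m - i))) else \<zero>)"
    for G :: "nat \<Rightarrow> 'a" and m i
  define P where "P G m x \<longleftrightarrow> x \<in> carrier R \<and>
      f k \<otimes> tw k x \<oplus> finsum R (h G m) {k + 1..k + int m} = (if m = 0 then \<one> else \<zero>)"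
    for G m x
  have "\<exists>G. \<forall>m. P G m (G m)"
  proof (rule dependent_wf_choice[OF wf_less_than])
    fix G G' :: "nat \<Rightarrow> 'a" and m x
    assume "\<And>z. (z, m) \<in> less_than \<Longrightarrow> G z = G' z"
    then have "h G m = h G' m" by (auto simp: h_def)
    then show "P G m x = P G' m x" by (simp add: P_def)
  next
    fix m G assume "\<And>y. (y, m) \<in> less_than \<Longrightarrow> P G y (G y)"
    then have "h G m i \<in> carrier R" for i by (auto simp: h_def P_def)
    then have s: "finsum R (h G m) {k + 1..k + int m} \<in> carrier R" (is "?s \<in> _")
      by (auto intro!: finsum_closed)
    define d where "d = (if m = 0 then \<one> else \<zero>)"
    \<comment> \<open>The equation \<open>f k \<otimes> tw k x \<oplus> ?s = d\<close> solved for
      \<open>x\<close>.\<close>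
    define x where "x = tw (- k) (inv (f k) \<otimes> (d \<ominus> ?s))"
    have d: "d \<in> carrier R" by (simp add: d_def)
    have "inv (f k) \<otimes> (d \<ominus> ?s) \<in> carrier R" using d s unit by simp
    then have "tw k x = inv (f k) \<otimes> (d \<ominus> ?s)"
      unfolding x_def by (subst tw_add[symmetric]) simp_all
    then have "f k \<otimes> tw k x = d \<ominus> ?s"
      using d s unit by (simp add: m_assoc[symmetric])
    then have "f k \<otimes> tw k x \<oplus> ?s = d" using d s by (simp add: a_minus_def a_assoc l_neg)
    moreover have "x \<in> carrier R" using d s unit by (simp add: x_def)
    ultimately show "\<exists>x. P G m x" unfolding P_def d_def by blast
  qed
  then obtain G where G: "\<And>m. P G m (G m)" by blast
  have Gc: "G m \<in> carrier R" for m using G[of m] by (simp add: P_def)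
  define g where "g n = (if n < - k then \<zero> else G (nat (n + k)))" for n
  have gc: "g n \<in> carrier R" for n by (simp add: g_def Gc)
  have g0: "g n = \<zero>" if "n < - k" for n using that by (simp add: g_def)
  have gS: "g \<in> carrier S" unfolding series_carrier using gc g0 by blast
  have "f \<otimes>\<^bsub>S\<^esub> g = \<one>\<^bsub>S\<^esub>"
  proof
    fix n
    show "(f \<otimes>\<^bsub>S\<^esub> g) n = \<one>\<^bsub>S\<^esub> n"
    proof (cases "n < 0")
      case True
      then show ?thesis
        using series_mult_below[OF _ _ low g0, where n = n] gc by (simp add: series_one)
    next
      case False
      define m where "m = nat n"
      have n: "n = int m" using False by (simp add: m_def)
      have "(f \<otimes>\<^bsub>S\<^esub> g) n = finsum R (\<lambda>i. f i \<otimes> tw i (g (n - i))) {k..k + int m}"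
        using gc by (intro series_mult_interval[OF _ _ low g0]) (auto simp: n)
      also have "{k..k + int m} = insert k {k + 1..k + int m}" by auto
      also have "finsum R (\<lambda>i. f i \<otimes> tw i (g (n - i))) (insert k {k + 1..k + int m}) =
          f k \<otimes> tw k (g (n - k)) \<oplus> finsum R (\<lambda>i. f i \<otimes> tw i (g (n - i))) {k + 1..k + int m}"
        using gc by (intro finsum_insert) auto
      also have "g (n - k) = G m" by (simp add: g_def n)
      also have "finsum R (\<lambda>i. f i \<otimes> tw i (g (n - i))) {k + 1..k + int m} =
          finsum R (h G m) {k + 1..k + int m}"
        by (rule finsum_cong') (auto simp: h_def g_def n Gc algebra_simps)
      finally show ?thesis using G[of m] by (simp add: P_def series_one n)
    qed
  qed
  moreover have "g (- k) \<in> Units R"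
  proof -
    have "f k \<otimes> tw k (G 0) = \<one>" using G[of 0] Gc by (simp add: P_def)
    then have "tw k (G 0) = inv (f k)"
      using unit Gc by (metis Units_inv_Units Units_inv_closed Units_inv_inv Units_closed inv_unique' Units_l_inv
          Units_r_inv l_one m_assoc r_one tw_closed)
    then have "G 0 = tw (- k) (inv (f k))" using tw_add[of "G 0" "- k" k] Gc by simp
    then show ?thesis using tw_Units unit by (simp add: g_def)
  qed
  ultimately show ?thesis using gS g0 by blast
qed

text \<open>Without commutativity a right inverse is not enough. Here the right inverse
  \<open>g\<close> has a right inverse \<open>h\<close> itself, and associativity forces
  \<open>h = f\<close>.\<close>

lemma series_Units:
  assumes f: "f \<in> carrier S" and low: "\<And>n. n < k \<Longrightarrow> f n = \<zero>" and unit: "f k \<in> Units R"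
  shows "f \<in> Units S"
proof -
  interpret S: ring S by (rule series_ring)
  obtain g where g: "g \<in> carrier S" "f \<otimes>\<^bsub>S\<^esub> g = \<one>\<^bsub>S\<^esub>" "\<And>n. n < - k \<Longrightarrow> g n = \<zero>" "g (- k) \<in> Units R"
    using series_right_inverse[OF assms] by blast
  obtain h where h: "h \<in> carrier S" "g \<otimes>\<^bsub>S\<^esub> h = \<one>\<^bsub>S\<^esub>"
    using series_right_inverse[OF g(1,3,4)] by blast
  have "f = f \<otimes>\<^bsub>S\<^esub> (g \<otimes>\<^bsub>S\<^esub> h)" using f h by simp
  also have "\<dots> = h" using f g(1,2) h(1) by (simp add: S.m_assoc[symmetric])
  finally show ?thesis using f g h unfolding Units_def by blast
qed

end

section \<open>Polynomials acting on two-sided sequences\<close>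

text \<open>Multiplication of the formal two-sided series with coefficients \<open>x\<close> by
  \<open>p(Y)\<close>. Such series form a module over the polynomials that contains the expansions
  at 0 and those at infinity.\<close>

definition shift_act :: "'a::comm_ring_1 poly \<Rightarrow> (int \<Rightarrow> 'a) \<Rightarrow> int \<Rightarrow> 'a" where
  "shift_act p x m = (\<Sum>k\<le>degree p. coeff p k * x (m - int k))"

definition coeff_seq :: "'a::zero poly \<Rightarrow> int \<Rightarrow> 'a" where
  "coeff_seq p m = (if 0 \<le> m then coeff p (nat m) else 0)"

lemma shift_act_bound:
  assumes "degree p \<le> n"
  shows "shift_act p x m = (\<Sum>k\<le>n. coeff p k * x (m - int k))"
  unfolding shift_act_def
  by (rule sum.mono_neutral_left) (use assms in \<open>auto simp: coeff_eq_0\<close>)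

lemma shift_act_0 [simp]: "shift_act 0 x m = 0"
  by (simp add: shift_act_def)

lemma shift_act_pCons [simp]: "shift_act (pCons a p) x m = a * x m + shift_act p x (m - 1)"
proof -
  have "shift_act (pCons a p) x m = (\<Sum>k\<le>Suc (degree p). coeff (pCons a p) k * x (m - int k))"
    by (rule shift_act_bound) (simp add: degree_pCons_le)
  also have "\<dots> = a * x m + shift_act p x (m - 1)"
    unfolding shift_act_def by (subst sum.atMost_Suc_shift) (simp add: algebra_simps)
  finally show ?thesis .
qed

lemma shift_act_add: "shift_act (p + q) x m = shift_act p x m + shift_act q x m"
  by (induction p q arbitrary: m rule: poly_induct2) (simp_all add: algebra_simps)

lemma shift_act_smult: "shift_act (smult c p) x m = c * shift_act p x m"
  by (induction p arbitrary: m) (simp_all add: algebra_simps)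

lemma shift_act_scale_seq: "shift_act p (\<lambda>i. c * x i) m = c * shift_act p x m"
  by (induction p arbitrary: m) (simp_all add: algebra_simps)

lemma shift_act_diff_seq: "shift_act p (\<lambda>i. x i - y i) m = shift_act p x m - shift_act p y m"
  by (induction p arbitrary: m) (simp_all add: algebra_simps)

lemma shift_act_sum_seq: "shift_act p (\<lambda>i. \<Sum>j\<in>J. x j i) m = (\<Sum>j\<in>J. shift_act p (x j) m)"
  by (induction p arbitrary: m) (simp_all add: sum.distrib sum_distrib_left)

lemma shift_act_shift_seq: "shift_act p (\<lambda>i. x (i - n)) m = shift_act p x (m - n)"
  by (induction p arbitrary: m) (simp_all add: algebra_simps)

lemma shift_act_mult: "shift_act (p * q) x m = shift_act p (shift_act q x) m"
  by (induction p arbitrary: m) (simp_all add: shift_act_add shift_act_smult)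

lemma shift_act_coeff_seq: "shift_act p (coeff_seq q) m = coeff_seq (p * q) m"
proof (induction p arbitrary: m)
  case (pCons a p)
  have "coeff_seq (pCons 0 (p * q)) m = coeff_seq (p * q) (m - 1)"
    by (auto simp: coeff_seq_def coeff_pCons nat_diff_distrib split: nat.splits)
  moreover have "coeff_seq (smult a q + pCons 0 (p * q)) m = a * coeff_seq q m + coeff_seq (pCons 0 (p * q)) m"
    by (simp add: coeff_seq_def)
  ultimately show ?case using pCons by simp
qed (simp add: coeff_seq_def)

text \<open>Applied to \<theta>, to see that a solution is fixed by it, and to \<open>e\<close>, to
  carry an equation over to the separable closure.\<close>

lemma shift_act_hom:
  assumes "\<And>x y. h (x + y) = h x + h y" "\<And>x y. h (x * y) = h x * h y" "h 0 = 0"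
  shows "h (shift_act p x m) = shift_act (map_poly h p) (\<lambda>i. h (x i)) m"
  by (induction p arbitrary: m) (simp_all add: assms map_poly_pCons)

text \<open>A polynomial with nonzero constant term acts injectively on sequences bounded below,
  since the equations determine the terms from the lowest upwards. Without the bound this fails:
  \<open>Y - z\<close> annihilates a two-sided geometric sequence.\<close>

lemma shift_act_eq_0_below:
  fixes x :: "int \<Rightarrow> 'a::field"
  assumes "coeff p 0 \<noteq> 0" "\<And>m. shift_act p x m = 0" "\<And>m. m < b \<Longrightarrow> x m = 0"
  shows "x m = 0"
proof -
  have "x (b + int n) = 0" for n
  proof (induction n rule: less_induct)
    case (less n)
    have z: "x (b + int n - int k) = 0" if "0 < k" for k
    proof (cases "k \<le> n")
      case True
      then show ?thesis using less[of "n - k"] that by (simp add: of_nat_diff algebra_simps)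
    qed (use assms(3) in auto)
    have "0 = (\<Sum>k\<le>degree p. coeff p k * x (b + int n - int k))"
      using assms(2) by (simp add: shift_act_def)
    also have "\<dots> = (\<Sum>k\<le>degree p. if k = 0 then coeff p 0 * x (b + int n) else 0)"
      by (rule sum.cong) (use z in auto)
    finally show ?case using assms(1) by simp
  qed
  from this[of "nat (m - b)"] show ?thesis using assms(3) by (cases "m < b") auto
qed

text \<open>The substitution of \<open>1/Y\<close> for \<open>Y\<close>, up to the factor
  \<open>Y^degree p\<close>. It exchanges bounds below and bounds above; the nonzero constant term
  keeps the degree of the reflected polynomial equal to that of \<open>p\<close>.\<close>

lemma shift_act_reflect:
  fixes p :: "'a::field poly"
  assumes "coeff p 0 \<noteq> 0"
  shows "shift_act (reflect_poly p) (\<lambda>i. x (- i)) m = shift_act p x (int (degree p) - m)"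
proof -
  have "shift_act (reflect_poly p) (\<lambda>i. x (- i)) m =
      (\<Sum>k\<le>degree p. coeff p (degree p - k) * x (int k - m))"
    using assms by (simp add: shift_act_def coeff_reflect_poly)
  also have "\<dots> = (\<Sum>k\<le>degree p. coeff p k * x (int (degree p) - m - int k))"
    by (rule sum.reindex_bij_witness[where i = "\<lambda>k. degree p - k" and j = "\<lambda>k. degree p - k"])
      (auto simp: of_nat_diff algebra_simps)
  finally show ?thesis by (simp add: shift_act_def)
qed

lemma shift_act_eq_0_above:
  fixes x :: "int \<Rightarrow> 'a::field"
  assumes "coeff p 0 \<noteq> 0" "\<And>m. shift_act p x m = 0" "\<And>m. b < m \<Longrightarrow> x m = 0"
  shows "x m = 0"
proof -
  have "shift_act (reflect_poly p) (\<lambda>i. x (- i)) n = 0" for n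
    by (simp add: shift_act_reflect[OF assms(1)] assms(2))
  moreover have "coeff (reflect_poly p) 0 \<noteq> 0" using assms(1) by auto
  ultimately have "x (- (- m)) = 0"
    using shift_act_eq_0_below[of "reflect_poly p" "\<lambda>i. x (- i)" "- b" "- m"] assms(3) by simp
  then show ?thesis by simp
qed

text \<open>The expansion of \<open>1 / p\<close> at 0, from the inverse of \<open>p\<close> as a
  formal power series.\<close>

lemma shift_act_inverse_below:
  fixes p :: "'a::field poly"
  assumes "coeff p 0 \<noteq> 0"
  shows "\<exists>d. (\<forall>m<0. d m = 0) \<and> (\<forall>m. shift_act p d m = (if m = 0 then 1 else 0))"
proof -
  define d where "d m = (if m < 0 then 0 else fps_nth (inverse (fps_of_poly p)) (nat m))" for m
  have "shift_act p d m = (if m = 0 then 1 else 0)" for m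
  proof (cases "m < 0")
    case True
    then show ?thesis by (simp add: shift_act_def d_def)
  next
    case False
    define n where "n = nat m"
    have m: "m = int n" using False by (simp add: n_def)
    have "shift_act p d m = (\<Sum>k\<le>max n (degree p). coeff p k * d (int n - int k))"
      unfolding m by (rule shift_act_bound) simp
    also have "\<dots> = (\<Sum>k\<le>n. coeff p k * d (int n - int k))"
      by (rule sum.mono_neutral_right) (auto simp: d_def)
    also have "\<dots> = (\<Sum>k=0..n. fps_nth (fps_of_poly p) k * fps_nth (inverse (fps_of_poly p)) (n - k))"
      by (rule sum.cong) (auto simp: d_def nat_diff_distrib)
    also have "\<dots> = fps_nth (fps_of_poly p * inverse (fps_of_poly p)) n"
      by (simp add: fps_mult_nth)
    also have "fps_of_poly p * inverse (fps_of_poly p) = 1"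
      by (rule inverse_mult_eq_1') (use assms in simp)
    finally show ?thesis by (simp add: m)
  qed
  moreover have "\<forall>m<0. d m = 0" by (simp add: d_def)
  ultimately show ?thesis by blast
qed

text \<open>The expansion of \<open>1 / p\<close> at infinity, which starts at
  \<open>Y^(- degree p)\<close>.\<close>

lemma shift_act_inverse_above:
  fixes p :: "'a::field poly"
  assumes "coeff p 0 \<noteq> 0"
  shows "\<exists>d. (\<forall>m>- int (degree p). d m = 0) \<and> (\<forall>m. shift_act p d m = (if m = 0 then 1 else 0))"
proof -
  have "coeff (reflect_poly p) 0 \<noteq> 0" using assms by auto
  then obtain d where d: "\<And>m. m < 0 \<Longrightarrow> d m = 0"
    "\<And>m. shift_act (reflect_poly p) d m = (if m = 0 then 1 else 0)"
    using shift_act_inverse_below by blast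
  \<comment> \<open>\<open>1 / p(Y)\<close> is \<open>Y^(- degree p)\<close> times the reciprocal of
    the reflected polynomial at \<open>1/Y\<close>, so its coefficient at \<open>m\<close> is the
    one of \<open>d\<close> at \<open>- m - degree p\<close>.\<close>
  define c where "c m = d (- m - int (degree p))" for m
  have "shift_act p c m = (if m = 0 then 1 else 0)" for m
  proof -
    have "shift_act p c m = shift_act p c (int (degree p) - (int (degree p) - m))" by simp
    also have "\<dots> = shift_act (reflect_poly p) (\<lambda>i. c (- i)) (int (degree p) - m)"
      using shift_act_reflect[OF assms, of c "int (degree p) - m"] by simp
    also have "\<dots> = shift_act (reflect_poly p) (\<lambda>i. d (i - int (degree p))) (int (degree p) - m)"
      by (simp add: c_def)
    also have "\<dots> = shift_act (reflect_poly p) d (- m)"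
      by (simp add: shift_act_shift_seq)
    finally show ?thesis using d(2) by simp
  qed
  moreover have "\<forall>m>- int (degree p). c m = 0" using d(1) by (simp add: c_def)
  ultimately show ?thesis by blast
qed

section \<open>The residue theorem for the reciprocal of a squarefree split polynomial\<close>

context
  fixes Z :: "'a::field set" and p :: "'a poly" and lc :: 'a
  assumes fin: "finite Z" and p: "p = smult lc (\<Prod>z\<in>Z. [:- z, 1:])" and lc: "lc \<noteq> 0" and nz: "0 \<notin> Z"
begin

private definition cof where "cof z = smult lc (\<Prod>w\<in>Z - {z}. [:- w, 1:])"

private lemma p_cof: "z \<in> Z \<Longrightarrow> p = [:- z, 1:] * cof z"
  using fin by (simp add: p cof_def prod.remove[of Z z])

private lemma pderiv_cof: "z \<in> Z \<Longrightarrow> poly (pderiv p) z = poly (cof z) z"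
proof -
  assume "z \<in> Z"
  then have "pderiv p = [:- z, 1:] * pderiv (cof z) + cof z * pderiv [:- z, 1:]"
    by (subst p_cof) (simp_all only: pderiv_mult)
  then show ?thesis by (simp add: pderiv_pCons)
qed

private lemma cof_other: "z \<in> Z \<Longrightarrow> w \<in> Z \<Longrightarrow> z \<noteq> w \<Longrightarrow> poly (cof z) w = 0"
  using fin by (auto simp: cof_def poly_prod)

private lemma cof_nz: "z \<in> Z \<Longrightarrow> poly (cof z) z \<noteq> 0"
  using fin lc by (auto simp: cof_def poly_prod)

private lemma degree_cof: "z \<in> Z \<Longrightarrow> degree (cof z) < card Z"
proof -
  assume z: "z \<in> Z"
  have "degree (cof z) \<le> (\<Sum>w\<in>Z - {z}. degree [:- w, 1:])"
    unfolding cof_def using fin degree_prod_sum_le[of "Z - {z}" "\<lambda>w. [:- w, 1:]"]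
    by (intro order_trans[OF degree_smult_le]) (simp add: o_def)
  also have "\<dots> = card (Z - {z})" by simp
  also have "\<dots> < card Z" by (rule card_Diff1_less[OF fin z])
  finally show ?thesis .
qed

text \<open>Lagrange interpolation of the constant 1 at the points of \<open>Z\<close>: the
  difference of the two sides has \<open>card Z\<close> zeros but smaller degree. Dividing by
  \<open>p\<close> gives the partial fractions of \<open>1 / p\<close>. For empty \<open>Z\<close>
  the sum would be 0.\<close>

private lemma lagrange:
  assumes "Z \<noteq> {}"
  shows "(\<Sum>z\<in>Z. smult (inverse (poly (pderiv p) z)) (cof z)) = 1" (is "?s = 1")
proof (rule ccontr)
  assume "?s \<noteq> 1"
  then have nz: "?s - 1 \<noteq> 0" by simp
  have "poly (?s - 1) w = 0" if "w \<in> Z" for w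
  proof -
    have "poly ?s w = (\<Sum>z\<in>Z. if z = w then 1 else 0)"
      unfolding poly_sum using that by (intro sum.cong) (auto simp: pderiv_cof cof_other cof_nz)
    then show ?thesis using fin that by simp
  qed
  then have "card Z \<le> card {w. poly (?s - 1) w = 0}"
    by (intro card_mono poly_roots_finite nz) auto
  also have "\<dots> \<le> degree (?s - 1)" by (rule card_poly_roots_bound[OF nz])
  also have "\<dots> < card Z"
  proof (rule degree_diff_less)
    show "degree ?s < card Z"
      using fin degree_cof assms by (intro degree_sum_less) (auto simp: card_gt_0_iff intro: le_less_trans[OF degree_smult_le])
  qed (use fin assms in \<open>simp add: card_gt_0_iff\<close>)
  finally show False by simp
qed

text \<open>The expansions of \<open>1 / (Y - z)\<close> at \<open>0\<close> and at \<open>\<infinity>\<close>.\<close>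

private lemma geometric:
  assumes "z \<in> Z"
  shows "shift_act [:- z, 1:] (\<lambda>m. if m < 0 then 0 else - (z powi (- m - 1))) m = (if m = 0 then 1 else 0)"
    "shift_act [:- z, 1:] (\<lambda>m. if m < 0 then z powi (- m - 1) else 0) m = (if m = 0 then 1 else 0)"
proof -
  have z: "z \<noteq> 0" using assms nz by auto
  have s: "z * z powi (- m - 1) = z powi (- m)"
    using power_int_add_1'[of z "- m - 1"] z by simp
  show "shift_act [:- z, 1:] (\<lambda>m. if m < 0 then 0 else - (z powi (- m - 1))) m = (if m = 0 then 1 else 0)"
    "shift_act [:- z, 1:] (\<lambda>m. if m < 0 then z powi (- m - 1) else 0) m = (if m = 0 then 1 else 0)"
    using s by auto
qed

text \<open>Partial fractions at the level of sequences: \<open>p\<close> is \<open>Y - z\<close>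
  times \<open>cof z\<close>, so it sends an inverse of \<open>Y - z\<close> to
  \<open>cof z\<close>, and \<open>lagrange\<close> sums these up. The direction in which
  \<open>x z\<close> expands is left open, so that both ends are covered.\<close>

private lemma expansion:
  assumes "\<And>z m. z \<in> Z \<Longrightarrow> shift_act [:- z, 1:] (x z) m = (if m = 0 then 1 else (0::'a))" "Z \<noteq> {}"
  shows "shift_act p (\<lambda>m. \<Sum>z\<in>Z. inverse (poly (pderiv p) z) * x z m) m = (if m = 0 then 1 else 0)"
proof -
  have d: "shift_act q (\<lambda>m. if m = 0 then 1 else 0) m = coeff_seq q m" for q :: "'a poly"
  proof -
    have "(\<lambda>m. if m = 0 then 1 else (0::'a)) = coeff_seq 1" by (auto simp: coeff_seq_def)
    then show ?thesis by (simp add: shift_act_coeff_seq)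
  qed
  have "shift_act p (x z) m = coeff_seq (cof z) m" if "z \<in> Z" for z
  proof -
    have "shift_act p (x z) m = shift_act (cof z) (shift_act [:- z, 1:] (x z)) m"
      by (subst p_cof[OF that], subst mult.commute, rule shift_act_mult)
    moreover have "shift_act [:- z, 1:] (x z) = (\<lambda>m. if m = 0 then 1 else 0)"
      using assms(1)[OF that] by (rule ext)
    ultimately show ?thesis using d by simp
  qed
  then have "shift_act p (\<lambda>m. \<Sum>z\<in>Z. inverse (poly (pderiv p) z) * x z m) m =
      (\<Sum>z\<in>Z. inverse (poly (pderiv p) z) * coeff_seq (cof z) m)"
    by (simp add: shift_act_sum_seq shift_act_scale_seq)
  also have "\<dots> = coeff_seq (\<Sum>z\<in>Z. smult (inverse (poly (pderiv p) z)) (cof z)) m"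
    by (simp add: coeff_seq_def coeff_sum)
  also have "\<dots> = (if m = 0 then 1 else 0)"
    by (simp add: lagrange[OF assms(2)] coeff_seq_def)
  finally show ?thesis .
qed

text \<open>The residue of \<open>Y^i / p\<close> is read off at the exponent -1, hence at
  \<open>-1 - i\<close> in \<open>1 / p\<close>. By uniqueness \<open>d0\<close> and
  \<open>di\<close> are the sums of the geometric expansions of the partial fractions, and the claim
  holds separately for each of these.\<close>

lemma residue_sum_reciprocal:
  assumes d0: "\<And>m. m < 0 \<Longrightarrow> d0 m = 0" "\<And>m. shift_act p d0 m = (if m = 0 then 1 else 0)"
    and di: "\<And>m. b < m \<Longrightarrow> di m = 0" "\<And>m. shift_act p di m = (if m = 0 then 1 else 0)"
  shows "(\<Sum>z\<in>Z. inverse (poly (pderiv p) z) * z powi i) + d0 (- 1 - i) - di (- 1 - i) = 0"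
proof (cases "Z = {}")
  \<comment> \<open>Here \<open>p\<close> is the constant \<open>lc\<close> and both expansions
    equal \<open>1 / lc\<close>; \<open>lagrange\<close> does not cover this case.\<close>
  case True
  have "lc * d0 m = (if m = 0 then 1 else 0)" "lc * di m = (if m = 0 then 1 else 0)" for m
    using d0(2) di(2) True by (auto simp: p one_pCons)
  then have "lc * (d0 (- 1 - i) - di (- 1 - i)) = 0" by (simp add: right_diff_distrib)
  then show ?thesis using True lc by simp
next
  case False
  have p0: "coeff p 0 \<noteq> 0"
    using fin lc nz by (auto simp: p poly_0_coeff_0[symmetric] poly_prod)
  define m where "m = - 1 - i"
  define x where "x z m = (if m < 0 then 0 else - (z powi (- m - 1)))" for z :: 'a and m :: int
  define y where "y z m = (if m < 0 then z powi (- m - 1) else 0)" for z :: 'a and m :: int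
  let ?c = "\<lambda>z. inverse (poly (pderiv p) z)"
  have "d0 m - (\<Sum>z\<in>Z. ?c z * x z m) = 0"
  proof (rule shift_act_eq_0_below[OF p0, where b = 0])
    show "shift_act p (\<lambda>m. d0 m - (\<Sum>z\<in>Z. ?c z * x z m)) m = 0" for m
      using expansion[of x, OF _ False] geometric(1) d0(2) by (simp add: shift_act_diff_seq x_def)
  qed (simp add: d0(1) x_def)
  moreover have "di m - (\<Sum>z\<in>Z. ?c z * y z m) = 0"
  proof (rule shift_act_eq_0_above[OF p0, where b = "max b 0"])
    show "shift_act p (\<lambda>m. di m - (\<Sum>z\<in>Z. ?c z * y z m)) m = 0" for m
      using expansion[of y, OF _ False] geometric(2) di(2) by (simp add: shift_act_diff_seq y_def)
  qed (simp add: di(1) y_def)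
  \<comment> \<open>The two expansions of \<open>1 / (Y - z)\<close> differ by the same power of
    \<open>z\<close> at every exponent: \<open>x z m - y z m\<close> is minus
    \<open>z powi (- m - 1)\<close>, and \<open>- m - 1 = i\<close>.\<close>
  moreover have "?c z * z powi i + ?c z * x z m - ?c z * y z m = 0" for z
    by (auto simp: x_def y_def m_def)
  then have "(\<Sum>z\<in>Z. ?c z * z powi i) + (\<Sum>z\<in>Z. ?c z * x z m) - (\<Sum>z\<in>Z. ?c z * y z m) = 0"
    by (simp add: sum.distrib[symmetric] sum_subtractf[symmetric])
  ultimately show ?thesis by (simp add: m_def)
qed

end

section \<open>Skew Laurent polynomials over a field\<close>

lemma type_ring_simps [simp]:
  "carrier (type_ring :: 'k::field ring) = UNIV"
  "x \<otimes>\<^bsub>type_ring\<^esub> y = x * (y::'k)" "x \<oplus>\<^bsub>type_ring\<^esub> y = x + (y::'k)"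
  "\<one>\<^bsub>type_ring\<^esub> = (1::'k)" "\<zero>\<^bsub>type_ring\<^esub> = (0::'k)"
  by (simp_all add: ring_of_type_algebra_def)

lemma finsum_type_ring: "finite I \<Longrightarrow> finsum type_ring f I = (\<Sum>i\<in>I. f i :: 'k::field)"
proof (induction I rule: finite_induct)
  case empty
  show ?case by (simp add: abelian_monoid.finsum_empty ring.is_abelian_group[OF ring_from_type_algebra]
        abelian_group.axioms)
next
  case (insert a I)
  interpret ring "type_ring :: 'k ring" by rule
  show ?case using insert by (simp add: finsum_insert)
qed

lemma Units_type_ring: "Units (type_ring :: 'k::field ring) = - {0}"
proof -
  have "\<exists>y. y * x = 1 \<and> x * y = 1" if "x \<noteq> 0" for x :: 'k
    using that by (intro exI[of _ "inverse x"]) simp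
  then show ?thesis by (auto simp: Units_def)
qed

locale skew_setup =
  fixes \<theta> :: "'k::field \<Rightarrow> 'k" and r :: nat
  assumes theta_iso: "\<theta> \<in> ring_iso type_ring type_ring" and theta_order: "has_order \<theta> r"

sublocale skew_setup \<subseteq> K: ring_automorphism "type_ring :: 'k ring" \<theta>
  by (intro ring_automorphism.intro ring_automorphism_axioms.intro theta_iso ring_from_type_algebra)

context skew_setup
begin

abbreviation "A \<equiv> ring_A \<theta>"
abbreviation "F \<equiv> fixed_field \<theta>"
abbreviation "over_F \<equiv> poly_over (fixed_field \<theta>)"
abbreviation "lm c n \<equiv> laurent_monom (type_ring :: 'k ring) c n"
abbreviation "pw p \<equiv> poly_at_power r p"
abbreviation mult_S :: "(int \<Rightarrow> 'k) \<Rightarrow> (int \<Rightarrow> 'k) \<Rightarrow> int \<Rightarrow> 'k" (infixl \<open>\<odot>\<close> 70)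
  where "f \<odot> g \<equiv> f \<otimes>\<^bsub>K.S\<^esub> g"

sublocale S: ring "K.S" by (rule K.series_ring)

lemma r_pos: "0 < r" and theta_r: "\<theta> ^^ r = id"
  using theta_order by (auto simp: has_order_def)

lemma theta_simps [simp]:
  "\<theta> (x + y) = \<theta> x + \<theta> y" "\<theta> (x * y) = \<theta> x * \<theta> y" "\<theta> 1 = 1" "\<theta> 0 = 0"
  using ring_hom_add[OF K.aut_hom, of x y] ring_hom_mult[OF K.aut_hom, of x y]
    ring_hom_one[OF K.aut_hom] ring_hom_zero[OF K.aut_hom] K.ring_axioms by auto

lemma theta_eq_0 [simp]: "\<theta> x = 0 \<longleftrightarrow> x = 0"
proof
  assume "\<theta> x = 0"
  then have "K.tw 1 x = 0" by (simp add: int_pow_map_def)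
  then have "K.tw (-1) (K.tw 1 x) = 0" using K.tw_zero by simp
  then show "x = 0" using K.tw_add[of x "-1" 1] by simp
qed simp

lemma theta_minus [simp]: "\<theta> (- x) = - \<theta> x"
  using theta_simps(1)[of x "- x"] by (simp add: add_eq_0_iff2)

lemma theta_diff [simp]: "\<theta> (x - y) = \<theta> x - \<theta> y"
  using theta_simps(1)[of x "- y"] by simp

lemma theta_inverse [simp]: "\<theta> (inverse x) = inverse (\<theta> x)"
proof (cases "x = 0")
  case False
  then have "\<theta> x * \<theta> (inverse x) = 1" by (simp flip: theta_simps(2))
  then show ?thesis by (metis inverse_unique)
qed simp

lemma tw_simps [simp]:
  "K.tw i 1 = 1" "K.tw i 0 = 0" "K.tw i (x + y) = K.tw i x + K.tw i y"
  "K.tw i (x * y) = K.tw i x * K.tw i y"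
  using K.tw_one[of i] K.tw_zero[of i] K.tw_plus[of x y i] K.tw_mult[of x y i] by simp_all

lemma lm_apply: "lm c n i = (if i = n then c else 0)"
  by (simp add: laurent_monom_def)

lemma tw_r [simp]: "K.tw (int r * k) x = x"
proof -
  have *: "K.tw (int r) y = y" for y using theta_r by (simp add: int_pow_map_def)
  show ?thesis
  proof (induction k rule: int_induct[where k = 0])
    case (step1 i)
    then show ?case using K.tw_add[of x "int r" "int r * i"] * by (simp add: algebra_simps)
  next
    case (step2 i)
    have "K.tw (int r * (i - 1)) x = K.tw (int r) (K.tw (int r * (i - 1)) x)" using * by simp
    also have "\<dots> = K.tw (int r + int r * (i - 1)) x" using K.tw_add by simp
    finally show ?case using step2 by (simp add: algebra_simps)
  qed simp
qed

lemma tw_fixed: "x \<in> F \<Longrightarrow> K.tw k x = x"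
proof (induction k rule: int_induct[where k = 0])
  case (step1 i)
  then show ?case using K.tw_Suc[of x i] by (simp add: fixed_field_def)
next
  case (step2 i)
  have "inv_into UNIV \<theta> x = x"
    using K.aut_inv(3)[of x] step2 by (simp add: fixed_field_def)
  then show ?case using K.tw_pred[of x i] step2 by simp
qed simp

lemma carrier_A: "f \<in> carrier A \<longleftrightarrow> finite {n. f n \<noteq> 0}"
  by (simp add: skew_laurent_poly_def)

text \<open>\<open>ring_A\<close> differs from the series ring only in its carrier, so all products
  are rewritten to products of series.\<close>

lemma A_simps [simp]:
  "f \<otimes>\<^bsub>A\<^esub> g = f \<odot> g" "f \<oplus>\<^bsub>A\<^esub> g = (\<lambda>n. f n + g n)" "\<zero>\<^bsub>A\<^esub> = (\<lambda>_. 0)"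
  "\<one>\<^bsub>A\<^esub> = \<one>\<^bsub>K.S\<^esub>"
  by (simp_all add: skew_laurent_poly_def skew_laurent_series_def)

lemma A_subset: "carrier A \<subseteq> carrier K.S"
proof
  fix f assume "f \<in> carrier A"
  then have fin: "finite {n. f n \<noteq> 0}" by (simp add: carrier_A)
  have "f n = 0" if "n < Min (insert 0 {n. f n \<noteq> 0})" for n
    using that fin by (metis (mono_tags, lifting) Min_le finite_insert insertCI mem_Collect_eq not_le)
  then have "\<exists>n0. \<forall>n<n0. f n = 0" by blast
  then show "f \<in> carrier K.S" unfolding K.series_carrier by simp
qed

lemma lm_closed [simp]: "lm c n \<in> carrier A"
  by (simp add: carrier_A lm_apply)

lemma mult_A_closed: "f \<in> carrier A \<Longrightarrow> g \<in> carrier A \<Longrightarrow> f \<odot> g \<in> carrier A"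
proof -
  assume f: "f \<in> carrier A" and g: "g \<in> carrier A"
  have "{n. (f \<odot> g) n \<noteq> 0} \<subseteq> (\<lambda>(i, j). i + j) ` ({n. f n \<noteq> 0} \<times> {n. g n \<noteq> 0})"
  proof
    fix n assume n: "n \<in> {n. (f \<odot> g) n \<noteq> 0}"
    have "(f \<odot> g) n = (\<Sum>i\<in>{i. f i \<noteq> 0}. f i * K.tw i (g (n - i)))"
      using f by (subst K.series_mult_on[where I = "{i. f i \<noteq> 0}"]) (auto simp: carrier_A finsum_type_ring)
    then obtain i where "f i \<noteq> 0" "K.tw i (g (n - i)) \<noteq> 0"
      using n by (metis (mono_tags, lifting) mem_Collect_eq mult_zero_right sum.neutral)
    then have "(i, n - i) \<in> {n. f n \<noteq> 0} \<times> {n. g n \<noteq> 0}" using K.tw_zero by auto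
    then show "n \<in> (\<lambda>(i, j). i + j) ` ({n. f n \<noteq> 0} \<times> {n. g n \<noteq> 0})"
      by (rule rev_image_eqI) simp
  qed
  then show ?thesis using f g finite_subset by (fastforce simp: carrier_A)
qed

lemma A_subring: "subring (carrier A) K.S"
proof (rule S.subringI[OF A_subset])
  show "\<one>\<^bsub>K.S\<^esub> \<in> carrier A" by (simp add: K.series_one_monom)
  show "\<ominus>\<^bsub>K.S\<^esub> h \<in> carrier A" if h: "h \<in> carrier A" for h
  proof -
    have "(\<lambda>n. - h n) \<in> carrier A" using h by (simp add: carrier_A)
    then have "\<ominus>\<^bsub>K.S\<^esub> h = (\<lambda>n. - h n)"
      using A_subset h by (intro S.minus_equality) auto
    then show ?thesis using \<open>(\<lambda>n. - h n) \<in> carrier A\<close> by simp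
  qed
  show "h1 \<oplus>\<^bsub>K.S\<^esub> h2 \<in> carrier A" if "h1 \<in> carrier A" "h2 \<in> carrier A" for h1 h2
  proof -
    have "{n. h1 n + h2 n \<noteq> 0} \<subseteq> {n. h1 n \<noteq> 0} \<union> {n. h2 n \<noteq> 0}" by auto
    then show ?thesis using that finite_subset by (fastforce simp: carrier_A)
  qed
qed (rule mult_A_closed)

lemma A_alt: "A = K.S\<lparr>carrier := carrier A\<rparr>"
  by (simp add: skew_laurent_poly_def)

sublocale A: ring A
  using S.subring_is_ring[OF A_subring] A_alt by simp

lemma lm_mult: "lm a m \<odot> lm b n = lm (a * K.tw m b) (m + n)"
proof
  fix i show "(lm a m \<odot> lm b n) i = lm (a * K.tw m b) (m + n) i"
    using K.tw_zero by (subst K.laurent_monom_mult) (auto simp: lm_apply)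
qed

lemma A_induct [consumes 1, case_names zero monom add]:
  assumes "f \<in> carrier A" "P (\<lambda>_. 0)" "\<And>c n. P (lm c n)"
    "\<And>f g. f \<in> carrier A \<Longrightarrow> g \<in> carrier A \<Longrightarrow> P f \<Longrightarrow> P g \<Longrightarrow> P (\<lambda>n. f n + g n)"
  shows "P f"
proof -
  have "P f" if "finite I" "{n. f n \<noteq> 0} \<subseteq> I" for f I
    using that
  proof (induction I arbitrary: f rule: finite_induct)
    case empty
    then have "f = (\<lambda>_. 0)" by auto
    then show ?case using assms(2) by simp
  next
    case (insert a I)
    have sub: "{n. (f(a := 0)) n \<noteq> 0} \<subseteq> I" using insert by auto
    then have "P (f(a := 0))" by (rule insert)
    moreover have "f(a := 0) \<in> carrier A"
      unfolding carrier_A using sub insert(1) finite_subset by blast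
    ultimately have "P (\<lambda>n. (f(a := 0)) n + lm (f a) a n)"
      by (intro assms(4) lm_closed assms(3))
    moreover have "(\<lambda>n. (f(a := 0)) n + lm (f a) a n) = f" by (auto simp: lm_apply)
    ultimately show ?case by simp
  qed
  then show ?thesis using assms(1) by (auto simp: carrier_A)
qed

subsection \<open>Polynomials in \<open>Y\<close>\<close>

lemma pw_eq: "pw p n = (if int r dvd n then coeff_seq p (n div int r) else 0)"
  using r_pos by (auto simp: poly_at_power_def coeff_seq_def pos_imp_zdiv_nonneg_iff)

lemma pw_mult_term [simp]: "pw p (int r * int k) = coeff p k"
  using r_pos by (simp add: pw_eq coeff_seq_def)

lemma pw_mult_term' [simp]: "pw p (int k * int r) = coeff p k"
  using pw_mult_term[of p k] by (simp add: mult.commute)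

lemma pw_nonzeroE:
  assumes "pw p n \<noteq> 0"
  obtains k where "k \<le> degree p" "n = int r * int k"
proof -
  have "0 \<le> n" "int r dvd n" "coeff p (nat (n div int r)) \<noteq> 0"
    using assms by (auto simp: poly_at_power_def split: if_splits)
  then show thesis
    using that[of "nat (n div int r)"] r_pos by (simp add: le_degree pos_imp_zdiv_nonneg_iff)
qed

lemma pw_closed [simp]: "pw p \<in> carrier A"
proof -
  have "{n. pw p n \<noteq> 0} \<subseteq> (\<lambda>k. int r * int k) ` {..degree p}"
    by (auto elim!: pw_nonzeroE)
  then show ?thesis unfolding carrier_A using finite_subset by blast
qed

lemma inj_r: "inj_on (\<lambda>k. int r * int k) I"
  using r_pos by (auto simp: inj_on_def)

text \<open>The exponents in \<open>pw p\<close> are multiples of \<open>r\<close>, and \<theta> to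
  such a power is the identity; hence no twist remains, for any coefficients of
  \<open>p\<close>.\<close>

lemma pw_mult_left: "(pw p \<odot> g) n = (\<Sum>k\<le>degree p. coeff p k * g (n - int r * int k))"
proof -
  have "(pw p \<odot> g) n = (\<Sum>i\<in>(\<lambda>k. int r * int k) ` {..degree p}. pw p i * K.tw i (g (n - i)))"
    by (subst K.series_mult_on[where I = "(\<lambda>k. int r * int k) ` {..degree p}"])
      (auto simp: finsum_type_ring elim!: pw_nonzeroE)
  then show ?thesis by (simp add: sum.reindex[OF inj_r])
qed

text \<open>On this side the coefficients of \<open>p\<close> are twisted by the exponents of
  \<open>g\<close>, which does no harm only for coefficients in \<open>F\<close>.\<close>

lemma pw_mult_right:
  assumes "over_F p"
  shows "(g \<odot> pw p) n = (\<Sum>k\<le>degree p. coeff p k * g (n - int r * int k))"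
proof -
  let ?h = "\<lambda>k. n - int r * int k"
  have inj: "inj_on ?h {..degree p}" using r_pos by (auto simp: inj_on_def)
  have "(g \<odot> pw p) n = (\<Sum>i\<in>?h ` {..degree p}. g i * K.tw i (pw p (n - i)))"
  proof (subst K.series_mult_on[where I = "?h ` {..degree p}"])
    fix i assume "pw p (n - i) \<noteq> \<zero>\<^bsub>type_ring\<^esub>"
    then show "i \<in> ?h ` {..degree p}" by (auto elim!: pw_nonzeroE intro!: image_eqI[of i])
  qed (auto simp: finsum_type_ring)
  also have "\<dots> = (\<Sum>k\<le>degree p. coeff p k * g (n - int r * int k))"
    using assms by (subst sum.reindex[OF inj]) (simp add: tw_fixed poly_over_def mult.commute)
  finally show ?thesis .
qed

lemma pw_central: "over_F p \<Longrightarrow> pw p \<odot> g = g \<odot> pw p"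
  by (rule ext) (simp add: pw_mult_left pw_mult_right)

text \<open>Linearity of the section operators over polynomials in \<open>Y\<close>: the passage
  from the skew ring to two-sided sequences.\<close>

lemma section_pw_mult: "section_op r j (pw p \<odot> g) m = shift_act p (section_op r j g) m"
  by (simp add: section_op_def pw_mult_left shift_act_def algebra_simps)

lemma pw_mult: "pw (p * q) = pw p \<odot> pw q"
proof
  fix n
  have "(pw p \<odot> pw q) n = (\<Sum>k\<le>degree p. coeff p k * pw q (n - int r * int k))"
    by (rule pw_mult_left)
  also have "\<dots> = (if int r dvd n then shift_act p (coeff_seq q) (n div int r) else 0)"
  proof (cases "int r dvd n")
    case True
    then obtain m where n: "n = int r * m" by blast
    have "pw q (n - int r * int k) = coeff_seq q (m - int k)" for k
      using r_pos by (simp add: n pw_eq flip: right_diff_distrib)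
    then show ?thesis using r_pos by (simp add: shift_act_def n)
  next
    case False
    then have "\<not> int r dvd n - int r * int k" for k by (simp add: dvd_diff_left_iff)
    then show ?thesis using False by (simp add: pw_eq)
  qed
  finally show "pw (p * q) n = (pw p \<odot> pw q) n"
    by (simp add: pw_eq shift_act_coeff_seq)
qed

lemma pw_add: "pw (p + q) = (\<lambda>n. pw p n + pw q n)"
  by (auto simp: poly_at_power_def)

lemma pw_const: "pw [:a:] = lm a 0"
proof
  fix n
  have "n = 0" if "int r dvd n" "0 \<le> n" "n div int r \<le> 0"
    using that r_pos by (metis antisym dvd_mult_div_cancel mult_zero_right of_nat_0_less_iff pos_imp_zdiv_nonneg_iff)
  then show "pw [:a:] n = lm a 0 n"
    using r_pos by (auto simp: pw_eq coeff_seq_def lm_apply coeff_pCons pos_imp_zdiv_nonneg_iff split: nat.splits)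
qed

lemma pw_1: "pw 1 = \<one>\<^bsub>K.S\<^esub>"
  by (simp add: one_pCons pw_const K.series_one_monom)

lemma pw_0 [simp]: "pw 0 = (\<lambda>_. 0)"
  by (auto simp: poly_at_power_def)

lemma pw_Y: "pw [:0, 1:] = lm 1 (int r)"
proof
  fix n
  have "n = int r" if "int r dvd n" "n div int r = 1" using that by (metis dvd_mult_div_cancel mult.right_neutral)
  then show "pw [:0, 1:] n = lm 1 (int r) n"
    using r_pos by (auto simp: pw_eq coeff_seq_def lm_apply coeff_pCons nat_eq_iff split: nat.splits)
qed

lemma pw_eq_0_iff [simp]: "pw p = (\<lambda>_. 0) \<longleftrightarrow> p = 0"
proof
  assume "pw p = (\<lambda>_. 0)"
  then have "coeff p k = 0" for k using pw_mult_term[of p k] by simp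
  then show "p = 0" by (simp add: poly_eq_iff)
qed simp

lemma pw_center: "pw p \<in> center_Z \<theta> r \<longleftrightarrow> over_F p"
proof
  assume "pw p \<in> center_Z \<theta> r"
  then have "pw p (int r * int k) \<in> F" for k unfolding center_Z_def by blast
  then show "over_F p" by (simp add: poly_over_def)
next
  assume "over_F p"
  then have "pw p n \<in> F" for n by (auto simp: poly_at_power_def poly_over_def fixed_field_def)
  moreover have "pw p n \<noteq> 0 \<longrightarrow> int r dvd n" for n by (simp add: poly_at_power_def)
  ultimately show "pw p \<in> center_Z \<theta> r" unfolding center_Z_def using pw_closed by blast
qed

lemma lm_Y_central: "lm 1 (int r * k) \<odot> g = g \<odot> lm 1 (int r * k)"
  by (rule ext) (simp add: K.laurent_monom_mult K.mult_laurent_monom)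

text \<open>Multiplying by a power of \<open>Y\<close> moves the support to nonnegative
  exponents.\<close>

lemma center_poly:
  assumes "D \<in> center_Z \<theta> r"
  shows "\<exists>k p. over_F p \<and> D = lm 1 (int r * k) \<odot> pw p"
proof -
  have fin: "finite {n. D n \<noteq> 0}" using assms by (simp add: center_Z_def carrier_A)
  obtain k where k: "\<And>n. n < int r * k \<Longrightarrow> D n = 0"
  proof -
    obtain n0 where n0: "\<And>n. n < n0 \<Longrightarrow> D n = 0"
    proof -
      have "D \<in> carrier K.S" using assms A_subset by (auto simp: center_Z_def)
      then show thesis using that by (auto simp: K.series_carrier)
    qed
    \<comment> \<open>A multiple of \<open>r\<close> is wanted below \<open>n0\<close>; for a
      nonpositive number, multiplication by \<open>r\<close> can only lower it.\<close>
    have "int r * min n0 0 \<le> 1 * min n0 0" using r_pos by (intro mult_right_mono_neg) auto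
    then have "int r * min n0 0 \<le> n0" by simp
    then show thesis using that[of "min n0 0"] n0 by (meson less_le_trans)
  qed
  define p where "p = Abs_poly (\<lambda>i. D (int r * (k + int i)))"
  have "finite ((\<lambda>i. int r * (k + int i)) -` {n. D n \<noteq> 0})"
    using r_pos by (intro finite_vimageI fin) (auto simp: inj_on_def)
  then have "\<forall>\<^sub>\<infinity>i. D (int r * (k + int i)) = 0"
    by (simp add: MOST_iff_cofinite vimage_def)
  then have coeff: "coeff p i = D (int r * (k + int i))" for i
    unfolding p_def by (metis Abs_poly_inverse mem_Collect_eq)
  have "over_F p" using assms by (simp add: poly_over_def coeff center_Z_def)
  moreover have "D n = (lm 1 (int r * k) \<odot> pw p) n" for n
  proof -
    have rhs: "(lm 1 (int r * k) \<odot> pw p) n = pw p (n - int r * k)"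
      by (simp add: K.laurent_monom_mult)
    show ?thesis
    proof (cases "int r dvd n \<and> int r * k \<le> n")
      case True
      then obtain m where m: "n = int r * m" by blast
      then have "k \<le> m" using True r_pos by simp
      then have "n - int r * k = int r * int (nat (m - k))" "n = int r * (k + int (nat (m - k)))"
        using m by (simp_all add: algebra_simps)
      then show ?thesis using rhs coeff by (metis pw_mult_term)
    next
      case False
      then have "D n = 0" using k assms by (auto simp: center_Z_def)
      moreover have "pw p (n - int r * k) = 0"
        using False by (auto simp: poly_at_power_def dvd_diff_left_iff)
      ultimately show ?thesis using rhs by simp
    qed
  qed
  ultimately show ?thesis by blast
qed

lemma center_commute:
  assumes "D \<in> center_Z \<theta> r" "g \<in> carrier K.S"
  shows "D \<odot> g = g \<odot> D"
proof -
  obtain k p where p: "over_F p" "D = lm 1 (int r * k) \<odot> pw p" using center_poly[OF assms(1)] by blast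
  have c: "lm 1 (int r * k) \<in> carrier K.S" "pw p \<in> carrier K.S" using A_subset by auto
  have "D \<odot> g = lm 1 (int r * k) \<odot> (g \<odot> pw p)"
    using c assms(2) pw_central[OF p(1)] by (simp add: p(2) S.m_assoc)
  also have "\<dots> = g \<odot> (lm 1 (int r * k) \<odot> pw p)"
    using c assms(2) lm_Y_central[of k g] by (simp add: S.m_assoc[symmetric])
  finally show ?thesis by (simp add: p(2))
qed

lemma center_A: "center_Z \<theta> r \<subseteq> carrier A"
  by (auto simp: center_Z_def)

text \<open>The lowest nonzero coefficient lies in a field, so it is a unit. This makes fractions
  expand at 0 and, applied to the inverse automorphism, at infinity; it also gives cancellation in
  \<open>A\<close>.\<close>

lemma A_Units:
  assumes "f \<in> carrier A" "f \<noteq> (\<lambda>_. 0)"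
  shows "f \<in> Units K.S"
proof -
  let ?M = "{n. f n \<noteq> 0}"
  have fin: "finite ?M" using assms by (simp add: carrier_A)
  have ne: "?M \<noteq> {}" using assms(2) by auto
  show ?thesis
  proof (rule K.series_Units)
    show "f \<in> carrier K.S" using assms A_subset by blast
    show "f n = \<zero>\<^bsub>type_ring\<^esub>" if "n < Min ?M" for n
      using that Min_le[OF fin, of n] by force
    show "f (Min ?M) \<in> Units type_ring" using Min_in[OF fin ne] by (simp add: Units_type_ring)
  qed
qed

lemma A_cancel:
  assumes "f \<in> carrier A" "f \<noteq> (\<lambda>_. 0)" "g \<in> carrier K.S" "h \<in> carrier K.S" "f \<odot> g = f \<odot> h"
  shows "g = h"
  using A_Units[OF assms(1,2)] assms(3-5) by (simp add: S.Units_l_cancel)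

end

lemma (in monoid) inv_commute:
  assumes "a \<in> carrier G" "u \<in> Units G" "a \<otimes> u = u \<otimes> a"
  shows "a \<otimes> inv u = inv u \<otimes> a"
proof -
  have u: "u \<in> carrier G" "inv u \<in> carrier G" "inv u \<otimes> u = \<one>" "u \<otimes> inv u = \<one>" using assms(2) by auto
  have "inv u \<otimes> (a \<otimes> u) \<otimes> inv u = inv u \<otimes> (u \<otimes> a) \<otimes> inv u" by (simp only: assms(3))
  moreover have "inv u \<otimes> (a \<otimes> u) \<otimes> inv u = inv u \<otimes> a" using u assms(1) by (simp add: m_assoc)
  moreover have "inv u \<otimes> (u \<otimes> a) = a" using u assms(1) by (simp add: m_assoc[symmetric])
  ultimately show ?thesis by simp
qed

section \<open>Fractions\<close>

context skew_setup
begin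

text \<open>The class is described through one fixed representative, so that no appeal to
  transitivity of \<open>frac_rel\<close> is made.\<close>

lemma frac_A_E:
  assumes "f \<in> frac_A \<theta> r"
  obtains P0 D0 where "P0 \<in> carrier A" "D0 \<in> center_Z \<theta> r" "D0 \<noteq> (\<lambda>_. 0)"
    "\<And>P D. (P, D) \<in> f \<longleftrightarrow> P \<in> carrier A \<and> D \<in> center_Z \<theta> r \<and> D \<noteq> (\<lambda>_. 0) \<and> D \<odot> P0 = D0 \<odot> P"
proof -
  obtain P0 D0 where "P0 \<in> carrier A" "D0 \<in> center_Z \<theta> r" "D0 \<noteq> (\<lambda>_. 0)"
    "f = frac_rel \<theta> r `` {(P0, D0)}"
    using assms by (auto simp: frac_A_def quotient_def)
  moreover from this have "(P, D) \<in> f \<longleftrightarrow> P \<in> carrier A \<and> D \<in> center_Z \<theta> r \<and> D \<noteq> (\<lambda>_. 0) \<and>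
      D \<odot> P0 = D0 \<odot> P" for P D
    by (auto simp: frac_rel_def)
  ultimately show thesis using that by blast
qed

lemma frac_A_mem:
  assumes "f \<in> frac_A \<theta> r" "(P, D) \<in> f"
  shows "P \<in> carrier A" "D \<in> center_Z \<theta> r" "D \<noteq> (\<lambda>_. 0)"
  using assms by (auto elim!: frac_A_E)

text \<open>\<open>M\<close> commutes past \<open>D0\<close> and is a unit among the series, so it
  can be removed from the defining equation of the class. This is how a denominator is
  reduced.\<close>

lemma frac_A_cancel:
  assumes "f \<in> frac_A \<theta> r" "(M \<odot> P, M \<odot> D) \<in> f"
    and M: "M \<in> center_Z \<theta> r" "M \<noteq> (\<lambda>_. 0)" and D: "D \<in> center_Z \<theta> r" and P: "P \<in> carrier A"
  shows "(P, D) \<in> f"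
proof -
  obtain P0 D0 where 0: "P0 \<in> carrier A" "D0 \<in> center_Z \<theta> r" "D0 \<noteq> (\<lambda>_. 0)"
    and f: "\<And>P D. (P, D) \<in> f \<longleftrightarrow> P \<in> carrier A \<and> D \<in> center_Z \<theta> r \<and> D \<noteq> (\<lambda>_. 0) \<and> D \<odot> P0 = D0 \<odot> P"
    using assms(1) by (elim frac_A_E) blast
  have c: "P0 \<in> carrier K.S" "D0 \<in> carrier K.S" "M \<in> carrier K.S" "D \<in> carrier K.S" "P \<in> carrier K.S"
    using 0 M D P A_subset center_A by blast+
  have "M \<odot> (D \<odot> P0) = D0 \<odot> (M \<odot> P)" using assms(2) f c by (simp add: S.m_assoc)
  also have "\<dots> = M \<odot> (D0 \<odot> P)"
    using c center_commute[OF M(1) c(2)] by (simp add: S.m_assoc[symmetric])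
  finally have "D \<odot> P0 = D0 \<odot> P"
  proof (rule A_cancel[of M, rotated 4])
    show "D \<odot> P0 \<in> carrier K.S" "D0 \<odot> P \<in> carrier K.S" "M \<in> carrier A" "M \<noteq> (\<lambda>_. 0)"
      using M center_A c by blast+
  qed
  moreover have "D \<noteq> (\<lambda>_. 0)"
  proof
    assume "D = (\<lambda>_. 0)"
    then have "M \<odot> D = (\<lambda>_. 0)" using S.r_null[OF c(3)] by simp
    then show False using assms(2) f by blast
  qed
  ultimately show ?thesis using f D P by blast
qed

text \<open>Denominators are central, so their images commute with each other and all
  representatives yield the same quotient. The equation obtained is free of inverses; it serves for
  the expansions at \<open>z\<close>, at 0 and at infinity.\<close>

lemma frac_extend_char:
  fixes R' :: "('c, 'd) ring_scheme"
  assumes "monoid R'"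
    and clo: "\<And>a. a \<in> carrier A \<Longrightarrow> \<phi> a \<in> carrier R'"
    and mult: "\<And>a b. a \<in> carrier A \<Longrightarrow> b \<in> carrier A \<Longrightarrow> \<phi> (a \<odot> b) = \<phi> a \<otimes>\<^bsub>R'\<^esub> \<phi> b"
    and units: "\<And>D. D \<in> center_Z \<theta> r \<Longrightarrow> D \<noteq> (\<lambda>_. 0) \<Longrightarrow> \<phi> D \<in> Units R'"
    and f: "f \<in> frac_A \<theta> r"
  shows "frac_extend R' \<phi> f \<in> carrier R'"
    and "\<And>P D. (P, D) \<in> f \<Longrightarrow> \<phi> D \<otimes>\<^bsub>R'\<^esub> frac_extend R' \<phi> f = \<phi> P"
proof -
  interpret R': monoid R' by fact
  obtain P0 D0 where 0: "P0 \<in> carrier A" "D0 \<in> center_Z \<theta> r" "D0 \<noteq> (\<lambda>_. 0)"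
    and f: "\<And>P D. (P, D) \<in> f \<longleftrightarrow> P \<in> carrier A \<and> D \<in> center_Z \<theta> r \<and> D \<noteq> (\<lambda>_. 0) \<and> D \<odot> P0 = D0 \<odot> P"
    using f by (elim frac_A_E) blast
  define g where "g = inv\<^bsub>R'\<^esub> (\<phi> D0) \<otimes>\<^bsub>R'\<^esub> \<phi> P0"
  have D0: "\<phi> D0 \<in> Units R'" "\<phi> D0 \<in> carrier R'" "D0 \<in> carrier A" using units clo 0 center_A by blast+
  have g: "g \<in> carrier R'" using D0 clo 0 by (simp add: g_def)
  have eq: "\<phi> D \<otimes>\<^bsub>R'\<^esub> g = \<phi> P" if "(P, D) \<in> f" for P D
  proof -
    have PD: "P \<in> carrier A" "D \<in> center_Z \<theta> r" "D \<in> carrier A" "D \<odot> P0 = D0 \<odot> P"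
      using that f center_A by auto
    have c: "\<phi> D \<in> carrier R'" "\<phi> P \<in> carrier R'" "\<phi> P0 \<in> carrier R'" using PD clo 0 by auto
    have "D \<odot> D0 = D0 \<odot> D" using center_commute PD D0 A_subset by blast
    then have "\<phi> D \<otimes>\<^bsub>R'\<^esub> \<phi> D0 = \<phi> D0 \<otimes>\<^bsub>R'\<^esub> \<phi> D" using mult PD D0 by metis
    then have com: "\<phi> D \<otimes>\<^bsub>R'\<^esub> inv\<^bsub>R'\<^esub> (\<phi> D0) = inv\<^bsub>R'\<^esub> (\<phi> D0) \<otimes>\<^bsub>R'\<^esub> \<phi> D"
      using R'.inv_commute c D0 by blast
    have "\<phi> D \<otimes>\<^bsub>R'\<^esub> g = inv\<^bsub>R'\<^esub> (\<phi> D0) \<otimes>\<^bsub>R'\<^esub> (\<phi> D \<otimes>\<^bsub>R'\<^esub> \<phi> P0)"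
      using c D0 com by (simp add: g_def R'.m_assoc[symmetric])
    also have "\<phi> D \<otimes>\<^bsub>R'\<^esub> \<phi> P0 = \<phi> D0 \<otimes>\<^bsub>R'\<^esub> \<phi> P" using mult PD D0 0 by metis
    also have "inv\<^bsub>R'\<^esub> (\<phi> D0) \<otimes>\<^bsub>R'\<^esub> (\<phi> D0 \<otimes>\<^bsub>R'\<^esub> \<phi> P) = \<phi> P"
      using c D0 by (simp add: R'.m_assoc[symmetric])
    finally show ?thesis .
  qed
  have "inv\<^bsub>R'\<^esub> (\<phi> D) \<otimes>\<^bsub>R'\<^esub> \<phi> P = g" if PD: "(P, D) \<in> f" for P D
  proof -
    have D: "\<phi> D \<in> Units R'" using PD f units by blast
    then have "inv\<^bsub>R'\<^esub> (\<phi> D) \<otimes>\<^bsub>R'\<^esub> (\<phi> D \<otimes>\<^bsub>R'\<^esub> g) = g"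
      using g by (simp add: R'.m_assoc[symmetric] R'.Units_closed)
    then show ?thesis by (simp add: eq[OF PD])
  qed
  moreover have "(P0, D0) \<in> f" using f 0 by simp
  \<comment> \<open>Only now does \<open>the_elem\<close> in \<open>frac_extend\<close> have a
    meaning.\<close>
  ultimately have "(\<lambda>(P, D). inv\<^bsub>R'\<^esub> (\<phi> D) \<otimes>\<^bsub>R'\<^esub> \<phi> P) ` f = {g}" by force
  then have "frac_extend R' \<phi> f = g" by (simp add: frac_extend_def)
  then show "frac_extend R' \<phi> f \<in> carrier R'"
    and "\<And>P D. (P, D) \<in> f \<Longrightarrow> \<phi> D \<otimes>\<^bsub>R'\<^esub> frac_extend R' \<phi> f = \<phi> P"
    using g eq by auto
qed

end

section \<open>Polynomials over the fixed field\<close>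

lemma map_poly_hom_mult:
  fixes h :: "'a::comm_ring_1 \<Rightarrow> 'b::comm_ring_1"
  assumes "\<And>x y. h (x + y) = h x + h y" "\<And>x y. h (x * y) = h x * h y" "h 0 = 0"
  shows "map_poly h (p + q) = map_poly h p + map_poly h q"
    "map_poly h (p * q) = map_poly h p * map_poly h q"
proof -
  show add: "map_poly h (p + q) = map_poly h p + map_poly h q" for p q
    by (simp add: poly_eq_iff coeff_map_poly assms)
  show "map_poly h (p * q) = map_poly h p * map_poly h q"
    by (induction p) (simp_all add: add map_poly_pCons map_poly_smult assms)
qed

lemma map_poly_hom_pderiv:
  fixes h :: "'a::{comm_ring_1,semiring_no_zero_divisors} \<Rightarrow> 'b::{comm_ring_1,semiring_no_zero_divisors}"
  assumes "\<And>x y. h (x + y) = h x + h y" "h 0 = 0"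
  shows "map_poly h (pderiv p) = pderiv (map_poly h p)"
proof (induction p)
  case (pCons a p)
  have "map_poly h (p + pCons 0 (pderiv p)) = map_poly h p + map_poly h (pCons 0 (pderiv p))"
    by (simp add: poly_eq_iff coeff_map_poly assms)
  then show ?case using pCons by (simp add: map_poly_pCons assms pderiv_pCons)
qed simp

context skew_setup
begin

text \<open>As an equation, the condition is compatible with ring operations and with
  derivatives.\<close>

lemma over_F_iff: "over_F p \<longleftrightarrow> map_poly \<theta> p = p"
  by (simp add: poly_over_def fixed_field_def poly_eq_iff coeff_map_poly)

lemma over_F_simps [simp]: "over_F 0" "over_F 1" "over_F [:0, 1:]"
  by (simp_all add: over_F_iff map_poly_pCons)

lemma over_F_add: "over_F p \<Longrightarrow> over_F q \<Longrightarrow> over_F (p + q)"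
  and over_F_mult: "over_F p \<Longrightarrow> over_F q \<Longrightarrow> over_F (p * q)"
  and over_F_diff: "over_F p \<Longrightarrow> over_F q \<Longrightarrow> over_F (p - q)"
  and over_F_smult: "c \<in> F \<Longrightarrow> over_F p \<Longrightarrow> over_F (smult c p)"
proof -
  show "over_F p \<Longrightarrow> over_F q \<Longrightarrow> over_F (p * q)"
    unfolding over_F_iff by (simp add: map_poly_hom_mult)
qed (simp_all add: poly_over_def fixed_field_def)

lemma over_F_pderiv: "over_F p \<Longrightarrow> over_F (pderiv p)"
  by (simp add: over_F_iff map_poly_hom_pderiv)

text \<open>Applying \<theta> to a division with remainder by \<open>q\<close> gives another one for
  the same \<open>p\<close> and \<open>q\<close>; uniqueness makes quotient and remainder invariant.
  Hence division over \<open>K\<close> agrees with division over \<open>F\<close>.\<close>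

lemma over_F_div_mod:
  assumes "over_F p" "over_F q" "q \<noteq> 0"
  shows "over_F (p div q)" "over_F (p mod q)"
proof -
  have "p = map_poly \<theta> (p div q * q + p mod q)" using assms(1) by (simp add: over_F_iff)
  also have "\<dots> = map_poly \<theta> (p div q) * map_poly \<theta> q + map_poly \<theta> (p mod q)"
    by (simp only: map_poly_hom_mult theta_simps)
  also have "map_poly \<theta> q = q" using assms(2) by (simp only: over_F_iff)
  finally have *: "p = map_poly \<theta> (p div q) * q + map_poly \<theta> (p mod q)" .
  have "degree (map_poly \<theta> (p mod q)) = degree (p mod q)" by (rule degree_map_poly) simp
  moreover have "p mod q = 0 \<or> degree (p mod q) < degree q" using assms(3) by (rule degree_mod_less)
  ultimately have "map_poly \<theta> (p mod q) div q = 0" by (auto simp: div_poly_eq_0_iff)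
  then have "p div q = map_poly \<theta> (p div q)"
    using div_mult_self3[OF assms(3), of "map_poly \<theta> (p div q)" "map_poly \<theta> (p mod q)"] *[symmetric] by simp
  then show div: "over_F (p div q)" by (simp add: over_F_iff)
  show "over_F (p mod q)"
    unfolding minus_div_mult_eq_mod[symmetric] using div assms by (intro over_F_diff over_F_mult)
qed

end

section \<open>Minimal polynomials\<close>

locale skew_closure = skew_setup \<theta> r
  for \<theta> :: "'k::field \<Rightarrow> 'k" and r +
  fixes e :: "'k \<Rightarrow> 'l::field"
  assumes e_hom: "e \<in> ring_hom type_ring type_ring"
    and sep_closure: "separable_closure (fixed_field \<theta>) e"
begin

abbreviation "ev p z \<equiv> poly (map_poly e p) z"
abbreviation "mp z \<equiv> min_poly (fixed_field \<theta>) e z"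

lemma e_simps [simp]: "e (x + y) = e x + e y" "e (x * y) = e x * e y" "e 1 = 1" "e 0 = 0"
proof -
  show "e (x + y) = e x + e y" for x y using ring_hom_add[OF e_hom, of x y] by simp
  from this[of 0 0] have "e 0 + 0 = e 0 + e 0" by (simp only: add_0_right)
  then show "e 0 = 0" by (simp only: add_left_cancel)
qed (use ring_hom_mult[OF e_hom, of x y] ring_hom_one[OF e_hom] in simp_all)

lemma e_eq_0 [simp]: "e x = 0 \<longleftrightarrow> x = 0"
proof
  assume "e x = 0"
  then have "e (x * inverse x) = 0" by (simp del: mult_cancel_left) 
  then show "x = 0" by (cases "x = 0") (simp_all del: e_simps(2))
qed simp

lemma e_minus [simp]: "e (- x) = - e x"
  using e_simps(1)[of x "- x"] by (simp add: add_eq_0_iff2)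

lemma ev_simps [simp]:
  "ev (p + q) z = ev p z + ev q z" "ev (p * q) z = ev p z * ev q z"
  by (simp_all add: map_poly_hom_mult)

lemma ev_diff [simp]: "ev (p - q) z = ev p z - ev q z"
  using ev_simps(1)[of "p - q" q z] by simp

lemma ev_div_mod: "ev p z = ev q z * ev (p div q) z + ev (p mod q) z"
  by (simp only: ev_simps[symmetric] mult_div_mod_eq)

text \<open>The description in \<open>min_poly\<close> is proper: an annihilating polynomial of
  least degree can be made monic, and the difference of two such monic polynomials would annihilate
  \<open>z\<close> in smaller degree.\<close>

lemma min_poly_props:
  "annihilates F e z (mp z)" "lead_coeff (mp z) = 1"
  "annihilates F e z q \<Longrightarrow> degree (mp z) \<le> degree q"
proof -
  let ?P = "\<lambda>p. annihilates F e z p \<and> lead_coeff p = 1 \<and> (\<forall>q. annihilates F e z q \<longrightarrow> degree p \<le> degree q)"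
  obtain p where p: "annihilates F e z p" "\<And>q. annihilates F e z q \<Longrightarrow> degree p \<le> degree q"
  proof -
    obtain p0 where "annihilates F e z p0" using sep_closure by (auto simp: separable_closure_def)
    then show thesis using that ex_has_least_nat[of "annihilates F e z" p0 degree] by blast
  qed
  define p1 where "p1 = smult (inverse (lead_coeff p)) p"
  have "inverse (lead_coeff p) \<in> F" using p(1) by (auto simp: annihilates_def poly_over_def fixed_field_def)
  then have p1: "?P p1"
    using p over_F_smult by (auto simp: p1_def annihilates_def map_poly_smult)
  have "?P (THE p. ?P p)"
  proof (rule theI)
    show "?P p1" by (rule p1)
    fix p2 assume p2: "?P p2"
    have deg: "degree p1 = degree p2" using p1 p2 by (simp add: eq_iff)
    show "p2 = p1"
    proof (rule ccontr)
      assume "p2 \<noteq> p1"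
      then have nz: "p2 - p1 \<noteq> 0" by simp
      then have "annihilates F e z (p2 - p1)"
        using p1 p2 over_F_diff by (auto simp: annihilates_def)
      then have "degree p1 \<le> degree (p2 - p1)" using p1 by blast
      moreover have "degree (p2 - p1) < degree p1"
      proof -
        have "coeff (p2 - p1) (degree p1) = 0" using p1 p2 deg by simp
        then have "degree (p2 - p1) \<noteq> degree p1" using nz by (metis leading_coeff_0_iff)
        moreover have "degree (p2 - p1) \<le> degree p1" using deg by (simp add: degree_diff_le)
        ultimately show ?thesis by simp
      qed
      ultimately show False by simp
    qed
  qed
  then have "?P (mp z)" by (simp add: min_poly_def)
  then show "annihilates F e z (mp z)" "lead_coeff (mp z) = 1"
    "annihilates F e z q \<Longrightarrow> degree (mp z) \<le> degree q" by auto
qed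

lemma mp_simps [simp]: "over_F (mp z)" "ev (mp z) z = 0" "mp z \<noteq> 0"
  using min_poly_props(1)[of z] by (auto simp: annihilates_def)

lemma mp_minimal: "over_F q \<Longrightarrow> ev q z = 0 \<Longrightarrow> degree q < degree (mp z) \<Longrightarrow> q = 0"
  using min_poly_props(3)[of z q] by (auto simp: annihilates_def)

lemma degree_mp: "0 < degree (mp z)"
proof (rule ccontr)
  assume "\<not> 0 < degree (mp z)"
  then have "mp z = [:1:]"
    using min_poly_props(2)[of z] by (metis degree_eq_zeroE coeff_pCons_0 degree_pCons_0 gr0I)
  then show False using mp_simps(2)[of z] by (simp add: map_poly_pCons)
qed

lemma mp_dvd:
  assumes "over_F p" "ev p z = 0"
  obtains q where "over_F q" "p = mp z * q"
proof -
  have "ev (p mod mp z) z = 0" using assms ev_div_mod[of p z "mp z"] by simp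
  moreover have "degree (p mod mp z) < degree (mp z)"
    using degree_mp by (metis degree_mod_less mp_simps(3) degree_0)
  ultimately have "p mod mp z = 0" using mp_minimal over_F_div_mod assms(1) by simp
  then have "p = mp z * (p div mp z)" by (metis add.right_neutral mult_div_mod_eq)
  then show thesis by (rule that[rotated]) (simp add: over_F_div_mod(1)[OF assms(1)])
qed

text \<open>By minimality the derivative could vanish at \<open>z\<close> only by being 0, and then
  coprimality would make \<open>mp z\<close> a unit. The resulting simple zero gives the image of
  \<open>N\<close> in the series in \<open>T\<close> valuation exactly 1.\<close>

lemma mp_separable: "ev (pderiv (mp z)) z \<noteq> 0"
proof
  assume "ev (pderiv (mp z)) z = 0"
  moreover have "degree (pderiv (mp z)) < degree (mp z)"
  proof -
    have "degree (pderiv (mp z)) \<le> degree (mp z) - 1"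
      by (rule degree_le) (auto simp: coeff_pderiv coeff_eq_0)
    then show ?thesis using degree_mp[of z] by simp
  qed
  ultimately have "pderiv (mp z) = 0" using mp_minimal[of "pderiv (mp z)" z] over_F_pderiv by simp
  moreover have "separable_poly (mp z)" using sep_closure by (auto simp: separable_closure_def)
  ultimately have "is_unit (mp z)" by (simp add: separable_poly_def)
  then show False using degree_mp[of z] by (simp add: is_unit_iff_degree)
qed

text \<open>Division with remainder of \<open>N\<close> by \<open>p\<close> lowers the degree of \<open>p\<close> without creating a zero
  at \<open>z\<close>, because the quotient has smaller degree than \<open>N\<close>.\<close>

lemma mp_bezout:
  assumes "over_F p" "ev p z \<noteq> 0"
  shows "\<exists>U V. over_F U \<and> over_F V \<and> U * p + V * mp z = 1"
  using assms
proof (induction "degree p" arbitrary: p rule: less_induct)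
  case less
  let ?N = "mp z"
  have p0: "p \<noteq> 0" using less.prems by auto
  show ?case
  proof (cases "degree ?N \<le> degree p")
    case True
    have "ev (p mod ?N) z \<noteq> 0" using less.prems ev_div_mod[of p z ?N] by simp
    moreover have "degree (p mod ?N) < degree p"
      using True degree_mp[of z] degree_mod_less[of ?N p] p0 by fastforce
    ultimately obtain U V where UV: "over_F U" "over_F V" "U * (p mod ?N) + V * ?N = 1"
      using less.hyps[of "p mod ?N"] over_F_div_mod less.prems by auto
    have "U * p + (V - U * (p div ?N)) * ?N = U * (p - p div ?N * ?N) + V * ?N"
      by (simp add: algebra_simps)
    also have "p - p div ?N * ?N = p mod ?N" by (rule minus_div_mult_eq_mod)
    finally show ?thesis
      using UV less.prems over_F_div_mod over_F_mult over_F_diff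
      by (intro exI[of _ U] exI[of _ "V - U * (p div ?N)"]) auto
  next
    case False
    show ?thesis
    proof (cases "degree p = 0")
      case True
      then obtain c where c: "p = [:c:]" by (rule degree_eq_zeroE)
      then have "c \<noteq> 0" "c \<in> F" using p0 less.prems(1) by (auto simp: poly_over_def dest: spec[of _ 0])
      then have "over_F (smult (inverse c) 1)" by (intro over_F_smult over_F_simps) (simp add: fixed_field_def)
      then show ?thesis using c \<open>c \<noteq> 0\<close>
        by (intro exI[of _ "smult (inverse c) 1"] exI[of _ 0]) (simp add: one_pCons)
    next
      case deg: False
      let ?q = "?N div p" and ?s = "?N mod p"
      have N: "?N = ?q * p + ?s" by simp
      have q0: "?q \<noteq> 0" using False p0 by (simp add: div_poly_eq_0_iff)
      have s: "degree ?s < degree p"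
        using deg p0 degree_mod_less[of p ?N] by auto
      have "degree ?q + degree p = degree ?N"
      proof -
        have "degree (?q * p) = degree ?q + degree p" using q0 p0 by (rule degree_mult_eq)
        moreover have "degree (?q * p + ?s) = degree (?q * p)"
          using s calculation by (intro degree_add_eq_left) simp
        ultimately show ?thesis using N by metis
      qed
      then have "ev ?q z \<noteq> 0"
        using q0 mp_minimal[of ?q z] over_F_div_mod[of ?N p] less.prems p0 deg by fastforce
      then have "ev ?s z \<noteq> 0" using ev_div_mod[of ?N z p] less.prems(2) by auto
      then obtain U V where UV: "over_F U" "over_F V" "U * ?s + V * ?N = 1"
        using less.hyps[OF s] over_F_div_mod less.prems p0 by auto
      have "(- U * ?q) * p + (U + V) * ?N = U * (?N - ?q * p) + V * ?N"
        by (simp add: algebra_simps)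
      also have "?N - ?q * p = ?s" by (rule minus_div_mult_eq_mod)
      moreover have "over_F (0 - U * ?q)"
        using UV less.prems p0 over_F_div_mod[of ?N p] by (intro over_F_diff over_F_mult) auto
      ultimately show ?thesis
        using UV over_F_add by (intro exI[of _ "- U * ?q"] exI[of _ "U + V"]) auto
    qed
  qed
qed

end

section \<open>Taylor expansions\<close>

text \<open>\<open>PIdl\<close> consists of left multiples; centrality of \<open>a\<close> gives
  closure under multiplication from the right.\<close>

lemma (in ring) central_cgenideal_ideal:
  assumes a: "a \<in> carrier R" and central: "\<And>x. x \<in> carrier R \<Longrightarrow> a \<otimes> x = x \<otimes> a"
  shows "ideal (PIdl a) R"
proof -
  have mem: "x \<in> PIdl a \<longleftrightarrow> (\<exists>u\<in>carrier R. x = u \<otimes> a)" for x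
    by (auto simp: cgenideal_def)
  show ?thesis
  proof (intro idealI[OF ring_axioms] add.subgroupI)
    show "PIdl a \<subseteq> carrier R" using a mem by auto
    show "PIdl a \<noteq> {}" using cgenideal_self[OF a] by blast
  next
    fix x assume "x \<in> PIdl a"
    then obtain u where u: "u \<in> carrier R" "x = u \<otimes> a" using mem by blast
    then have "\<ominus> x = (\<ominus> u) \<otimes> a" using a by (simp add: l_minus)
    then show "\<ominus> x \<in> PIdl a" using u mem by blast
    fix y assume y: "y \<in> carrier R"
    have "y \<otimes> x = (y \<otimes> u) \<otimes> a" using u a y by (simp add: m_assoc)
    then show "y \<otimes> x \<in> PIdl a" using u y mem by blast
    have "x \<otimes> y = (u \<otimes> y) \<otimes> a" using u a y central by (simp add: m_assoc)
    then show "x \<otimes> y \<in> PIdl a" using u y mem by blast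
  next
    fix x y assume "x \<in> PIdl a" "y \<in> PIdl a"
    then obtain u v where u: "u \<in> carrier R" "x = u \<otimes> a" and v: "v \<in> carrier R" "y = v \<otimes> a"
      using mem by meson
    then have "x \<oplus> y = (u \<oplus> v) \<otimes> a" using a by (simp add: l_distr)
    then show "x \<oplus> y \<in> PIdl a" using u v mem by blast
  qed
qed

lemma (in ring) ring_automorphism_id: "ring_automorphism R id"
  by (intro ring_automorphism.intro ring_automorphism_axioms.intro ring_axioms)
    (auto simp: ring_iso_def intro!: ring_hom_memI)

lemma (in ring) int_pow_map_id:
  assumes "x \<in> carrier R"
  shows "int_pow_map R id i x = x"
proof -
  interpret ring_automorphism R id by (rule ring_automorphism_id)
  show ?thesis
  proof (induction i rule: int_induct[where k = 0])
    case (step1 i)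
    then show ?case using tw_Suc[OF assms, of i] by (metis id_apply)
  next
    case (step2 i)
    then show ?case using tw_pred[OF assms, of i] aut_inv(3)[OF assms] by (metis id_apply)
  qed (rule tw_0)
qed

text \<open>Used with \<open>b = 0\<close> for products of power series and with
  \<open>b = -1\<close> for a power series times a series with a simple pole.\<close>

lemma (in ring) power_series_mult_low:
  assumes f: "\<And>n. f n \<in> carrier R" "\<And>n. n < 0 \<Longrightarrow> f n = \<zero>"
    and g: "\<And>n. g n \<in> carrier R" "\<And>n. n < b \<Longrightarrow> g n = \<zero>"
  shows "(f \<otimes>\<^bsub>skew_laurent_series R id\<^esub> g) b = f 0 \<otimes> g b"
    "(f \<otimes>\<^bsub>skew_laurent_series R id\<^esub> g) (b + 1) = f 0 \<otimes> g (b + 1) \<oplus> f 1 \<otimes> g b"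
proof -
  interpret ring_automorphism R id by (rule ring_automorphism_id)
  have "(f \<otimes>\<^bsub>skew_laurent_series R id\<^esub> g) b = finsum R (\<lambda>i. f i \<otimes> tw i (g (b - i))) {0..0}"
    by (rule series_mult_interval[OF f(1) g(1) f(2) g(2)]) auto
  then show "(f \<otimes>\<^bsub>skew_laurent_series R id\<^esub> g) b = f 0 \<otimes> g b"
    using f(1) g(1) by (simp add: finsum_insert finsum_empty)
  have "(f \<otimes>\<^bsub>skew_laurent_series R id\<^esub> g) (b + 1) =
      finsum R (\<lambda>i. f i \<otimes> tw i (g (b + 1 - i))) {0..1}"
    by (rule series_mult_interval[OF f(1) g(1) f(2) g(2)]) auto
  also have "{0..1::int} = {0, 1}" by auto
  also have "finsum R (\<lambda>i. f i \<otimes> tw i (g (b + 1 - i))) {0, 1} = f 0 \<otimes> tw 0 (g (b + 1)) \<oplus> f 1 \<otimes> tw 1 (g b)"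
    using f(1) g(1) by (simp add: finsum_insert finsum_empty)
  finally show "(f \<otimes>\<^bsub>skew_laurent_series R id\<^esub> g) (b + 1) = f 0 \<otimes> g (b + 1) \<oplus> f 1 \<otimes> g b"
    by (simp only: int_pow_map_id[OF g(1)])
qed

text \<open>\<open>LEAST\<close> over the integers is meaningful only for sets bounded below. The
  bound \<open>n0\<close> provides the least index, by way of the natural numbers
  \<open>i - n0\<close>.\<close>

lemma laurent_ord_ge:
  assumes "Fin m \<le> laurent_ord R g" "\<And>i. i < n0 \<Longrightarrow> g i = \<zero>\<^bsub>R\<^esub>" "n < m"
  shows "g n = \<zero>\<^bsub>R\<^esub>"
proof (rule ccontr)
  assume n: "g n \<noteq> \<zero>\<^bsub>R\<^esub>"
  obtain l where l: "g l \<noteq> \<zero>\<^bsub>R\<^esub>" "\<And>i. g i \<noteq> \<zero>\<^bsub>R\<^esub> \<Longrightarrow> nat (l - n0) \<le> nat (i - n0)"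
    using ex_has_least_nat[of "\<lambda>i. g i \<noteq> \<zero>\<^bsub>R\<^esub>" n "\<lambda>i. nat (i - n0)"] n by blast
  have le: "l \<le> i" if "g i \<noteq> \<zero>\<^bsub>R\<^esub>" for i
  proof -
    have "n0 \<le> i" "n0 \<le> l" using assms(2) that l(1) by (meson not_le)+
    then show ?thesis using l(2)[OF that] by simp
  qed
  then have "(LEAST n. g n \<noteq> \<zero>\<^bsub>R\<^esub>) = l" using l(1) by (intro Least_equality)
  then have "m \<le> l" using assms(1) n by (auto simp: laurent_ord_def split: if_splits)
  then show False using le[OF n] assms(3) by simp
qed

locale taylor = skew_closure \<theta> r e
  for \<theta> :: "'k::field \<Rightarrow> 'k" and r and e :: "'k \<Rightarrow> 'l::field" +
  fixes z :: 'l and \<tau> :: "(nat \<Rightarrow> (int \<Rightarrow> 'k) set) \<Rightarrow> int \<Rightarrow> (int \<Rightarrow> 'k) set"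
  assumes adm: "admissible \<theta> r (min_poly_A \<theta> r e z) \<tau>"
begin

abbreviation "N \<equiv> min_poly_A \<theta> r e z"
abbreviation "Q \<equiv> quot_A \<theta> N"
abbreviation "cls \<equiv> class_A \<theta> N"
abbreviation "L \<equiv> skew_laurent_series Q id"

lemma N_eq: "N = pw (mp z)"
  by (simp add: min_poly_A_def)

lemma ideal_pw: "over_F p \<Longrightarrow> ideal (PIdl\<^bsub>A\<^esub> (pw p)) A"
  by (rule A.central_cgenideal_ideal) (simp_all add: pw_central)

lemma N_pow: "N [^]\<^bsub>A\<^esub> (m::nat) = pw (mp z ^ m)"
proof (induction m)
  case (Suc m)
  then show ?case by (simp add: N_eq pw_mult[symmetric] mult.commute)
qed (simp add: pw_1)

lemma over_F_power: "over_F p \<Longrightarrow> over_F (p ^ m)"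
  by (induction m) (simp_all add: over_F_mult)

lemma ideal_adic: "ideal (adic_ideal A N m) A"
  unfolding adic_ideal_def N_pow by (intro ideal_pw over_F_power) simp

lemma ideal_N: "ideal (PIdl\<^bsub>A\<^esub> N) A"
  unfolding N_eq by (intro ideal_pw) simp

sublocale Q: ring Q
  unfolding quot_A_def by (rule ideal.quotient_is_ring[OF ideal_N])

sublocale L: ring_automorphism Q id
  by (rule Q.ring_automorphism_id)

sublocale LR: ring L
  by (rule L.series_ring)

lemma cls_hom: "cls \<in> ring_hom A Q"
proof -
  have "cls = (+>\<^bsub>A\<^esub>) (PIdl\<^bsub>A\<^esub> N)" by (rule ext) (simp add: class_A_def)
  then show ?thesis using ideal.rcos_ring_hom[OF ideal_N] by (simp add: quot_A_def)
qed

lemma cls_closed [simp]: "a \<in> carrier A \<Longrightarrow> cls a \<in> carrier Q"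
  and cls_mult: "a \<in> carrier A \<Longrightarrow> b \<in> carrier A \<Longrightarrow> cls (a \<odot> b) = cls a \<otimes>\<^bsub>Q\<^esub> cls b"
  and cls_add: "a \<in> carrier A \<Longrightarrow> b \<in> carrier A \<Longrightarrow> cls (\<lambda>n. a n + b n) = cls a \<oplus>\<^bsub>Q\<^esub> cls b"
  and cls_one: "cls (lm 1 0) = \<one>\<^bsub>Q\<^esub>"
  and cls_zero: "cls (\<lambda>_. 0) = \<zero>\<^bsub>Q\<^esub>"
proof -
  show "cls (lm 1 0) = \<one>\<^bsub>Q\<^esub>"
    using ring_hom_one[OF cls_hom] by (simp add: K.series_one_monom)
qed (use ring_hom_closed[OF cls_hom, of a] ring_hom_mult[OF cls_hom, of a b]
    ring_hom_add[OF cls_hom, of a b] ring_hom_zero[OF cls_hom A.ring_axioms Q.ring_axioms] in simp_all)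

lemma cls_eq_zero_iff:
  assumes "a \<in> carrier A"
  shows "cls a = \<zero>\<^bsub>Q\<^esub> \<longleftrightarrow> (\<exists>b\<in>carrier A. a = N \<odot> b)"
proof -
  interpret I: ideal "PIdl\<^bsub>A\<^esub> N" A by (rule ideal_N)
  have "cls a = \<zero>\<^bsub>Q\<^esub> \<longleftrightarrow> a \<in> PIdl\<^bsub>A\<^esub> N"
  proof -
    have "cls a = \<zero>\<^bsub>Q\<^esub> \<longleftrightarrow> PIdl\<^bsub>A\<^esub> N +>\<^bsub>A\<^esub> a = PIdl\<^bsub>A\<^esub> N"
      by (simp add: class_A_def quot_A_def FactRing_def)
    moreover have "a \<in> PIdl\<^bsub>A\<^esub> N +>\<^bsub>A\<^esub> a" using assms by (rule I.a_rcos_self)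
    ultimately show ?thesis using I.a_rcos_const[of a] by blast
  qed
  also have "\<dots> \<longleftrightarrow> (\<exists>b\<in>carrier A. a = N \<odot> b)"
  proof -
    have "N \<odot> b = b \<odot> N" for b unfolding N_eq by (rule pw_central) simp
    then show ?thesis unfolding cgenideal_def A_simps by auto
  qed
  finally show ?thesis .
qed

lemma cls_N: "cls N = \<zero>\<^bsub>Q\<^esub>"
proof -
  have "N = N \<odot> \<one>\<^bsub>A\<^esub>" using A.r_one[of N] by (simp add: N_eq)
  then show ?thesis using cls_eq_zero_iff[of N] A.one_closed by (metis N_eq pw_closed)
qed

lemma cls_pw_eq_zero:
  assumes "over_F p" "ev p z = 0"
  shows "cls (pw p) = \<zero>\<^bsub>Q\<^esub>"
proof -
  obtain q where "p = mp z * q" using mp_dvd assms by blast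
  then have "pw p = N \<odot> pw q" by (simp add: N_eq pw_mult)
  then show ?thesis using cls_eq_zero_iff[OF pw_closed] pw_closed by blast
qed

text \<open>A Bezout relation presents the inverse as the class of a polynomial over
  \<open>F\<close>, which can later be evaluated at \<open>z\<close>.\<close>

lemma cls_pw_inverse:
  assumes "over_F p" "over_F U" "over_F V" "U * p + V * mp z = 1"
  shows "cls (pw U) \<otimes>\<^bsub>Q\<^esub> cls (pw p) = \<one>\<^bsub>Q\<^esub>"
proof -
  have "cls (pw (V * mp z)) = \<zero>\<^bsub>Q\<^esub>" using assms by (intro cls_pw_eq_zero over_F_mult) auto
  then have "cls (pw (U * p)) = cls (pw (U * p)) \<oplus>\<^bsub>Q\<^esub> cls (pw (V * mp z))" by simp
  also have "\<dots> = cls (pw (U * p + V * mp z))" by (simp add: cls_add[symmetric] pw_add)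
  also have "\<dots> = \<one>\<^bsub>Q\<^esub>" by (simp add: assms(4) pw_1 K.series_one_monom cls_one)
  finally show ?thesis by (simp add: pw_mult cls_mult)
qed

lemma cls_pw_Units:
  assumes "over_F p" "ev p z \<noteq> 0"
  shows "cls (pw p) \<in> Units Q"
proof -
  obtain U V where UV: "over_F U" "over_F V" "U * p + V * mp z = 1"
    using mp_bezout[OF assms] by blast
  have "cls (pw U) \<otimes>\<^bsub>Q\<^esub> cls (pw p) = \<one>\<^bsub>Q\<^esub>" by (rule cls_pw_inverse[OF assms(1) UV])
  moreover from this have "cls (pw p) \<otimes>\<^bsub>Q\<^esub> cls (pw U) = \<one>\<^bsub>Q\<^esub>"
    by (simp add: cls_mult[symmetric] pw_mult[symmetric] mult.commute)
  ultimately show ?thesis unfolding Units_def by (auto intro!: bexI[of _ "cls (pw U)"])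
qed

definition phi where "phi a = \<tau> (to_completion A N a)"

lemma adic_ideal_Suc: "adic_ideal A N (Suc m) \<subseteq> adic_ideal A N m"
proof
  fix x assume "x \<in> adic_ideal A N (Suc m)"
  then obtain y where y: "y \<in> carrier A" "x = y \<odot> pw (mp z ^ Suc m)"
    unfolding adic_ideal_def N_pow cgenideal_def A_simps by blast
  have "x = (y \<odot> pw (mp z)) \<odot> pw (mp z ^ m)"
    using A.m_assoc[OF y(1) pw_closed pw_closed] by (simp add: y(2) pw_mult)
  moreover have "y \<odot> pw (mp z) \<in> carrier A" using y(1) by (rule mult_A_closed) simp
  ultimately show "x \<in> adic_ideal A N m"
    unfolding adic_ideal_def N_pow cgenideal_def A_simps by blast
qed

lemma to_completion_hom: "to_completion A N \<in> ring_hom A (adic_completion A N)"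
proof (rule ring_hom_memI)
  fix a b assume ab: "a \<in> carrier A" "b \<in> carrier A"
  show "to_completion A N a \<in> carrier (adic_completion A N)"
  proof -
    have "adic_ideal A N m +>\<^bsub>A\<^esub> x = adic_ideal A N m +>\<^bsub>A\<^esub> a"
      if x: "x \<in> adic_ideal A N (Suc m) +>\<^bsub>A\<^esub> a" for x m
    proof -
      interpret I: ideal "adic_ideal A N m" A by (rule ideal_adic)
      have "x \<in> adic_ideal A N m +>\<^bsub>A\<^esub> a"
        using x adic_ideal_Suc unfolding a_r_coset_def r_coset_def by blast
      then show ?thesis
        using A.a_repr_independence[of x "adic_ideal A N m" a] ab(1) I.a_subgroup by simp
    qed
    then show ?thesis
      using ring_hom_closed[OF ideal.rcos_ring_hom[OF ideal_adic] ab(1)]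
      unfolding adic_completion_def to_completion_def by simp
  qed
  show "to_completion A N (a \<otimes>\<^bsub>A\<^esub> b) = to_completion A N a \<otimes>\<^bsub>adic_completion A N\<^esub> to_completion A N b"
    using ring_hom_mult[OF ideal.rcos_ring_hom[OF ideal_adic] ab]
    by (simp add: to_completion_def adic_completion_def del: A_simps)
  show "to_completion A N (a \<oplus>\<^bsub>A\<^esub> b) = to_completion A N a \<oplus>\<^bsub>adic_completion A N\<^esub> to_completion A N b"
    using ring_hom_add[OF ideal.rcos_ring_hom[OF ideal_adic] ab]
    by (simp add: to_completion_def adic_completion_def del: A_simps)
next
  show "to_completion A N \<one>\<^bsub>A\<^esub> = \<one>\<^bsub>adic_completion A N\<^esub>"
    using ring_hom_one[OF ideal.rcos_ring_hom[OF ideal_adic]]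
    by (simp add: to_completion_def adic_completion_def del: A_simps)
qed

lemma phi_hom: "phi \<in> ring_hom A (power_series Q)"
proof -
  have "\<tau> \<circ> to_completion A N \<in> ring_hom A (power_series Q)"
    using ring_hom_trans[OF to_completion_hom] adm by (auto simp: admissible_def)
  moreover have "\<tau> \<circ> to_completion A N = phi" by (rule ext) (simp add: phi_def)
  ultimately show ?thesis by simp
qed

lemma phi_closed: "a \<in> carrier A \<Longrightarrow> phi a \<in> carrier L"
  and phi_neg: "a \<in> carrier A \<Longrightarrow> n < 0 \<Longrightarrow> phi a n = \<zero>\<^bsub>Q\<^esub>"
  and phi_mult: "a \<in> carrier A \<Longrightarrow> b \<in> carrier A \<Longrightarrow> phi (a \<odot> b) = phi a \<otimes>\<^bsub>L\<^esub> phi b"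
  and phi_add: "a \<in> carrier A \<Longrightarrow> b \<in> carrier A \<Longrightarrow> phi (\<lambda>n. a n + b n) = (\<lambda>n. phi a n \<oplus>\<^bsub>Q\<^esub> phi b n)"
  using ring_hom_closed[OF phi_hom, of a] ring_hom_mult[OF phi_hom, of a b]
    ring_hom_add[OF phi_hom, of a b]
  by (simp_all add: power_series_def)

lemma phi_coeff [simp]: "a \<in> carrier A \<Longrightarrow> phi a n \<in> carrier Q"
  using L.series_closed[OF phi_closed] .

lemma phi_const: "phi (lm c 0) = laurent_monom Q (cls (lm c 0)) 0"
  and phi_X: "phi (lm 1 1) 0 = cls (lm 1 1)"
  and phi_Y: "phi (lm 1 (int r)) = (\<lambda>n. laurent_monom Q (cls (lm 1 (int r))) 0 n \<oplus>\<^bsub>Q\<^esub>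
      laurent_monom Q \<one>\<^bsub>Q\<^esub> 1 n)"
  using adm by (simp_all add: admissible_def phi_def power_series_def)

lemma phi_mult_0:
  assumes "a \<in> carrier A" "b \<in> carrier A"
  shows "phi (a \<odot> b) 0 = phi a 0 \<otimes>\<^bsub>Q\<^esub> phi b 0"
    "phi (a \<odot> b) 1 = phi a 0 \<otimes>\<^bsub>Q\<^esub> phi b 1 \<oplus>\<^bsub>Q\<^esub> phi a 1 \<otimes>\<^bsub>Q\<^esub> phi b 0"
  using Q.power_series_mult_low[of "phi a" "phi b" 0] assms phi_neg by (simp_all add: phi_mult)

text \<open>Modulo \<open>T\<close>, \<open>phi\<close> is a ring homomorphism that agrees with
  \<open>cls\<close> on constants and on \<open>X\<close>, and these determine it on all
  monomials.\<close>

lemma phi_0: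
  assumes "a \<in> carrier A"
  shows "phi a 0 = cls a"
  using assms
proof (induction a rule: A_induct)
  case zero
  have "phi (\<lambda>_. 0) = phi (lm 0 0)" by (rule arg_cong[of _ _ phi]) (simp add: lm_apply fun_eq_iff)
  moreover have "cls (\<lambda>_. 0) = cls (lm 0 0)" by (rule arg_cong[of _ _ cls]) (simp add: lm_apply fun_eq_iff)
  ultimately show ?case by (simp add: phi_const laurent_monom_def[of Q])
next
  case (monom c n)
  have c: "phi (lm c 0) 0 = cls (lm c 0)" for c
    by (simp add: phi_const laurent_monom_def[of Q])
  have pos: "phi (lm 1 (int m)) 0 = cls (lm 1 (int m))" for m
  proof (induction m)
    case (Suc m)
    have "lm 1 (int (Suc m)) = lm 1 1 \<odot> lm 1 (int m)" by (simp add: lm_mult)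
    then show ?case using Suc by (simp add: phi_mult_0 cls_mult phi_X)
  qed (simp add: c)
  have "phi (lm 1 n) 0 = cls (lm 1 n)"
  proof (cases "0 \<le> n")
    case True
    then show ?thesis using pos[of "nat n"] by simp
  next
    case False
    \<comment> \<open>For negative \<open>n\<close>, both values are inverse to the class of the
      positive power \<open>X^(-n)\<close>, hence equal.\<close>
    have 1: "phi (lm 1 n) 0 \<otimes>\<^bsub>Q\<^esub> cls (lm 1 (- n)) = \<one>\<^bsub>Q\<^esub>"
      using False pos[of "nat (- n)"] phi_mult_0(1)[of "lm 1 n" "lm 1 (- n)"]
      by (simp add: lm_mult c cls_one)
    have 2: "cls (lm 1 (- n)) \<otimes>\<^bsub>Q\<^esub> cls (lm 1 n) = \<one>\<^bsub>Q\<^esub>"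
      using cls_mult[of "lm 1 (- n)" "lm 1 n"] by (simp add: lm_mult cls_one)
    have "phi (lm 1 n) 0 = phi (lm 1 n) 0 \<otimes>\<^bsub>Q\<^esub> (cls (lm 1 (- n)) \<otimes>\<^bsub>Q\<^esub> cls (lm 1 n))"
      by (simp add: 2)
    also have "\<dots> = cls (lm 1 n)" by (simp add: Q.m_assoc[symmetric] 1)
    finally show ?thesis .
  qed
  then have "phi (lm c 0 \<odot> lm 1 n) 0 = cls (lm c 0 \<odot> lm 1 n)"
    by (simp add: phi_mult_0 cls_mult c)
  then show ?case by (simp add: lm_mult)
next
  case (add f g)
  then show ?case by (simp add: phi_add cls_add)
qed

text \<open>The Leibniz rule, starting from the image \<open>z + T\<close> of \<open>Y\<close>.
  Admissibility prescribes the image of \<open>X\<close> modulo \<open>T\<close> only, so the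
  formula is confined to polynomials in \<open>Y\<close>.\<close>

lemma phi_1: "phi (pw p) 1 = cls (pw (pderiv p))"
proof (induction p)
  case 0
  have "phi (\<lambda>_. 0) = phi (lm 0 0)" by (rule arg_cong[of _ _ phi]) (simp add: lm_apply fun_eq_iff)
  then show ?case by (simp add: phi_const laurent_monom_def[of Q] cls_zero)
next
  case (pCons a p)
  have Y: "phi (pw [:0, 1:]) 1 = \<one>\<^bsub>Q\<^esub>" "phi (pw [:0, 1:]) 0 = cls (pw [:0, 1:])"
    by (simp_all add: pw_Y phi_Y laurent_monom_def[of Q])
  have "pw (pCons a p) = (\<lambda>n. lm a 0 n + (pw [:0, 1:] \<odot> pw p) n)"
    by (simp add: pw_const[symmetric] pw_mult[symmetric] pw_add[symmetric])
  then have "phi (pw (pCons a p)) 1 = cls (pw [:0, 1:]) \<otimes>\<^bsub>Q\<^esub> cls (pw (pderiv p)) \<oplus>\<^bsub>Q\<^esub> cls (pw p)"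
    using pCons by (simp add: phi_add mult_A_closed phi_mult_0 Y phi_const laurent_monom_def[of Q] phi_0)
  also have "\<dots> = cls (pw ([:0, 1:] * pderiv p + p))"
    by (simp only: pw_add pw_mult cls_add cls_mult mult_A_closed pw_closed)
  also have "[:0, 1:] * pderiv p + p = pderiv (pCons a p)"
    by (simp add: pderiv_pCons)
  finally show ?case .
qed

text \<open>Factors \<open>N\<close> are split off until the value at \<open>z\<close> is nonzero.
  The remaining factor has an invertible constant coefficient, and each \<open>N\<close> has an
  invertible coefficient at \<open>T\<close>, namely its derivative at \<open>z\<close>.\<close>

lemma phi_pw_Units: "over_F p \<Longrightarrow> p \<noteq> 0 \<Longrightarrow> phi (pw p) \<in> Units L"
proof (induction "degree p" arbitrary: p rule: less_induct)
  case less
  show ?case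
  proof (cases "ev p z = 0")
    case False
    then show ?thesis
      using less.prems cls_pw_Units by (intro L.series_Units[of _ 0]) (auto simp: phi_closed phi_neg phi_0)
  next
    case True
    then obtain q where q: "over_F q" "p = mp z * q" using mp_dvd less.prems by blast
    have "q \<noteq> 0" using q less.prems by auto
    then have "degree q < degree p"
      using degree_mp[of z] by (simp add: q degree_mult_eq)
    then have "phi (pw q) \<in> Units L" using less.hyps q \<open>q \<noteq> 0\<close> by blast
    moreover have "phi (pw (mp z)) \<in> Units L"
    proof (rule L.series_Units[of _ 1])
      show "phi (pw (mp z)) n = \<zero>\<^bsub>Q\<^esub>" if "n < 1" for n
      proof (cases "n = 0")
        case True
        then show ?thesis using cls_N by (simp add: phi_0 N_eq)
      qed (use that in \<open>simp add: phi_neg\<close>)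
    qed (simp_all add: phi_closed phi_1 cls_pw_Units over_F_pderiv mp_separable)
    ultimately show ?thesis by (simp add: q pw_mult phi_mult)
  qed
qed

lemma phi_Units:
  assumes "D \<in> center_Z \<theta> r" "D \<noteq> (\<lambda>_. 0)"
  shows "phi D \<in> Units L"
proof -
  obtain k p where p: "over_F p" "D = lm 1 (int r * k) \<odot> pw p" using center_poly assms by blast
  have "p \<noteq> 0" using assms(2) A.r_null[of "lm 1 (int r * k)"] p by auto
  have "phi (lm 1 0) = \<one>\<^bsub>L\<^esub>" by (simp add: phi_const cls_one L.series_one_monom)
  then have "phi (lm 1 (int r * k)) \<otimes>\<^bsub>L\<^esub> phi (lm 1 (int r * - k)) = \<one>\<^bsub>L\<^esub>"
    "phi (lm 1 (int r * - k)) \<otimes>\<^bsub>L\<^esub> phi (lm 1 (int r * k)) = \<one>\<^bsub>L\<^esub>"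
    by (simp_all add: phi_mult[symmetric] lm_mult)
  then have "phi (lm 1 (int r * k)) \<in> Units L"
    unfolding Units_def using phi_closed lm_closed by blast
  then show ?thesis using phi_pw_Units[OF p(1) \<open>p \<noteq> 0\<close>] by (simp add: p(2) phi_mult)
qed

context
  fixes f
  assumes f: "f \<in> frac_A \<theta> r" and ord: "ord_at \<theta> N \<tau> f \<ge> Fin (- 1)"
begin

abbreviation "TS \<equiv> TS_at \<theta> N \<tau> f"

lemma TS_eq: "TS = frac_extend L phi f"
proof -
  have "phi = (\<lambda>a. \<tau> (to_completion A N a))" by (rule ext) (simp add: phi_def)
  then show ?thesis by (simp add: TS_at_def)
qed

lemma TS_closed: "TS \<in> carrier L"
  and TS_mult: "(P, D) \<in> f \<Longrightarrow> phi D \<otimes>\<^bsub>L\<^esub> TS = phi P"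
  unfolding TS_eq
  using frac_extend_char[OF LR.monoid_axioms phi_closed phi_mult phi_Units f] by blast+

lemma TS_simple_pole: "n < - 1 \<Longrightarrow> TS n = \<zero>\<^bsub>Q\<^esub>"
proof -
  \<comment> \<open>The bound that gives \<open>laurent_ord\<close> its intended value.\<close>
  obtain n0 where "\<And>i. i < n0 \<Longrightarrow> TS i = \<zero>\<^bsub>Q\<^esub>" using TS_closed by (auto simp: L.series_carrier)
  then show "n < - 1 \<Longrightarrow> TS n = \<zero>\<^bsub>Q\<^esub>" using laurent_ord_ge ord unfolding ord_at_def by blast
qed

lemma TS_coeff [simp]: "TS n \<in> carrier Q"
  using L.series_closed[OF TS_closed] .

lemma TS_low:
  assumes PD: "(P, pw D) \<in> f"
  shows "cls (pw D) \<otimes>\<^bsub>Q\<^esub> TS (- 1) = \<zero>\<^bsub>Q\<^esub>"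
    "cls (pw D) \<otimes>\<^bsub>Q\<^esub> TS 0 \<oplus>\<^bsub>Q\<^esub> cls (pw (pderiv D)) \<otimes>\<^bsub>Q\<^esub> TS (- 1) = cls P"
proof -
  have P: "P \<in> carrier A" using frac_A_mem(1)[OF f PD] .
  note low = Q.power_series_mult_low[of "phi (pw D)" TS "- 1"]
  have "phi P (- 1) = cls (pw D) \<otimes>\<^bsub>Q\<^esub> TS (- 1)"
    using low(1) TS_simple_pole by (simp add: TS_mult[OF PD] phi_neg phi_0)
  then show "cls (pw D) \<otimes>\<^bsub>Q\<^esub> TS (- 1) = \<zero>\<^bsub>Q\<^esub>" using P by (simp add: phi_neg)
  have "phi P 0 = cls (pw D) \<otimes>\<^bsub>Q\<^esub> TS 0 \<oplus>\<^bsub>Q\<^esub> cls (pw (pderiv D)) \<otimes>\<^bsub>Q\<^esub> TS (- 1)"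
    using low(2) TS_simple_pole by (simp add: TS_mult[OF PD] phi_neg phi_0 phi_1)
  then show "cls (pw D) \<otimes>\<^bsub>Q\<^esub> TS 0 \<oplus>\<^bsub>Q\<^esub> cls (pw (pderiv D)) \<otimes>\<^bsub>Q\<^esub> TS (- 1) = cls P"
    using P by (simp add: phi_0)
qed

lemma residue_regular:
  assumes "(P, pw D) \<in> f" "over_F D" "ev D z \<noteq> 0"
  shows "TS (- 1) = \<zero>\<^bsub>Q\<^esub>"
proof -
  have "cls (pw D) \<otimes>\<^bsub>Q\<^esub> TS (- 1) = cls (pw D) \<otimes>\<^bsub>Q\<^esub> \<zero>\<^bsub>Q\<^esub>" using TS_low(1)[OF assms(1)] by simp
  then show ?thesis using cls_pw_Units[OF assms(2,3)] Q.Units_l_cancel TS_coeff Q.zero_closed by blast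
qed

lemma residue_simple_pole:
  assumes "(P, pw D) \<in> f" "over_F D" "ev D z = 0"
    and "over_F U" "over_F V" "U * pderiv D + V * mp z = 1"
  shows "TS (- 1) = cls (pw U \<odot> P)"
proof -
  have P: "P \<in> carrier A" using frac_A_mem(1)[OF f assms(1)] .
  have "TS (- 1) = (cls (pw U) \<otimes>\<^bsub>Q\<^esub> cls (pw (pderiv D))) \<otimes>\<^bsub>Q\<^esub> TS (- 1)"
    using cls_pw_inverse[OF over_F_pderiv[OF assms(2)] assms(4-6)] by simp
  also have "\<dots> = cls (pw U) \<otimes>\<^bsub>Q\<^esub> cls P"
    using TS_low(2)[OF assms(1)] P by (simp add: Q.m_assoc cls_pw_eq_zero[OF assms(2,3)])
  finally show ?thesis using P by (simp add: cls_mult)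
qed

lemma multiple_root_cancel:
  assumes "(P, pw D) \<in> f" "over_F D" "ev D z = 0" "ev (pderiv D) z = 0"
  obtains P' D' where "P' \<in> carrier A" "over_F D'" "D = mp z * D'" "(P', pw D') \<in> f"
proof -
  have P: "P \<in> carrier A" using frac_A_mem(1)[OF f assms(1)] .
  have "cls P = \<zero>\<^bsub>Q\<^esub>"
    using TS_low(2)[OF assms(1)] assms cls_pw_eq_zero over_F_pderiv by simp
  then obtain P' where P': "P' \<in> carrier A" "P = N \<odot> P'" using cls_eq_zero_iff P by blast
  obtain D' where D': "over_F D'" "D = mp z * D'" using mp_dvd assms by blast
  have "(N \<odot> P', N \<odot> pw D') \<in> f" using assms(1) by (simp add: P'(2) D'(2) pw_mult N_eq)
  then have "(P', pw D') \<in> f"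
  proof (rule frac_A_cancel[OF f])
    show "N \<in> center_Z \<theta> r" "N \<noteq> (\<lambda>_. 0)" by (simp_all add: N_eq pw_center)
  qed (simp_all add: P' D' pw_center)
  then show thesis using that P' D' by blast
qed

end

end

section \<open>The tensor product\<close>

context skew_closure
begin

abbreviation "FA \<equiv> free_Abelian_group (UNIV :: ('k \<times> 'l) set)"
abbreviation "T \<equiv> tensor_product F e"
abbreviation "pt a x \<equiv> pure_tensor F e a x"

lemma FA_comm_group: "comm_group FA"
  by (rule abelian_free_Abelian_group)

lemma FA_simps: "carrier FA = UNIV" "u \<otimes>\<^bsub>FA\<^esub> v = u + v" "\<one>\<^bsub>FA\<^esub> = 0"
  by (simp_all add: free_Abelian_group_def)

lemma relations_subgroup: "subgroup (tensor_relations F e) FA"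
  unfolding tensor_relations_def
  using FA_comm_group by (intro group.generate_is_subgroup comm_group.axioms(2)) (simp_all add: FA_simps)

lemma relations_normal: "tensor_relations F e \<lhd> FA"
  using FA_comm_group relations_subgroup by (simp add: comm_group.subgroup_imp_normal)

sublocale T: comm_group T
  unfolding tensor_product_def
  using FA_comm_group relations_subgroup by (rule comm_group.abelian_FactGroup)

lemma pt_closed [simp]: "pt a x \<in> carrier T"
  by (auto simp: tensor_product_def FactGroup_def pure_tensor_def RCOSETS_def FA_simps)

lemma coset_eq:
  assumes "u - v \<in> tensor_relations F e"
  shows "tensor_relations F e #>\<^bsub>FA\<^esub> u = tensor_relations F e #>\<^bsub>FA\<^esub> v"
proof -
  have "u \<in> tensor_relations F e #>\<^bsub>FA\<^esub> v"
    using assms by (auto simp: r_coset_def FA_simps intro!: bexI[of _ "u - v"])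
  then show ?thesis
    using group.repr_independence[of FA u "tensor_relations F e" v] relations_subgroup FA_comm_group
    by (simp add: FA_simps comm_group.axioms(2))
qed

lemma coset_mult:
  "(tensor_relations F e #>\<^bsub>FA\<^esub> u) \<otimes>\<^bsub>T\<^esub> (tensor_relations F e #>\<^bsub>FA\<^esub> v) =
    tensor_relations F e #>\<^bsub>FA\<^esub> (u + v)"
  using normal.rcos_sum[OF relations_normal, of u v]
  by (simp add: tensor_product_def FactGroup_def FA_simps)

lemma pt_add_left: "pt (a + b) x = pt a x \<otimes>\<^bsub>T\<^esub> pt b x"
  unfolding pure_tensor_def coset_mult
  by (rule coset_eq) (auto simp: tensor_relations_def diff_diff_eq[symmetric] intro!: generate.incl)

lemma pt_add_right: "pt a (x + y) = pt a x \<otimes>\<^bsub>T\<^esub> pt a y"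
  unfolding pure_tensor_def coset_mult
  by (rule coset_eq) (auto simp: tensor_relations_def diff_diff_eq[symmetric] intro!: generate.incl)

lemma pt_balanced: "c \<in> F \<Longrightarrow> pt (c * a) x = pt a (e c * x)"
  unfolding pure_tensor_def
  by (rule coset_eq) (auto simp: tensor_relations_def intro!: generate.incl)

lemma pt_zero_left [simp]: "pt 0 x = \<one>\<^bsub>T\<^esub>"
  using pt_add_left[of 0 0 x] T.l_cancel_one'[of "pt 0 x" "pt 0 x"] by simp

lemma pt_zero_right [simp]: "pt a 0 = \<one>\<^bsub>T\<^esub>"
  using pt_add_right[of a 0 0] T.l_cancel_one'[of "pt a 0" "pt a 0"] by simp

lemma pt_sum_left: "finite I \<Longrightarrow> pt (\<Sum>i\<in>I. a i) x = finprod T (\<lambda>i. pt (a i) x) I"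
  by (induction I rule: finite_induct) (simp_all add: pt_add_left)

text \<open>The common shape of all partial residues, modelled on the product in
  \<open>iota\<close>. It is additive in \<open>w\<close> for fixed \<open>b\<close>, so residues
  are added up inside the second argument. For infinite support the product is the unit by
  convention.\<close>

definition tensor_sum :: "(int \<Rightarrow> 'k) \<Rightarrow> (int \<Rightarrow> 'l) \<Rightarrow> ('k \<times> 'l \<Rightarrow>\<^sub>0 int) set" where
  "tensor_sum b w = finprod T (\<lambda>i. pt (b i) (w i)) {i. b i \<noteq> 0}"

lemma tensor_sum_closed [simp]: "tensor_sum b w \<in> carrier T"
  by (simp add: tensor_sum_def T.finprod_closed)

lemma tensor_sum_on:
  assumes "finite I" "\<And>i. b i \<noteq> 0 \<Longrightarrow> i \<in> I"
  shows "tensor_sum b w = finprod T (\<lambda>i. pt (b i) (w i)) I"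
  unfolding tensor_sum_def
  by (rule T.finprod_mono_neutral_cong_left) (use assms in auto)

lemma tensor_sum_zero [simp]: "tensor_sum b (\<lambda>_. 0) = \<one>\<^bsub>T\<^esub>" "tensor_sum (\<lambda>_. 0) w = \<one>\<^bsub>T\<^esub>"
  by (simp_all add: tensor_sum_def)

lemma tensor_sum_add_left:
  assumes "finite {i. b i \<noteq> 0}" "finite {i. c i \<noteq> 0}"
  shows "tensor_sum (\<lambda>i. b i + c i) w = tensor_sum b w \<otimes>\<^bsub>T\<^esub> tensor_sum c w"
proof -
  let ?I = "{i. b i \<noteq> 0} \<union> {i. c i \<noteq> 0}"
  have "tensor_sum (\<lambda>i. b i + c i) w = finprod T (\<lambda>i. pt (b i + c i) (w i)) ?I"
    by (rule tensor_sum_on) (use assms in auto)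
  also have "\<dots> = finprod T (\<lambda>i. pt (b i) (w i)) ?I \<otimes>\<^bsub>T\<^esub> finprod T (\<lambda>i. pt (c i) (w i)) ?I"
    by (simp add: pt_add_left)
  also have "finprod T (\<lambda>i. pt (b i) (w i)) ?I = tensor_sum b w"
    by (rule tensor_sum_on[symmetric]) (use assms in auto)
  also have "finprod T (\<lambda>i. pt (c i) (w i)) ?I = tensor_sum c w"
    by (rule tensor_sum_on[symmetric]) (use assms in auto)
  finally show ?thesis .
qed

lemma tensor_sum_add_right: "tensor_sum b (\<lambda>i. w i + v i) = tensor_sum b w \<otimes>\<^bsub>T\<^esub> tensor_sum b v"
  by (simp add: tensor_sum_def pt_add_right)

lemma tensor_sum_sum_right:
  "finite J \<Longrightarrow> tensor_sum b (\<lambda>i. \<Sum>j\<in>J. w j i) = finprod T (\<lambda>j. tensor_sum b (w j)) J"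
  by (induction J rule: finite_induct) (simp_all add: tensor_sum_add_right)

lemma tensor_sum_scale:
  assumes "finite {i. b i \<noteq> 0}" "c \<in> F"
  shows "tensor_sum (\<lambda>i. c * b i) w = tensor_sum b (\<lambda>i. e c * w i)"
proof -
  have "tensor_sum (\<lambda>i. c * b i) w = finprod T (\<lambda>i. pt (c * b i) (w i)) {i. b i \<noteq> 0}"
    by (rule tensor_sum_on) (use assms in auto)
  then show ?thesis using assms(2) by (simp add: pt_balanced tensor_sum_def)
qed

lemma tensor_sum_shift: "tensor_sum (\<lambda>i. b (i - 1)) w = tensor_sum b (\<lambda>i. w (i + 1))"
proof -
  have "{i. b (i - 1) \<noteq> 0} = (\<lambda>i. i + 1) ` {i. b i \<noteq> 0}"
    by (auto intro!: image_eqI[of _ _ "_ - 1"])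
  then show ?thesis
    unfolding tensor_sum_def by (simp add: T.finprod_reindex inj_on_def)
qed

lemma finite_shift_act:
  fixes b :: "int \<Rightarrow> 'k"
  assumes "finite {i. b i \<noteq> 0}"
  shows "finite {i. shift_act p b i \<noteq> 0}"
proof -
  have "{i. shift_act p b i \<noteq> 0} \<subseteq> (\<lambda>(k, i). i + int k) ` ({..degree p} \<times> {i. b i \<noteq> 0})"
  proof
    fix i assume "i \<in> {i. shift_act p b i \<noteq> 0}"
    then obtain k where "k \<le> degree p" "coeff p k * b (i - int k) \<noteq> 0"
      unfolding shift_act_def by (metis (mono_tags, lifting) atMost_iff mem_Collect_eq sum.neutral)
    then have "(k, i - int k) \<in> {..degree p} \<times> {i. b i \<noteq> 0}" by auto
    then show "i \<in> (\<lambda>(k, i). i + int k) ` ({..degree p} \<times> {i. b i \<noteq> 0})"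
      by (rule rev_image_eqI) simp
  qed
  then show ?thesis using assms finite_subset by blast
qed

text \<open>Coefficients in \<open>F\<close> cross the tensor sign, and a shift of \<open>b\<close>
  by one multiplies the right factors by \<open>z\<close>; so \<open>p(Y)\<close> on the left
  becomes \<open>p(z)\<close> on the right. The constant \<open>c\<close> is general because the
  induction step replaces it by \<open>c * z\<close>.\<close>

lemma tensor_sum_shift_act:
  assumes b: "finite {i. b i \<noteq> 0}" and z: "z \<noteq> 0" and p: "over_F p"
  shows "tensor_sum (shift_act p b) (\<lambda>i. c * z powi i) = tensor_sum b (\<lambda>i. c * ev p z * z powi i)"
  using p
proof (induction p arbitrary: c)
  case 0
  have "shift_act 0 b = (\<lambda>_. 0)" by (rule ext) simp
  then show ?case by simp
next
  case (pCons a p)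
  have a: "a \<in> F" and p: "over_F p"
    using pCons.prems by (auto simp: poly_over_def coeff_pCons split: nat.splits)
  let ?w = "\<lambda>i. c * z powi i"
  have fin: "finite {i. a * b i \<noteq> 0}" "finite {i. shift_act p b (i - 1) \<noteq> 0}"
  proof -
    show "finite {i. a * b i \<noteq> 0}" by (rule finite_subset[OF _ b]) auto
    have "{i. shift_act p b (i - 1) \<noteq> 0} = (\<lambda>i. i + 1) ` {i. shift_act p b i \<noteq> 0}"
      by (auto intro!: image_eqI[of _ _ "_ - 1"])
    then show "finite {i. shift_act p b (i - 1) \<noteq> 0}" using finite_shift_act[OF b] by simp
  qed
  have "shift_act (pCons a p) b = (\<lambda>i. a * b i + shift_act p b (i - 1))" by (rule ext) simp
  then have "tensor_sum (shift_act (pCons a p) b) ?w =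
      tensor_sum (\<lambda>i. a * b i) ?w \<otimes>\<^bsub>T\<^esub> tensor_sum (\<lambda>i. shift_act p b (i - 1)) ?w"
    using tensor_sum_add_left[OF fin] by simp
  also have "tensor_sum (\<lambda>i. a * b i) ?w = tensor_sum b (\<lambda>i. e a * ?w i)"
    by (rule tensor_sum_scale[OF b a])
  also have "tensor_sum (\<lambda>i. shift_act p b (i - 1)) ?w = tensor_sum (shift_act p b) (\<lambda>i. (c * z) * z powi i)"
    unfolding tensor_sum_shift using z by (simp add: power_int_add_1' mult.assoc)
  also have "\<dots> = tensor_sum b (\<lambda>i. (c * z) * ev p z * z powi i)" by (rule pCons.IH[OF p])
  also have "tensor_sum b (\<lambda>i. e a * ?w i) \<otimes>\<^bsub>T\<^esub> \<dots> =
      tensor_sum b (\<lambda>i. e a * ?w i + (c * z) * ev p z * z powi i)"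
    by (rule tensor_sum_add_right[symmetric])
  also have "\<dots> = tensor_sum b (\<lambda>i. c * ev (pCons a p) z * z powi i)"
    by (simp add: map_poly_pCons algebra_simps)
  finally show ?case .
qed

section \<open>Sections and \<open>iota\<close> on residue classes modulo \<open>N\<close>\<close>

lemma class_A_mem:
  "b \<in> class_A \<theta> (min_poly_A \<theta> r e z) a \<longleftrightarrow> (\<exists>x\<in>carrier A. b = (\<lambda>n. (pw (mp z) \<odot> x) n + a n))"
  by (auto simp: class_A_def a_r_coset_def r_coset_def cgenideal_def min_poly_A_def pw_central)

lemma finite_section:
  assumes "a \<in> carrier A"
  shows "finite {i. section_op r j a i \<noteq> 0}"
proof -
  have "finite ((\<lambda>i. j + i * int r) -` {n. a n \<noteq> 0})"
    using assms r_pos by (intro finite_vimageI) (auto simp: carrier_A inj_on_def)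
  then show ?thesis by (simp add: section_op_def vimage_def)
qed

text \<open>Two representatives differ by a multiple of \<open>N\<close>; its section is
  \<open>N\<close> acting on a sequence, which contributes the factor
  \<open>N(z) = 0\<close>.\<close>

lemma iota_class:
  assumes a: "a \<in> carrier A" and z: "z \<noteq> 0"
  shows "iota F e z (section_quot r j (class_A \<theta> (min_poly_A \<theta> r e z) a)) =
    tensor_sum (section_op r j a) (\<lambda>i. z powi i)"
proof -
  let ?C = "class_A \<theta> (min_poly_A \<theta> r e z) a"
  have "tensor_sum (section_op r j b) (\<lambda>i. z powi i) = tensor_sum (section_op r j a) (\<lambda>i. z powi i)"
    if b: "b \<in> ?C" for b
  proof -
    obtain x where x: "x \<in> carrier A" "b = (\<lambda>n. (pw (mp z) \<odot> x) n + a n)" using b class_A_mem by blast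
    have "section_op r j (pw (mp z) \<odot> x) = shift_act (mp z) (section_op r j x)"
      by (rule ext) (rule section_pw_mult)
    then have sb: "section_op r j b = (\<lambda>i. shift_act (mp z) (section_op r j x) i + section_op r j a i)"
      by (auto simp: section_op_def x(2) fun_eq_iff)
    have "tensor_sum (shift_act (mp z) (section_op r j x)) (\<lambda>i. 1 * z powi i) =
        tensor_sum (section_op r j x) (\<lambda>i. 1 * ev (mp z) z * z powi i)"
      by (rule tensor_sum_shift_act[OF finite_section[OF x(1)] z]) simp
    then have "tensor_sum (shift_act (mp z) (section_op r j x)) (\<lambda>i. z powi i) = \<one>\<^bsub>T\<^esub>" by simp
    then show ?thesis
      unfolding sb by (subst tensor_sum_add_left) (simp_all add: finite_shift_act finite_section x a)
  qed
  moreover have "?C \<noteq> {}" using class_A_mem A.zero_closed by blast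
  ultimately have "(\<lambda>b. tensor_sum b (\<lambda>i. z powi i)) ` section_op r j ` ?C =
      {tensor_sum (section_op r j a) (\<lambda>i. z powi i)}"
    by (auto simp: image_image)
  then show ?thesis by (simp add: iota_def section_quot_def tensor_sum_def)
qed

end

section \<open>Residues of a fraction with a squarefree denominator\<close>

text \<open>Replaces a factorization into linear factors by a property inherited by all divisors. If
  \<open>z\<close> is not a root of \<open>q\<close>, then \<open>Y - z\<close> divides the cofactor
  and cancels.\<close>

lemma split_divisor_has_root:
  fixes q :: "'a::field poly"
  assumes "smult c (\<Prod>z\<leftarrow>zs. [:- z, 1:]) \<noteq> 0" "q dvd smult c (\<Prod>z\<leftarrow>zs. [:- z, 1:])" "0 < degree q"
  shows "\<exists>z. poly q z = 0"
  using assms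
proof (induction zs)
  case Nil
  then have "degree q \<le> degree (smult c (1 :: 'a poly))" by (intro dvd_imp_degree_le) auto
  then show ?case using Nil.prems by simp
next
  case (Cons z zs)
  let ?p = "smult c (\<Prod>z\<leftarrow>zs. [:- z, 1:])"
  have eq: "smult c (\<Prod>z\<leftarrow>z # zs. [:- z, 1:]) = [:- z, 1:] * ?p" by simp
  obtain s where s: "[:- z, 1:] * ?p = q * s" using Cons.prems(2) unfolding eq dvd_def by blast
  have "poly (q * s) z = 0" unfolding s[symmetric] by simp
  then consider "poly q z = 0" | "poly s z = 0" by auto
  then show ?case
  proof cases
    case 2
    then obtain s' where "s = [:- z, 1:] * s'" by (auto simp: poly_eq_0_iff_dvd)
    then have "[:- z, 1:] * ?p = [:- z, 1:] * (q * s')" using s by (simp only: mult.left_commute)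
    then have "?p = q * s'" by (subst (asm) mult_left_cancel) simp_all
    moreover have "?p \<noteq> 0" using Cons.prems(1) unfolding eq by auto
    ultimately show ?thesis using Cons.IH Cons.prems(3) by (metis dvd_triv_left)
  qed blast
qed

text \<open>After division by one linear factor for each root, a nonconstant remaining factor would
  have a root, and this would be a multiple root of \<open>p\<close>.\<close>

lemma split_squarefree_eq_prod:
  fixes p :: "'a::field poly"
  assumes "p \<noteq> 0" and split: "\<And>q. q dvd p \<Longrightarrow> 0 < degree q \<Longrightarrow> \<exists>z. poly q z = 0"
    and simple: "\<And>z. poly p z = 0 \<Longrightarrow> poly (pderiv p) z \<noteq> 0"
  shows "\<exists>c. c \<noteq> 0 \<and> p = smult c (\<Prod>z | poly p z = 0. [:- z, 1:])"
proof -
  let ?Z = "{z. poly p z = 0}"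
  have "\<exists>q. p = (\<Prod>z\<in>W. [:- z, 1:]) * q" if "finite W" "W \<subseteq> ?Z" for W
    using that
  proof (induction W rule: finite_induct)
    case (insert w W)
    then obtain q where q: "p = (\<Prod>z\<in>W. [:- z, 1:]) * q" by auto
    have "poly (\<Prod>z\<in>W. [:- z, 1:]) w \<noteq> 0" using insert by (auto simp: poly_prod)
    moreover have "poly ((\<Prod>z\<in>W. [:- z, 1:]) * q) w = 0" using insert.prems q by simp
    ultimately have "poly q w = 0" by simp
    then obtain s where "q = [:- w, 1:] * s" by (auto simp: poly_eq_0_iff_dvd)
    then have "p = (\<Prod>z\<in>insert w W. [:- z, 1:]) * s" using q insert by (simp add: mult_ac del: mult_pCons_left)
    then show ?case by blast
  qed simp
  then obtain q where q: "p = (\<Prod>z\<in>?Z. [:- z, 1:]) * q" using poly_roots_finite[OF assms(1)] by blast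
  have "degree q = 0"
  proof (rule ccontr)
    assume "degree q \<noteq> 0"
    then obtain z where z: "poly q z = 0" using split[of q] q by (metis dvd_triv_right gr0I)
    have "poly ((\<Prod>z\<in>?Z. [:- z, 1:]) * q) z = 0" using z by simp
    then have pz: "poly p z = 0" using q by simp
    have "pderiv p = (\<Prod>z\<in>?Z. [:- z, 1:]) * pderiv q + q * pderiv (\<Prod>z\<in>?Z. [:- z, 1:])"
      using q pderiv_mult by metis
    moreover have "poly (\<Prod>z\<in>?Z. [:- z, 1:]) z = 0"
      using pz poly_roots_finite[OF assms(1)] by (auto simp: poly_prod)
    ultimately have "poly (pderiv p) z = 0" using z by simp
    then show False using simple pz by blast
  qed
  then obtain c where "q = [:c:]" by (rule degree_eq_zeroE)
  then have "p = smult c (\<Prod>z\<in>?Z. [:- z, 1:])" using q by simp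
  moreover have "c \<noteq> 0" using calculation assms(1) by auto
  ultimately show ?thesis by blast
qed

context taylor
begin

lemma iota_residue_regular:
  assumes "f \<in> frac_A \<theta> r" "ord_at \<theta> N \<tau> f \<ge> Fin (- 1)" "z \<noteq> 0"
    and "(P, pw D) \<in> f" "over_F D" "ev D z \<noteq> 0"
  shows "iota F e z (section_quot r j (TS_at \<theta> N \<tau> f (- 1))) = \<one>\<^bsub>T\<^esub>"
proof -
  have "TS_at \<theta> N \<tau> f (- 1) = cls (\<lambda>_. 0)"
    using residue_regular[OF assms(1,2,4-6)] by (simp add: cls_zero)
  moreover have "section_op r j (\<lambda>_. 0 :: 'k) = (\<lambda>_. 0)" by (rule ext) (simp add: section_op_def)
  moreover have "(\<lambda>_. 0) \<in> carrier A" using A.zero_closed by simp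
  ultimately show ?thesis using iota_class[OF _ assms(3)] by simp
qed

lemma iota_residue_simple_pole:
  assumes "f \<in> frac_A \<theta> r" "ord_at \<theta> N \<tau> f \<ge> Fin (- 1)" "z \<noteq> 0"
    and PD: "(P, pw D) \<in> f" "over_F D" "ev D z = 0" "ev (pderiv D) z \<noteq> 0"
  shows "iota F e z (section_quot r j (TS_at \<theta> N \<tau> f (- 1))) =
    tensor_sum (section_op r j P) (\<lambda>i. inverse (ev (pderiv D) z) * z powi i)"
proof -
  have P: "P \<in> carrier A" using frac_A_mem(1)[OF assms(1) PD(1)] .
  obtain U V where UV: "over_F U" "over_F V" "U * pderiv D + V * mp z = 1"
    using mp_bezout[OF over_F_pderiv[OF PD(2)] PD(4)] by blast
  have "ev (U * pderiv D + V * mp z) z = ev 1 z" by (simp only: UV(3))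
  \<comment> \<open>Evaluating the Bezout relation at \<open>z\<close> removes the multiple of
    \<open>mp z\<close>.\<close>
  then have U: "ev U z = inverse (ev (pderiv D) z)"
    using PD(4) by (simp add: field_simps)
  have "iota F e z (section_quot r j (TS_at \<theta> N \<tau> f (- 1))) =
      tensor_sum (section_op r j (pw U \<odot> P)) (\<lambda>i. z powi i)"
    unfolding residue_simple_pole[OF assms(1,2) PD(1-3) UV]
    by (rule iota_class[OF mult_A_closed[OF pw_closed P] assms(3)])
  also have "section_op r j (pw U \<odot> P) = shift_act U (section_op r j P)"
    by (rule ext) (rule section_pw_mult)
  also have "tensor_sum \<dots> (\<lambda>i. z powi i) = tensor_sum \<dots> (\<lambda>i. 1 * z powi i)" by simp
  also have "\<dots> = tensor_sum (section_op r j P) (\<lambda>i. 1 * ev U z * z powi i)"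
    by (rule tensor_sum_shift_act[OF finite_section[OF P] assms(3) UV(1)])
  finally show ?thesis by (simp add: U)
qed

end

text \<open>The expansion at infinity lives in the series ring in \<open>X^(-1)\<close>, which is
  twisted by the inverse automorphism.\<close>

lemma (in skew_setup) inverse_setup: "skew_setup (inv_into UNIV \<theta>) r"
proof
  have bij: "bij \<theta>" using K.aut_bij by simp
  show "inv_into UNIV \<theta> \<in> ring_iso type_ring type_ring"
    using K.inv_hom bij bij_imp_bij_inv by (auto simp: ring_iso_def)
  have "inv_into UNIV \<theta> ^^ m = id \<longleftrightarrow> \<theta> ^^ m = id" for m
  proof
    assume "\<theta> ^^ m = id"
    then show "inv_into UNIV \<theta> ^^ m = id" using inv_fn[OF bij, of m] by (metis inv_id)
  next
    assume "inv_into UNIV \<theta> ^^ m = id"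
    then have "inv_into UNIV (\<theta> ^^ m) = id" using inv_fn[OF bij, of m] by simp
    then show "\<theta> ^^ m = id" using bij_fn[OF bij] inv_inv_eq by (metis inv_id)
  qed
  then show "has_order (inv_into UNIV \<theta>) r" using theta_order by (auto simp: has_order_def)
qed

section \<open>Partial residues at 0 and at infinity\<close>

context skew_closure
begin

lemma convolution_solves:
  fixes b d :: "int \<Rightarrow> 'k"
  assumes "finite {i. b i \<noteq> 0}" "\<And>m. shift_act D d m = (if m = 0 then 1 else 0)"
  shows "shift_act D (\<lambda>m. \<Sum>i | b i \<noteq> 0. b i * d (m - i)) m = b m"
proof -
  have "shift_act D (\<lambda>m. \<Sum>i | b i \<noteq> 0. b i * d (m - i)) m =
      (\<Sum>i | b i \<noteq> 0. b i * shift_act D d (m - i))"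
    by (simp add: shift_act_sum_seq shift_act_scale_seq shift_act_shift_seq)
  also have "\<dots> = (\<Sum>i | b i \<noteq> 0. if i = m then b m else 0)"
    by (rule sum.cong) (auto simp: assms(2))
  also have "\<dots> = b m" using assms(1) by simp
  finally show ?thesis .
qed

text \<open>Only the values of \<open>d\<close> depend on the expansion; lying in \<open>F\<close>,
  they move to the right factor and leave \<open>b\<close> on the left.\<close>

lemma pt_convolution:
  assumes "finite {i. b i \<noteq> 0}" "\<And>m. d m \<in> F"
  shows "pt (\<Sum>i | b i \<noteq> 0. b i * d (m - i)) x = tensor_sum b (\<lambda>i. e (d (m - i)) * x)"
  using assms by (simp add: pt_sum_left mult.commute[of "b _"] pt_balanced tensor_sum_def)

lemma finite_support_bounds:
  fixes b :: "int \<Rightarrow> 'k"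
  assumes "finite {i. b i \<noteq> 0}"
  obtains l u where "\<And>i. b i \<noteq> 0 \<Longrightarrow> l \<le> i" "\<And>i. b i \<noteq> 0 \<Longrightarrow> i \<le> u"
  using that bdd_below_finite[OF assms] bdd_above_finite[OF assms]
  by (auto simp: bdd_below_def bdd_above_def)

context
  fixes f P D
  assumes f: "f \<in> frac_A \<theta> r" and PD: "(P, pw D) \<in> f" and D0: "coeff D 0 \<noteq> 0"
begin

private lemma P: "P \<in> carrier A" and over: "over_F D"
  using frac_A_mem[OF f PD] pw_center by auto

text \<open>The section of the expansion and the convolution of \<open>\<sigma>\<^sub>j(P)\<close>
  with \<open>d\<close> solve the same equation and are both bounded below, so they agree. The
  exponent \<open>j - r\<close> is the entry -1 of the section.\<close>

lemma residue_at_zero: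
  assumes d: "\<And>m. m < 0 \<Longrightarrow> d m = 0" "\<And>m. shift_act D d m = (if m = 0 then 1 else 0)"
  shows "pt (TS_zero \<theta> f (int j - int r)) 1 = tensor_sum (section_op r (int j) P) (\<lambda>i. e (d (- 1 - i)))"
proof -
  let ?g = "TS_zero \<theta> f" and ?b = "section_op r (int j) P"
  have fin: "finite {i. ?b i \<noteq> 0}" by (rule finite_section[OF P])
  have g: "?g \<in> carrier K.S" "pw D \<odot> ?g = P"
  proof -
    have *: "id a \<in> carrier K.S" "id (a \<odot> b) = id a \<odot> id b" if "a \<in> carrier A" for a b
      using that A_subset by auto
    have "id E \<in> Units K.S" if "E \<in> center_Z \<theta> r" "E \<noteq> (\<lambda>_. 0)" for E
      using that center_A A_Units by auto
    note char = frac_extend_char[OF S.monoid_axioms *(1) *(2) this f]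
    show "?g \<in> carrier K.S" unfolding TS_zero_def using char(1) by blast
    show "pw D \<odot> ?g = P" unfolding TS_zero_def using char(2) PD by fastforce
  qed
  \<comment> \<open>As \<open>D\<close> is over \<open>F\<close>, applying \<theta> to
    \<open>d\<close> gives another inverse of \<open>D\<close> that is bounded below.\<close>
  have dF: "d m \<in> F" for m
  proof -
    have "\<theta> (d m) - d m = 0"
    proof (rule shift_act_eq_0_below[OF D0, where b = 0])
      have "shift_act D (\<lambda>i. \<theta> (d i)) m = \<theta> (shift_act D d m)" for m
        using over by (subst shift_act_hom) (simp_all add: over_F_iff)
      then show "shift_act D (\<lambda>i. \<theta> (d i) - d i) m = 0" for m
        by (simp add: shift_act_diff_seq d(2))
    qed (simp add: d(1))
    then show ?thesis by (simp add: fixed_field_def)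
  qed
  have "section_op r (int j) ?g (- 1) - (\<Sum>i | ?b i \<noteq> 0. ?b i * d (- 1 - i)) = 0"
  proof -
    obtain n0 where n0: "\<And>n. n < n0 \<Longrightarrow> ?g n = 0" using g(1) by (auto simp: K.series_carrier)
    obtain l where l: "\<And>i. ?b i \<noteq> 0 \<Longrightarrow> l \<le> i" using finite_support_bounds[OF fin] by blast
    \<comment> \<open>For \<open>m\<close> below the first bound, \<open>m\<close> is negative and
      \<open>j + m * r \<le> j + m < n0\<close>; below \<open>l\<close>, every \<open>m - i\<close>
      in the convolution is negative.\<close>
    let ?c = "min (min n0 0 - int j) l"
    show ?thesis
    proof (rule shift_act_eq_0_below[OF D0, where b = ?c and m = "- 1" and
          x = "\<lambda>m. section_op r (int j) ?g m - (\<Sum>i | ?b i \<noteq> 0. ?b i * d (m - i))"])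
      show "shift_act D (\<lambda>m. section_op r (int j) ?g m - (\<Sum>i | ?b i \<noteq> 0. ?b i * d (m - i))) m = 0" for m
        by (simp only: shift_act_diff_seq section_pw_mult[symmetric] g(2)
            convolution_solves[OF fin d(2)] diff_self)
      show "section_op r (int j) ?g m - (\<Sum>i | ?b i \<noteq> 0. ?b i * d (m - i)) = 0" if m: "m < ?c" for m
      proof -
        have "m * int r \<le> m * 1" using m r_pos by (intro mult_left_mono_neg) auto
        then have "int j + m * int r < n0" using m by linarith
        then have "?g (int j + m * int r) = 0" by (rule n0)
        moreover have "(\<Sum>i | ?b i \<noteq> 0. ?b i * d (m - i)) = 0"
          using m by (intro sum.neutral ballI) (auto dest!: l intro!: d(1))
        ultimately show ?thesis by (simp add: section_op_def)
      qed
    qed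
  qed
  then have "TS_zero \<theta> f (int j - int r) = (\<Sum>i | ?b i \<noteq> 0. ?b i * d (- 1 - i))"
    by (simp add: section_op_def)
  then show ?thesis using pt_convolution[OF fin dF, where m = "- 1" and x = 1] by simp
qed

text \<open>The second claim is the equation \<open>D TS = P\<close>, with the coefficients of the
  expansion rewritten in powers of \<open>X\<close>.\<close>

lemma TS_infinity_props:
  shows "\<exists>n0. \<forall>n<n0. TS_infinity \<theta> f n = 0"
    and "(\<Sum>k\<le>degree D. coeff D k * TS_infinity \<theta> f (int r * int k - n)) = P n"
proof -
  let ?v = "inv_into UNIV \<theta>" and ?g = "TS_infinity \<theta> f"
  interpret I: skew_setup ?v r by (rule inverse_setup)
  have bij: "bij \<theta>" using K.aut_bij by simp
  \<comment> \<open>This is what makes the reversal of exponents multiplicative between the two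
    twisted rings.\<close>
  have tw: "I.K.tw i = K.tw (- i)" for i
    by (rule ext) (auto simp: int_pow_map_def inv_inv_eq[OF bij])
  define flip :: "(int \<Rightarrow> 'k) \<Rightarrow> int \<Rightarrow> 'k" where "flip a n = a (- n)" for a n
  have flip_A: "flip a \<in> carrier I.A" if "a \<in> carrier A" for a
  proof -
    have "finite (uminus -` {n. a n \<noteq> 0})" using that by (intro finite_vimageI) (auto simp: carrier_A)
    then show ?thesis by (simp add: I.carrier_A flip_def vimage_def)
  qed
  have flip_mult: "flip (a \<odot> b) = flip a \<otimes>\<^bsub>I.K.S\<^esub> flip b" if a: "a \<in> carrier A" and b: "b \<in> carrier A" for a b
  proof
    fix n
    let ?M = "{i. a i \<noteq> 0}"
    have fin: "finite ?M" using a by (simp add: carrier_A)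
    have "(flip a \<otimes>\<^bsub>I.K.S\<^esub> flip b) n = (\<Sum>i\<in>uminus ` ?M. flip a i * K.tw (- i) (flip b (n - i)))"
      using fin by (subst I.K.series_mult_on[where I = "uminus ` ?M"])
        (auto simp: finsum_type_ring flip_def tw intro!: image_eqI[of _ _ "- _"])
    also have "\<dots> = (\<Sum>i\<in>?M. a i * K.tw i (b (- n - i)))"
      by (subst sum.reindex) (auto simp: flip_def minus_diff_commute intro!: sum.cong)
    also have "\<dots> = (a \<odot> b) (- n)"
      using fin by (subst K.series_mult_on[where I = ?M]) (auto simp: finsum_type_ring)
    finally show "flip (a \<odot> b) n = (flip a \<otimes>\<^bsub>I.K.S\<^esub> flip b) n" by (simp add: flip_def)
  qed
  have flip_Units: "flip E \<in> Units I.K.S" if E: "E \<in> center_Z \<theta> r" "E \<noteq> (\<lambda>_. 0)" for E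
  proof (rule I.A_Units)
    show "flip E \<in> carrier I.A" using E center_A flip_A by blast
    obtain n where "E n \<noteq> 0" using E(2) by auto
    then have "flip E (- n) \<noteq> 0" by (simp add: flip_def)
    then show "flip E \<noteq> (\<lambda>_. 0)" by metis
  qed
  have closed: "flip a \<in> carrier I.K.S" if "a \<in> carrier A" for a
    using flip_A[OF that] I.A_subset by blast
  have g_eq: "?g = frac_extend I.K.S flip f"
  proof -
    have "flip = (\<lambda>a n. a (- n))" by (intro ext) (simp add: flip_def)
    then show ?thesis by (simp add: TS_infinity_def)
  qed
  note char = frac_extend_char[OF I.S.monoid_axioms closed flip_mult flip_Units f]
  have g: "?g \<in> carrier I.K.S" unfolding g_eq using char(1) by blast
  have eq: "flip (pw D) \<otimes>\<^bsub>I.K.S\<^esub> ?g = flip P" unfolding g_eq using char(2) PD by blast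
  show "\<exists>n0. \<forall>n<n0. ?g n = 0" using g by (simp add: I.K.series_carrier)
  let ?J = "(\<lambda>k. - (int r * int k)) ` {..degree D}"
  have inj: "inj_on (\<lambda>k. - (int r * int k)) {..degree D}" using r_pos by (auto simp: inj_on_def)
  have "P n = (flip (pw D) \<otimes>\<^bsub>I.K.S\<^esub> ?g) (- n)" unfolding eq by (simp add: flip_def)
  also have "\<dots> = (\<Sum>i\<in>?J. flip (pw D) i * K.tw (- i) (?g (- n - i)))"
  proof (subst I.K.series_mult_on[where I = ?J])
    fix i assume "flip (pw D) i \<noteq> \<zero>\<^bsub>type_ring\<^esub>"
    then have "pw D (- i) \<noteq> 0" by (simp add: flip_def)
    then obtain k where "k \<le> degree D" "- i = int r * int k" by (rule pw_nonzeroE)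
    then show "i \<in> ?J" by (intro image_eqI[of _ _ k]) auto
  qed (simp_all add: finsum_type_ring tw)
  also have "\<dots> = (\<Sum>k\<le>degree D. coeff D k * ?g (int r * int k - n))"
    by (subst sum.reindex[OF inj]) (auto simp: flip_def intro!: sum.cong)
  finally show "(\<Sum>k\<le>degree D. coeff D k * ?g (int r * int k - n)) = P n" by simp
qed

lemma residue_at_infinity:
  assumes d: "\<And>m. u < m \<Longrightarrow> d m = 0" "\<And>m. shift_act D d m = (if m = 0 then 1 else 0)"
  shows "pt (- TS_infinity \<theta> f (int r - int j)) 1 =
    tensor_sum (section_op r (int j) P) (\<lambda>i. - e (d (- 1 - i)))"
proof -
  let ?b = "section_op r (int j) P"
  define g where "g n = TS_infinity \<theta> f (- n)" for n
  have fin: "finite {i. ?b i \<noteq> 0}" by (rule finite_section[OF P])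
  have dF: "d m \<in> F" for m
  proof -
    have "\<theta> (d m) - d m = 0"
    proof (rule shift_act_eq_0_above[OF D0, where b = u])
      have "shift_act D (\<lambda>i. \<theta> (d i)) m = \<theta> (shift_act D d m)" for m
        using over by (subst shift_act_hom) (simp_all add: over_F_iff)
      then show "shift_act D (\<lambda>i. \<theta> (d i) - d i) m = 0" for m
        by (simp add: shift_act_diff_seq d(2))
    qed (simp add: d(1))
    then show ?thesis by (simp add: fixed_field_def)
  qed
  have sg: "shift_act D (section_op r (int j) g) m = ?b m" for m
  proof -
    have "shift_act D (section_op r (int j) g) m =
        (\<Sum>k\<le>degree D. coeff D k * TS_infinity \<theta> f (int r * int k - (int j + m * int r)))"
      by (simp add: shift_act_def section_op_def g_def algebra_simps)
    then show ?thesis by (simp only: TS_infinity_props(2)) (simp add: section_op_def)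
  qed
  have "section_op r (int j) g (- 1) - (\<Sum>i | ?b i \<noteq> 0. ?b i * d (- 1 - i)) = 0"
  proof -
    obtain n0 where "\<And>n. n < n0 \<Longrightarrow> TS_infinity \<theta> f n = 0" using TS_infinity_props(1) by blast
    then have n0: "g n = 0" if "- n0 < n" for n using that by (simp add: g_def)
    obtain l where l: "\<And>i. ?b i \<noteq> 0 \<Longrightarrow> i \<le> l" using finite_support_bounds[OF fin] by blast
    \<comment> \<open>For positive \<open>m\<close> above \<open>- n0\<close>,
      \<open>j + m * r\<close> also exceeds \<open>- n0\<close>; for \<open>m\<close> above
      \<open>l + u\<close>, every \<open>m - i\<close> in the convolution exceeds
      \<open>u\<close>.\<close>
    let ?c = "max (max (- n0) 0) (l + u)"
    show ?thesis
    proof (rule shift_act_eq_0_above[OF D0, where b = ?c and m = "- 1" and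
          x = "\<lambda>m. section_op r (int j) g m - (\<Sum>i | ?b i \<noteq> 0. ?b i * d (m - i))"])
      show "shift_act D (\<lambda>m. section_op r (int j) g m - (\<Sum>i | ?b i \<noteq> 0. ?b i * d (m - i))) m = 0" for m
        by (simp only: shift_act_diff_seq sg convolution_solves[OF fin d(2)] diff_self)
      show "section_op r (int j) g m - (\<Sum>i | ?b i \<noteq> 0. ?b i * d (m - i)) = 0" if m: "?c < m" for m
      proof -
        have "m * 1 \<le> m * int r" using m r_pos by (intro mult_left_mono) auto
        then have "- n0 < int j + m * int r" using m by linarith
        then have "g (int j + m * int r) = 0" by (rule n0)
        moreover have "(\<Sum>i | ?b i \<noteq> 0. ?b i * d (m - i)) = 0"
          using m by (intro sum.neutral ballI) (auto dest!: l intro!: d(1))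
        ultimately show ?thesis by (simp add: section_op_def)
      qed
    qed
  qed
  then have "TS_infinity \<theta> f (int r - int j) = (\<Sum>i | ?b i \<noteq> 0. ?b i * d (- 1 - i))"
    by (simp add: section_op_def g_def)
  \<comment> \<open>The sign in the definition of the residue at infinity crosses the tensor sign
    because -1 lies in \<open>F\<close>.\<close>
  moreover have "pt (- a) 1 = pt a (- 1)" for a
    using pt_balanced[of "- 1" a 1] by (simp add: fixed_field_def)
  ultimately show ?thesis using pt_convolution[OF fin dF, where m = "- 1" and x = "- 1"] by simp
qed

end

end

section \<open>Choice of the denominator and the sum of the residues\<close>

context skew_closure
begin

lemma simple_denominator:
  assumes f: "f \<in> frac_A \<theta> r" and poles: "poles_in_separable_closure r e f"
    and adm: "\<And>z. z \<noteq> 0 \<Longrightarrow> admissible \<theta> r (min_poly_A \<theta> r e z) (\<tau> z)"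
    and ord: "\<And>z. z \<noteq> 0 \<Longrightarrow> ord_at \<theta> (min_poly_A \<theta> r e z) (\<tau> z) f \<ge> Fin (- 1)"
  obtains P D where "(P, pw D) \<in> f" "over_F D" "coeff D 0 \<noteq> 0"
    "\<And>z. ev D z = 0 \<Longrightarrow> ev (pderiv D) z \<noteq> 0"
    "\<And>q. q dvd map_poly e D \<Longrightarrow> 0 < degree q \<Longrightarrow> \<exists>z. poly q z = 0"
proof -
  \<comment> \<open>The degree is minimized only among denominators with this property; it passes to
    factors, so a cancelled denominator competes again.\<close>
  define split where "split D \<longleftrightarrow> (\<exists>P. (P, pw D) \<in> f) \<and>
    (\<forall>q. q dvd map_poly e D \<and> 0 < degree q \<longrightarrow> (\<exists>z. poly q z = 0))" for D
  obtain P1 D1 c zs where 1: "(P1, pw D1) \<in> f" "map_poly e D1 = smult c (\<Prod>z\<leftarrow>zs. [:- z, 1:])"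
    using poles by (auto simp: poles_in_separable_closure_def)
  have "D1 \<noteq> 0" using frac_A_mem(3)[OF f 1(1)] by simp
  then have "map_poly e D1 \<noteq> 0" by (subst map_poly_eq_0_iff) auto
  then have "split D1" using 1 split_divisor_has_root unfolding split_def by metis
  then obtain D where D: "split D" and min: "\<And>D'. split D' \<Longrightarrow> degree D \<le> degree D'"
    using ex_has_least_nat[of split D1 degree] by blast
  then obtain P where PD: "(P, pw D) \<in> f" unfolding split_def by blast
  have over: "over_F D" and P: "P \<in> carrier A" and nz: "D \<noteq> 0"
    using frac_A_mem[OF f PD] pw_center by auto
  have smaller: False if "(P', pw D') \<in> f" "D = M * D'" "0 < degree M" for P' D' M
  proof -
    have "map_poly e D = map_poly e M * map_poly e D'" unfolding that(2) by (simp add: map_poly_hom_mult)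
    then have "split D'" using D that(1) unfolding split_def by (metis dvd_mult)
    moreover have "degree D' < degree D" using that nz by (auto simp: degree_mult_eq)
    ultimately show False using min by (simp add: not_le[symmetric])
  qed
  have "coeff D 0 \<noteq> 0"
  proof
    assume "coeff D 0 = 0"
    then obtain D' where D': "D = [:0, 1:] * D'" by (cases D) auto
    have Y: "lm 1 (int r) \<in> center_Z \<theta> r" "lm 1 (int r) \<noteq> (\<lambda>_. 0)"
      unfolding pw_Y[symmetric] by (simp_all add: pw_center)
    have "over_F D'" using over unfolding D' poly_over_def by (auto simp: coeff_pCons split: nat.splits)
    \<comment> \<open>The factor \<open>Y\<close> of \<open>D\<close> is moved to the numerator as
      \<open>X^(-r)\<close>, which exists in \<open>A\<close>.\<close>
    define P' where "P' = lm 1 (- int r) \<odot> P"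
    have "lm 1 (int r) \<odot> P' = (lm 1 (int r) \<odot> lm 1 (- int r)) \<odot> P"
      using A.m_assoc[OF lm_closed lm_closed P] by (simp add: P'_def)
    also have "\<dots> = P" using A.l_one[OF P] by (simp add: lm_mult K.series_one_monom)
    finally have "(lm 1 (int r) \<odot> P', lm 1 (int r) \<odot> pw D') \<in> f"
      using PD by (simp add: D' pw_mult[symmetric] pw_Y[symmetric])
    then have "(P', pw D') \<in> f"
      using frac_A_cancel[OF f _ Y] pw_center \<open>over_F D'\<close> mult_A_closed[OF lm_closed P] P'_def by blast
    then show False using smaller D' by (metis degree_pCons_eq_if one_neq_zero pCons_eq_0_iff zero_less_Suc)
  qed
  moreover have "ev (pderiv D) z \<noteq> 0" if z: "ev D z = 0" for z
  proof
    assume d: "ev (pderiv D) z = 0"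
    \<comment> \<open>The hypotheses on orders and on admissible morphisms concern nonzero points
      only, so the constant term of \<open>D\<close> had to be settled before.\<close>
    have "z \<noteq> 0" using z calculation by (auto simp: poly_0_coeff_0 coeff_map_poly)
    then interpret taylor \<theta> r e z "\<tau> z" by unfold_locales (rule adm)
    show False
      using multiple_root_cancel[OF f ord[OF \<open>z \<noteq> 0\<close>] PD over z d] smaller degree_mp by metis
  qed
  ultimately show thesis using that PD over D unfolding split_def by blast
qed

lemma residue_theorem:
  assumes f: "f \<in> frac_A \<theta> r" and poles: "poles_in_separable_closure r e f"
    and adm: "\<And>z. z \<noteq> 0 \<Longrightarrow> admissible \<theta> r (min_poly_A \<theta> r e z) (\<tau> z)"
    and ord: "\<And>z. z \<noteq> 0 \<Longrightarrow> ord_at \<theta> (min_poly_A \<theta> r e z) (\<tau> z) f \<ge> Fin (- 1)"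
  shows "finite {p. partial_skew_residue \<theta> r e \<tau> j f p \<noteq> \<one>\<^bsub>T\<^esub>} \<and>
    finprod T (partial_skew_residue \<theta> r e \<tau> j f)
      {p. partial_skew_residue \<theta> r e \<tau> j f p \<noteq> \<one>\<^bsub>T\<^esub>} = \<one>\<^bsub>T\<^esub>"
proof -
  let ?res = "partial_skew_residue \<theta> r e \<tau> j f"
  obtain P D where PD: "(P, pw D) \<in> f" and over: "over_F D" and D0: "coeff D 0 \<noteq> 0"
    and simple: "\<And>z. ev D z = 0 \<Longrightarrow> ev (pderiv D) z \<noteq> 0"
    and split: "\<And>q. q dvd map_poly e D \<Longrightarrow> 0 < degree q \<Longrightarrow> \<exists>z. poly q z = 0"
    using simple_denominator[OF f poles adm ord] by blast
  let ?E = "map_poly e D" and ?b = "section_op r (int j) P"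
  have pd: "pderiv ?E = map_poly e (pderiv D)" by (rule map_poly_hom_pderiv[symmetric]) simp_all
  have "D \<noteq> 0" using D0 by auto
  then have E0: "?E \<noteq> 0" by (subst map_poly_eq_0_iff) auto
  define Z where "Z = {z. ev D z = 0}"
  have finZ: "finite Z" unfolding Z_def by (rule poly_roots_finite[OF E0])
  have nzZ: "0 \<notin> Z" using D0 by (simp add: Z_def poly_0_coeff_0 coeff_map_poly)
  obtain c where c: "c \<noteq> 0" "?E = smult c (\<Prod>z\<in>Z. [:- z, 1:])"
    using split_squarefree_eq_prod[OF E0 split] simple unfolding pd Z_def by blast
  obtain d where d: "\<And>m. m < 0 \<Longrightarrow> d m = 0" "\<And>m. shift_act D d m = (if m = 0 then 1 else 0)"
    using shift_act_inverse_below[OF D0] by blast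
  obtain d' where d': "\<And>m. - int (degree D) < m \<Longrightarrow> d' m = 0"
      "\<And>m. shift_act D d' m = (if m = 0 then 1 else 0)"
    using shift_act_inverse_above[OF D0] by blast
  have e_act: "shift_act ?E (\<lambda>i. e (x i)) m = (if m = 0 then 1 else 0)"
    if "\<And>m. shift_act D x m = (if m = 0 then 1 else 0)" for x m
    using shift_act_hom[of e D x m] that by (simp split: if_splits)
  \<comment> \<open>\<open>w p i\<close> is the residue of \<open>Y^i / D\<close> at
    \<open>p\<close>, with the intended meaning on \<open>S0\<close>; \<open>d\<close> and
    \<open>d'\<close> expand \<open>1 / D\<close> at 0 and at infinity.\<close>
  define w where "w p = (\<lambda>i. case p of None \<Rightarrow> - e (d' (- 1 - i)) | Some z \<Rightarrow>
      if z = 0 then e (d (- 1 - i)) else inverse (ev (pderiv D) z) * z powi i)" for p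
  define S0 where "S0 = insert None (insert (Some 0) (Some ` Z))"
  have res: "?res p = tensor_sum ?b (w p)" if "p \<in> S0" for p
  proof (cases p)
    case None
    then show ?thesis
      using residue_at_infinity[OF f PD D0 d', of j] by (simp add: partial_skew_residue_def w_def)
  next
    case (Some z)
    show ?thesis
    proof (cases "z = 0")
      case True
      then show ?thesis
        using Some residue_at_zero[OF f PD D0 d] by (simp add: partial_skew_residue_def w_def)
    next
      case False
      then have z: "ev D z = 0" using that Some by (auto simp: S0_def Z_def)
      interpret taylor \<theta> r e z "\<tau> z" using False by unfold_locales (rule adm)
      show ?thesis
        using iota_residue_simple_pole[OF f ord[OF False] False PD over z simple[OF z]] False Some
        by (simp add: partial_skew_residue_def w_def)
    qed
  qed
  have "?res p = \<one>\<^bsub>T\<^esub>" if p_out: "p \<notin> S0" for p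
  proof -
    obtain z where p: "p = Some z" using p_out by (cases p) (auto simp: S0_def)
    then have z: "z \<noteq> 0" "ev D z \<noteq> 0" using p_out by (auto simp: S0_def Z_def)
    interpret taylor \<theta> r e z "\<tau> z" using z(1) by unfold_locales (rule adm)
    show ?thesis
      using iota_residue_regular[OF f ord[OF z(1)] z(1) PD over z(2)] z(1)
      by (simp add: partial_skew_residue_def p)
  qed
  then have sub: "{p. ?res p \<noteq> \<one>\<^bsub>T\<^esub>} \<subseteq> S0" by blast
  have finS: "finite S0" using finZ by (simp add: S0_def)
  have total: "(\<Sum>p\<in>S0. w p i) = 0" for i
  proof -
    have "(\<Sum>p\<in>S0. w p i) = w None i + (w (Some 0) i + (\<Sum>z\<in>Z. w (Some z) i))"
    proof -
      \<comment> \<open>As 0 is not a root of \<open>D\<close>, its residue is counted once.\<close>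
      have "Some 0 \<notin> Some ` Z" "None \<notin> insert (Some 0) (Some ` Z)" using nzZ by auto
      then show ?thesis using finZ by (simp add: S0_def sum.reindex)
    qed
    also have "(\<Sum>z\<in>Z. w (Some z) i) = (\<Sum>z\<in>Z. inverse (poly (pderiv ?E) z) * z powi i)"
      using nzZ by (intro sum.cong) (auto simp: w_def pd)
    also have "w None i + (w (Some 0) i + \<dots>) = \<dots> + e (d (- 1 - i)) - e (d' (- 1 - i))"
      by (simp add: w_def)
    also have "\<dots> = 0"
      using residue_sum_reciprocal[OF finZ c(2,1) nzZ, of "\<lambda>m. e (d m)" "- int (degree D)" "\<lambda>m. e (d' m)" i]
        d(1) d'(1) e_act[OF d(2)] e_act[OF d'(2)] by simp
    finally show ?thesis .
  qed
  \<comment> \<open>Points of \<open>S0\<close> with trivial residue contribute the unit, so the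
    exact support may be replaced by \<open>S0\<close>.\<close>
  have "finprod T ?res {p. ?res p \<noteq> \<one>\<^bsub>T\<^esub>} = finprod T (\<lambda>p. tensor_sum ?b (w p)) S0"
    using sub finS res by (intro T.finprod_mono_neutral_cong_left) auto
  also have "\<dots> = tensor_sum ?b (\<lambda>i. \<Sum>p\<in>S0. w p i)"
    by (rule tensor_sum_sum_right[OF finS, symmetric])
  also have "\<dots> = \<one>\<^bsub>T\<^esub>" by (simp add: total)
  finally show ?thesis using sub finS finite_subset by blast
qed

end

theorem theorem3p2p2:
  fixes \<theta> :: "'k::field \<Rightarrow> 'k" and r :: nat
    and e :: "'k \<Rightarrow> 'l::field"
    and \<tau> :: "'l \<Rightarrow> (nat \<Rightarrow> (int \<Rightarrow> 'k) set) \<Rightarrow> int \<Rightarrow> (int \<Rightarrow> 'k) set"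
    and f :: "((int \<Rightarrow> 'k) \<times> (int \<Rightarrow> 'k)) set"
  assumes "\<theta> \<in> ring_iso type_ring type_ring" and "has_order \<theta> r"
    and "e \<in> ring_hom type_ring type_ring" and "separable_closure (fixed_field \<theta>) e"
    and "\<And>z. z \<noteq> 0 \<Longrightarrow> admissible \<theta> r (min_poly_A \<theta> r e z) (\<tau> z)"
    and "f \<in> frac_A \<theta> r"
    and "poles_in_separable_closure r e f"
    and "\<And>z. z \<noteq> 0 \<Longrightarrow> ord_at \<theta> (min_poly_A \<theta> r e z) (\<tau> z) f \<ge> Fin (- 1)"
  shows "\<forall>j<r.
    finite {p. partial_skew_residue \<theta> r e \<tau> j f p \<noteq> \<one>\<^bsub>tensor_product (fixed_field \<theta>) e\<^esub>} \<and>
    finprod (tensor_product (fixed_field \<theta>) e) (partial_skew_residue \<theta> r e \<tau> j f)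
      {p. partial_skew_residue \<theta> r e \<tau> j f p \<noteq> \<one>\<^bsub>tensor_product (fixed_field \<theta>) e\<^esub>} =
    \<one>\<^bsub>tensor_product (fixed_field \<theta>) e\<^esub>"
proof -
  interpret skew_closure \<theta> r e
    using assms(1-4) by unfold_locales
  show ?thesis using residue_theorem[OF assms(6,7,5,8)] by blast
qed

end
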